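(* Let $c>3$ and let $p_{lk}=n^{-c}$ for all nodes in the Bayesian CART prior. Let $L=L_n\le L_{\max}$ with $L\to\infty$ as $n\to\infty$, and suppose $f_0$ satisfies Assumption (F)(a) or Assumption (F)(b) (stated in the context) with the constant $A>0$ (independent of $n$) sufficiently large. Then, for all sufficiently large $n$, with probability at least $1-4/n-e^{-n/8}$, the $\epsilon$-mixing time of the Informed Twiggy Bayesian CART Markov chain satisfies $$\tau_\epsilon\lesssim\log(6/\epsilon)\,\max\left(\frac{9\,(C_{f_0}+2)^2}{A^2}\,\frac{2^L\,n}{\log^2n},\ 2^{L+5}\right).$$ For the Informed Bayesian CART Markov chain the same bound holds, but only under Assumption (F)(a).
   Context: Model: $n=2^{L_{\max}+1}$, $x_i=i/n$, and $Y_i=f_0(x_i)+\varepsilon_i$ for $i=1,\dots,n$ with $\varepsilon_i$ i.i.d. $\mathcal N(0,1)$; probability refers to the law of $Y=(Y_1,\dots,Y_n)'$. Haar basis: $\psi_{-10}=I_{[0,1]}$ and $\psi_{lk}(x)=2^{l/2}\psi(2^lx-k)$ for $l\ge 0$, $0\le k<2^l$, with $\psi=I_{(0,1/2]}-I_{(1/2,1]}$. $\boldsymbol{X}$ is the $n\times p$ matrix, $p=2^{L_{\max}}=n/2$, whose columns are $(\psi_{lk}(x_i))_{i\le n}$ for $(l,k)=(-1,0)$ and $0\le l<L_{\max}$, $0\le k<2^l$ (so $\boldsymbol{X}'\boldsymbol{X}=nI_p$). $a\lesssim b$ means $a\le Cb$ for a constant $C>0$ not depending on $n,L,\epsilon$.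 Trees: a tree $\mathcal T$ of depth at most $L$ is determined by its set of internal nodes $\mathcal T_{int}$, consisting of $(-1,0)$ together with a (possibly empty) set of nodes $(l,k)$, $0\le l<L$, $0\le k<2^l$, that contains with each $(l,k)$, $l\ge1$, its parent $(l-1,\lfloor k/2\rfloor)$. The children of $(l,k)$ ($l\ge 0$) are $(l+1,2k),(l+1,2k+1)$; the only child of $(-1,0)$ is $(0,0)$. The external nodes $\mathcal T_{ext}$ are the nodes not in $\mathcal T_{int}$ that are children of nodes in $\mathcal T_{int}$. $\mathbb T_L$ is the set of all such trees; $\mathcal T_{null}$ has internal node set $\{(-1,0)\}$; $\mathcal T^L_{full}$ has all nodes with $l<L$ internal. $\mathcal T\subset\mathcal T'$ means $\mathcal T_{int}\subset\mathcal T'_{int}$. Bayesian CART prior and posterior: $\Pi(\mathcal T)\propto\prod_{(l,k)\in\mathcal T_{int}}p_{lk}\prod_{(l,k)\in\mathcal T_{ext}}(1-p_{lk})$ on $\mathbb T_L$; given $\mathcal T$, the coefficients $\beta_{lk}$, $(l,k)\in\mathcal T_{int}$, are i.i.d. $\mathcal N(0,1)$ and all others are $0$; the likelihood is $Y\mid\beta\sim\mathcal N(\boldsymbol{X}\beta,I_n)$. Equivalently $\Pi(\mathcal T\mid Y)\propto\Pi(\mathcal T)N_Y(\mathcal T)$ with $N_Y(\mathcal T)=(2\pi)^{-n/2}(1+n)^{-|\mathcal T_{ext}|/2}\exp\{-\frac12Y'[I-\boldsymbol{X}_{\mathcal T}\Sigma_{\mathcal T}\boldsymbol{X}_{\mathcal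 T}']Y\}$, $\Sigma_{\mathcal T}=\frac n{n+1}(\boldsymbol{X}_{\mathcal T}'\boldsymbol{X}_{\mathcal T})^{-1}$, $\boldsymbol{X}_{\mathcal T}$ being the columns of $\boldsymbol{X}$ indexed by $\mathcal T_{int}$. Assumption (F): $f_0=\sum_{(l,k)\in\mathcal B}\beta^*_{lk}\psi_{lk}$ for some $\mathcal B\subseteq\{(l,k):l<L\}$ with $A\log n/\sqrt n<|\beta^*_{lk}|<C_{f_0}$ for all $(l,k)\in\mathcal B$, for constants $A>0$, $C_{f_0}>0$. $\mathcal T^*\in\mathbb T_L$ denotes the smallest tree with $\mathcal B\subseteq\mathcal T^*_{int}$. (a): $\mathcal B$ is itself the internal node set of a tree, i.e. $\mathcal T^*_{int}=\mathcal B$. (b): $\mathcal B$ is not the internal node set of a tree in $\mathbb T_L$. Neighborhoods. Bayesian CART: $\mathcal N_g(\mathcal T)=\{\mathcal T'\in\mathbb T_L:\mathcal T'\supset\mathcal T,|\mathcal T'_{int}\setminus\mathcal T_{int}|=1\}$, $\mathcal N_p(\mathcal T)=\{\mathcal T'\in\mathbb T_L:\mathcal T'\subset\mathcal T,|\mathcal T_{int}\setminus\mathcal T'_{int}|=1\}$. Twiggy Bayesian CART: a twig $[(l,k)\leftrightarrow(l',k')]$, with $(l,k)$ equal to or an ancestor of $(l',k')$ and $0\le l\le l'<L$, is the set of nodes on the path from $(l,k)$ to $(l',k')$ (both included); $\mathcal N_g(\mathcal T)$ is the set of trees in $\mathbb T_L$ with internal node set $\mathcal T_{int}\cup[(l,k)\leftrightarrow(l',k')]$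 for some $(l,k)\in\mathcal T_{ext}$; $\mathcal N_p(\mathcal T)$ is the set of trees with internal node set $\mathcal T_{int}\setminus D$, where $D$ is the set consisting of some internal node $(l,k)$, $l\ge0$, and all its internal descendants in $\mathcal T$, and $D$ is a twig. Informed chains (Metropolis--Hastings on $\mathbb T_L$): with probability $1/2$ each, propose GROW or PRUNE (always GROW at $\mathcal T_{null}$, always PRUNE at $\mathcal T^L_{full}$), where $S_{GROW}(\mathcal T\to\widetilde{\mathcal T})=\frac{w_g(\widetilde{\mathcal T}\mid\mathcal T)}{Z_g(\mathcal T)}\mathbb I_{\mathcal N_g(\mathcal T)}(\widetilde{\mathcal T})$ and $S_{PRUNE}(\mathcal T\to\widetilde{\mathcal T})=\frac{w_p(\widetilde{\mathcal T}\mid\mathcal T)}{Z_p(\mathcal T)}\mathbb I_{\mathcal N_p(\mathcal T)}(\widetilde{\mathcal T})$, with $$w_g(\widetilde{\mathcal T}\mid\mathcal T)=\min\Big\{\tfrac{\Pi(\widetilde{\mathcal T}\mid Y)}{\Pi(\mathcal T\mid Y)},n^{(A^2\log n)/8}\Big\},\quad w_p(\widetilde{\mathcal T}\mid\mathcal T)=\min\Big\{\max\Big(1,\tfrac{\Pi(\widetilde{\mathcal T}\mid Y)}{\Pi(\mathcal T\mid Y)}\Big),n^{c-3/2}\Big\},$$ $Z_g(\mathcal T)=\sum_{\widetilde{\mathcal T}\in\mathcal N_g(\mathcal T)}w_g(\widetilde{\mathcal T}\mid\mathcal T)$ and $Z_p(\mathcal T)=\sum_{\widetilde{\mathcal T}\in\mathcal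 N_p(\mathcal T)}w_p(\widetilde{\mathcal T}\mid\mathcal T)$ (here $A>0$ is the constant in the signal lower bound $A\log n/\sqrt n<|\beta^*_{lk}|$ of Assumption (F), and $c>3$ is the exponent in the split probability $p_{lk}=n^{-c}$ of the Bayesian CART prior). With $S$ the overall proposal probability, accept with probability $\min\{1,\frac{\Pi(\widetilde{\mathcal T}\mid Y)S(\widetilde{\mathcal T}\to\mathcal T)}{\Pi(\mathcal T\mid Y)S(\mathcal T\to\widetilde{\mathcal T})}\}$, otherwise stay. Using the Bayesian CART (resp. Twiggy) neighborhoods gives Informed Bayesian CART (resp. Informed Twiggy Bayesian CART). With $\widetilde P$ the resulting transition matrix, the chain whose mixing is measured is the lazy chain $P=\widetilde P/2+I/2$. Mixing time: $\tau_\epsilon=\max_{\mathcal T\in\mathbb T_L}\min\{t\in\mathbb N:\|P^{t'}(\mathcal T,\cdot)-\Pi(\cdot\mid Y)\|_{TV}\le\epsilon\text{ for all }t'\ge t\}$, $\epsilon\in(0,1)$. *)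

theory Defs
  imports "HOL-Probability.Probability"
begin

section \<open>Haar functions and trees\<close>

text \<open>A node \<open>(l, k)\<close> consists of a level \<open>l \<ge> -1\<close> and a position \<open>k\<close>.  A tree is represented by
  its set of internal nodes.\<close>

type_synonym node = "int \<times> nat"
type_synonym tree = "node set"

definition haar_mother :: "real \<Rightarrow> real" where
  "haar_mother x = indicator {0<..1/2} x - indicator {1/2<..1} x"

fun haar :: "node \<Rightarrow> real \<Rightarrow> real" where
  "haar (l, k) x =
     (if l = -1 then indicator {0..1} x
      else 2 powr (real_of_int l / 2) * haar_mother (2 powi l * x - real k))"

definition nodes :: "nat \<Rightarrow> node set" where
  "nodes L = insert (-1, 0) {(l, k). 0 \<le> l \<and> l < int L \<and> k < 2 ^ nat l}"

fun children :: "node \<Rightarrow> node set" where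
  "children (l, k) = (if l = -1 then {(0, 0)} else {(l + 1, 2 * k), (l + 1, 2 * k + 1)})"

definition trees :: "nat \<Rightarrow> tree set" where
  "trees L = {T. T \<subseteq> nodes L \<and> (-1, 0) \<in> T \<and>
                 (\<forall>(l, k) \<in> T. 1 \<le> l \<longrightarrow> (l - 1, k div 2) \<in> T)}"

definition ext_nodes :: "tree \<Rightarrow> node set" where
  "ext_nodes T = (\<Union>v\<in>T. children v) - T"

definition null_tree :: tree where
  "null_tree = {(-1, 0)}"

definition full_tree :: "nat \<Rightarrow> tree" where
  "full_tree L = nodes L"

text \<open>\<open>(u, v) \<in> anc\<close> iff \<open>u\<close> is equal to or an ancestor of \<open>v\<close>.\<close>

definition anc :: "(node \<times> node) set" where
  "anc = {(u, v). v \<in> children u}\<^sup>*"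

definition path_between :: "node \<Rightarrow> node \<Rightarrow> node set" where
  "path_between u v = {w. (u, w) \<in> anc \<and> (w, v) \<in> anc}"

definition twig_ends :: "nat \<Rightarrow> node \<Rightarrow> node \<Rightarrow> bool" where
  "twig_ends L u v \<longleftrightarrow> (u, v) \<in> anc \<and> 0 \<le> fst u \<and> fst u \<le> fst v \<and> fst v < int L"

section \<open>Neighborhoods\<close>

definition cart_grow :: "nat \<Rightarrow> tree \<Rightarrow> tree set" where
  "cart_grow L T = {T' \<in> trees L. T \<subseteq> T' \<and> card (T' - T) = 1}"

definition cart_prune :: "nat \<Rightarrow> tree \<Rightarrow> tree set" where
  "cart_prune L T = {T' \<in> trees L. T' \<subseteq> T \<and> card (T - T') = 1}"

definition twiggy_grow :: "nat \<Rightarrow> tree \<Rightarrow> tree set" where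
  "twiggy_grow L T =
     {T' \<in> trees L. \<exists>u \<in> ext_nodes T. \<exists>v. twig_ends L u v \<and> T' = T \<union> path_between u v}"

definition twiggy_prune :: "nat \<Rightarrow> tree \<Rightarrow> tree set" where
  "twiggy_prune L T =
     {T' \<in> trees L. \<exists>u \<in> T. 0 \<le> fst u \<and>
        (let D = {v \<in> T. (u, v) \<in> anc}
         in (\<exists>a b. twig_ends L a b \<and> D = path_between a b) \<and> T' = T - D)}"

section \<open>Prior and posterior\<close>

definition tree_weight :: "(node \<Rightarrow> real) \<Rightarrow> tree \<Rightarrow> real" where
  "tree_weight p T = (\<Prod>v\<in>T. p v) * (\<Prod>v\<in>ext_nodes T. 1 - p v)"

definition tree_prior :: "(node \<Rightarrow> real) \<Rightarrow> nat \<Rightarrow> tree \<Rightarrow> real" where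
  "tree_prior p L T = tree_weight p T / (\<Sum>T'\<in>trees L. tree_weight p T')"

definition design :: "nat \<Rightarrow> nat \<Rightarrow> node \<Rightarrow> real" where
  "design n i v = haar v (real i / real n)"

definition likelihood :: "nat \<Rightarrow> tree \<Rightarrow> (nat \<Rightarrow> real) \<Rightarrow> (node \<Rightarrow> real) \<Rightarrow> real" where
  "likelihood n T Y \<beta> = (\<Prod>i=1..n. normal_density (\<Sum>v\<in>T. design n i v * \<beta> v) 1 (Y i))"

definition coeff_prior :: "tree \<Rightarrow> (node \<Rightarrow> real) measure" where
  "coeff_prior T = PiM T (\<lambda>_. density lborel (\<lambda>x. ennreal (normal_density 0 1 x)))"

text \<open>The marginal likelihood of a tree, with the coefficients integrated out.  Since the design
  is orthogonal and \<open>card (ext_nodes T) = card T\<close>, for \<open>T \<in> trees L\<close> with \<open>2 ^ (L + 1)\<close> dividing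
  \<open>n\<close> the Gaussian integral evaluates to
  \<open>(2\<pi>)\<^bsup>-n/2\<^esup> (1 + n)\<^bsup>-card (ext_nodes T)/2\<^esup> exp (-(1/2) Y'[I - X\<^sub>T \<Sigma>\<^sub>T X\<^sub>T']Y)\<close> with
  \<open>\<Sigma>\<^sub>T = n/(n+1) (X\<^sub>T'X\<^sub>T)\<^bsup>-1\<^esup>\<close>.\<close>

definition marginal_likelihood :: "nat \<Rightarrow> (nat \<Rightarrow> real) \<Rightarrow> tree \<Rightarrow> real" where
  "marginal_likelihood n Y T = (\<integral>\<beta>. likelihood n T Y \<beta> \<partial>coeff_prior T)"

definition posterior :: "(node \<Rightarrow> real) \<Rightarrow> nat \<Rightarrow> nat \<Rightarrow> (nat \<Rightarrow> real) \<Rightarrow> tree \<Rightarrow> real" where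
  "posterior p n L Y T =
     tree_prior p L T * marginal_likelihood n Y T /
     (\<Sum>T'\<in>trees L. tree_prior p L T' * marginal_likelihood n Y T')"

section \<open>Informed Metropolis--Hastings chains\<close>

definition weighted_proposal :: "(tree \<Rightarrow> tree set) \<Rightarrow> (tree \<Rightarrow> tree \<Rightarrow> real) \<Rightarrow> tree \<Rightarrow> tree \<Rightarrow> real" where
  "weighted_proposal N w T T' = (if T' \<in> N T then w T T' / (\<Sum>U\<in>N T. w T U) else 0)"

definition grow_weight :: "nat \<Rightarrow> real \<Rightarrow> (tree \<Rightarrow> real) \<Rightarrow> tree \<Rightarrow> tree \<Rightarrow> real" where
  "grow_weight n A \<pi> T T' = min (\<pi> T' / \<pi> T) (real n powr (A\<^sup>2 * ln (real n) / 8))"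

definition prune_weight :: "nat \<Rightarrow> real \<Rightarrow> (tree \<Rightarrow> real) \<Rightarrow> tree \<Rightarrow> tree \<Rightarrow> real" where
  "prune_weight n c \<pi> T T' = min (max 1 (\<pi> T' / \<pi> T)) (real n powr (c - 3/2))"

definition tree_proposal ::
  "nat \<Rightarrow> (tree \<Rightarrow> tree \<Rightarrow> real) \<Rightarrow> (tree \<Rightarrow> tree \<Rightarrow> real) \<Rightarrow> tree \<Rightarrow> tree \<Rightarrow> real" where
  "tree_proposal L Sg Sp T T' =
     (if T = null_tree then Sg T T'
      else if T = full_tree L then Sp T T'
      else Sg T T' / 2 + Sp T T' / 2)"

definition accept_prob :: "('s \<Rightarrow> 's \<Rightarrow> real) \<Rightarrow> ('s \<Rightarrow> real) \<Rightarrow> 's \<Rightarrow> 's \<Rightarrow> real" where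
  "accept_prob S \<pi> x y = min 1 (\<pi> y * S y x / (\<pi> x * S x y))"

definition mh_kernel :: "'s set \<Rightarrow> ('s \<Rightarrow> 's \<Rightarrow> real) \<Rightarrow> ('s \<Rightarrow> real) \<Rightarrow> 's \<Rightarrow> 's \<Rightarrow> real" where
  "mh_kernel X S \<pi> x y =
     (if y = x then 1 - (\<Sum>z\<in>X - {x}. S x z * accept_prob S \<pi> x z)
      else S x y * accept_prob S \<pi> x y)"

definition lazy_kernel :: "('s \<Rightarrow> 's \<Rightarrow> real) \<Rightarrow> 's \<Rightarrow> 's \<Rightarrow> real" where
  "lazy_kernel P x y = P x y / 2 + (if x = y then 1 / 2 else 0)"

definition informed_kernel ::
  "(nat \<Rightarrow> tree \<Rightarrow> tree set) \<Rightarrow> (nat \<Rightarrow> tree \<Rightarrow> tree set) \<Rightarrow> nat \<Rightarrow> nat \<Rightarrow> real \<Rightarrow> real \<Rightarrow>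
   (tree \<Rightarrow> real) \<Rightarrow> tree \<Rightarrow> tree \<Rightarrow> real" where
  "informed_kernel Ng Np n L A c \<pi> =
     lazy_kernel (mh_kernel (trees L)
       (tree_proposal L (weighted_proposal (Ng L) (grow_weight n A \<pi>))
                        (weighted_proposal (Np L) (prune_weight n c \<pi>))) \<pi>)"

section \<open>Mixing times\<close>

primrec kernel_pow :: "'s set \<Rightarrow> ('s \<Rightarrow> 's \<Rightarrow> real) \<Rightarrow> nat \<Rightarrow> 's \<Rightarrow> 's \<Rightarrow> real" where
  "kernel_pow X P 0 x y = (if x = y then 1 else 0)"
| "kernel_pow X P (Suc t) x y = (\<Sum>z\<in>X. P x z * kernel_pow X P t z y)"

definition tv_dist :: "'s set \<Rightarrow> ('s \<Rightarrow> real) \<Rightarrow> ('s \<Rightarrow> real) \<Rightarrow> real" where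
  "tv_dist X \<mu> \<nu> = (\<Sum>x\<in>X. \<bar>\<mu> x - \<nu> x\<bar>) / 2"

text \<open>The values are extended naturals, so that the mixing time of a chain that does not reach
  accuracy \<open>\<epsilon>\<close> is \<open>\<infinity>\<close>.\<close>

definition mixing_time :: "'s set \<Rightarrow> ('s \<Rightarrow> 's \<Rightarrow> real) \<Rightarrow> ('s \<Rightarrow> real) \<Rightarrow> real \<Rightarrow> enat" where
  "mixing_time X P \<pi> \<epsilon> =
     (MAX x\<in>X. INF t\<in>{t. \<forall>t'\<ge>t. tv_dist X (kernel_pow X P t' x) \<pi> \<le> \<epsilon>}. enat t)"

definition informed_mixing_time ::
  "(nat \<Rightarrow> tree \<Rightarrow> tree set) \<Rightarrow> (nat \<Rightarrow> tree \<Rightarrow> tree set) \<Rightarrow> nat \<Rightarrow> nat \<Rightarrow> real \<Rightarrow> real \<Rightarrow>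
   (nat \<Rightarrow> real) \<Rightarrow> real \<Rightarrow> enat" where
  "informed_mixing_time Ng Np n L A c Y \<epsilon> =
     (let \<pi> = posterior (\<lambda>_. real n powr (- c)) n L Y
      in mixing_time (trees L) (informed_kernel Ng Np n L A c \<pi>) \<pi> \<epsilon>)"

abbreviation "informed_cart_mixing_time \<equiv> informed_mixing_time cart_grow cart_prune"
abbreviation "informed_twiggy_mixing_time \<equiv> informed_mixing_time twiggy_grow twiggy_prune"

section \<open>Data-generating model\<close>

text \<open>The law of \<open>Y = (Y\<^sub>1, \<dots>, Y\<^sub>n)\<close> with independent \<open>Y\<^sub>i \<sim> N(f\<^sub>0(i/n), 1)\<close>.\<close>

definition data_law :: "nat \<Rightarrow> (real \<Rightarrow> real) \<Rightarrow> (nat \<Rightarrow> real) measure" where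
  "data_law n f0 =
     PiM {1..n} (\<lambda>i. density lborel (\<lambda>y. ennreal (normal_density (f0 (real i / real n)) 1 y)))"

definition sparse_signal ::
  "nat \<Rightarrow> nat \<Rightarrow> real \<Rightarrow> real \<Rightarrow> (real \<Rightarrow> real) \<Rightarrow> node set \<Rightarrow> bool" where
  "sparse_signal n L A Cf f0 B \<longleftrightarrow>
     B \<subseteq> nodes L \<and>
     (\<exists>\<beta>. (\<forall>x\<in>{0..1}. f0 x = (\<Sum>v\<in>B. \<beta> v * haar v x)) \<and>
          (\<forall>v\<in>B. A * ln (real n) / sqrt (real n) < \<bar>\<beta> v\<bar> \<and> \<bar>\<beta> v\<bar> < Cf))"

definition assumption_Fa :: "nat \<Rightarrow> nat \<Rightarrow> real \<Rightarrow> real \<Rightarrow> (real \<Rightarrow> real) \<Rightarrow> bool" where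
  "assumption_Fa n L A Cf f0 \<longleftrightarrow> (\<exists>B. sparse_signal n L A Cf f0 B \<and> B \<in> trees L)"

definition assumption_Fb :: "nat \<Rightarrow> nat \<Rightarrow> real \<Rightarrow> real \<Rightarrow> (real \<Rightarrow> real) \<Rightarrow> bool" where
  "assumption_Fb n L A Cf f0 \<longleftrightarrow> (\<exists>B. sparse_signal n L A Cf f0 B \<and> B \<notin> trees L)"

definition mixing_bound :: "nat \<Rightarrow> nat \<Rightarrow> real \<Rightarrow> real \<Rightarrow> real \<Rightarrow> real" where
  "mixing_bound n L A Cf \<epsilon> =
     ln (6 / \<epsilon>) *
     max (9 * (Cf + 2)\<^sup>2 / A\<^sup>2 * (2 ^ L * real n / (ln (real n))\<^sup>2)) (2 ^ (L + 5))"

end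

theory Submission
  imports Defs "HOL-Real_Asymp.Real_Asymp"
begin

text \<open>
  Let \<open>s\<^sub>v\<close> be the inner product of \<open>Y\<close> with the Haar column of the node \<open>v\<close>.  The columns are
  orthogonal and a tree has as many external as internal nodes, so the posterior weight of a tree
  \<open>T\<close> is, up to normalization, the product over \<open>v \<in> T\<close> of one factor \<open>g\<^sub>v\<close> that depends on \<open>s\<^sub>v\<close>
  only (\<open>posterior_eq\<close>).  A Chernoff bound for each node and a union bound show that, with
  probability at least \<open>1 - 1/n\<close>, all scores are within \<open>2 sqrt (n ln n)\<close> of their means
  (\<open>noise_event_prob\<close>).  On this event the factors split into two classes: outside the set \<open>B\<close> of
  signals \<open>g\<^sub>v\<close> is at most \<open>n powr (3/2 - c)\<close>, and on \<open>B\<close> it is at least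
  \<open>n powr (- (c + 1)) * exp (A\<^sup>2 (ln n)\<^sup>2 / 4)\<close>.  A path that leads to a signal contains at most \<open>L\<close>
  nodes, and \<open>L\<close> is of order \<open>ln n\<close>; the noise nodes on it cost at most a factor
  \<open>exp (O((c + 1) (ln n)\<^sup>2))\<close>.  If \<open>A\<close> is large compared with \<open>c\<close>, one signal pays for all of them.

  Call a move good if it grows a set of nodes that contains a signal or prunes a set that contains
  none.  The caps in the proposal weights make all moves that gain a signal equally likely and far
  likelier than other grow moves, and, once no signal is missing, the same holds for prune moves
  without signals.  Such moves are always accepted, because the reverse proposal has probability
  at least a power of \<open>1/n\<close>, respectively because the growing weights at the pruned tree add up to
  at most \<open>1/2\<close>.  All other moves go downhill in the posterior, and a
  Metropolis--Hastings chain takes a downhill move at most with the probability given by the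
  posterior ratio.  Hence the potential \<open>16 ((L + 1) card (B - T) + card (junk B T))\<close> decreases by
  at least 1 in expectation at each tree other than the target \<open>T\<^sup>*\<close>, the smallest tree that
  contains \<open>B\<close>, and it increases by at most 1 at \<open>T\<^sup>*\<close> (\<open>potential_change\<close>, \<open>progress\<close>).  Here
  \<open>junk B T\<close> consists of the nodes of \<open>T\<close> other than the root at or below which \<open>T\<close> contains
  no signal.  Nodes of \<open>T\<^sup>*\<close>
  count as junk as long as no signal below them has been reached: pruning them is uphill in the
  posterior and must therefore not be a setback for the potential.

  A drift of this kind determines the mixing time (\<open>drift_tv_bound\<close>).  Stationarity gives
  \<open>\<pi>(T\<^sup>*) \<ge> 1/2\<close>; reversibility and laziness then keep every return probability to \<open>T\<^sup>*\<close> at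
  least \<open>1/4\<close>; the drift brings the chain to \<open>T\<^sup>*\<close> in the time \<open>t\<^sub>0\<close>, twice the maximal potential, with
  probability at least \<open>1/2\<close>.  So \<open>t\<^sub>0\<close> steps reach \<open>T\<^sup>*\<close> from every tree with probability at least
  \<open>1/8\<close>, and the total variation distance contracts geometrically.  The resulting
  bound is of order \<open>ln (6/\<epsilon>) L 2\<^sup>L\<close>.  For large \<open>n\<close> it is below the first term of the maximum in
  the claim, which exceeds \<open>2\<^sup>L\<close> by a factor of order \<open>n / (ln n)\<^sup>2\<close>.

  Both chains are treated by the same argument: the locale \<open>tree_moves\<close> collects what the drift
  needs from the neighborhoods.  Twiggy moves satisfy it for every \<open>B\<close>, since a twig reaches any
  missing signal in one step.  CART moves add one node at a time and satisfy it if \<open>B\<close> is a tree: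
  then a missing signal of minimal level has its parent in \<open>T\<close> already.
\<close>

section \<open>Mixing of reversible chains with a drift towards one state\<close>

locale reversible_chain =
  fixes X :: "'s set" and P :: "'s \<Rightarrow> 's \<Rightarrow> real" and \<pi> :: "'s \<Rightarrow> real"
  assumes finite_states: "finite X"
    and kernel_nonneg: "\<And>x y. x \<in> X \<Longrightarrow> y \<in> X \<Longrightarrow> 0 \<le> P x y"
    and kernel_row: "\<And>x. x \<in> X \<Longrightarrow> (\<Sum>y\<in>X. P x y) = 1"
    and pi_pos: "\<And>x. x \<in> X \<Longrightarrow> 0 < \<pi> x"
    and pi_sum: "(\<Sum>x\<in>X. \<pi> x) = 1"
    and reversible: "\<And>x y. x \<in> X \<Longrightarrow> y \<in> X \<Longrightarrow> \<pi> x * P x y = \<pi> y * P y x"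
begin

abbreviation "iter \<equiv> kernel_pow X P"

lemma pow_nonneg: "x \<in> X \<Longrightarrow> y \<in> X \<Longrightarrow> 0 \<le> iter t x y"
  by (induction t arbitrary: x) (auto intro!: sum_nonneg mult_nonneg_nonneg kernel_nonneg)

lemma pow_row: "x \<in> X \<Longrightarrow> (\<Sum>y\<in>X. iter t x y) = 1"
proof (induction t arbitrary: x)
  case 0
  then show ?case using finite_states by simp
next
  case (Suc t)
  have "(\<Sum>y\<in>X. iter (Suc t) x y) = (\<Sum>z\<in>X. P x z * (\<Sum>y\<in>X. iter t z y))"
    by (simp add: sum_distrib_left) (rule sum.swap)
  then show ?case using Suc by (simp add: kernel_row)
qed

lemma pow_add:
  assumes "x \<in> X"
  shows "iter (s + t) x y = (\<Sum>z\<in>X. iter s x z * iter t z y)"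
  using assms
proof (induction s arbitrary: x)
  case 0
  have "(\<Sum>z\<in>X. iter 0 x z * iter t z y) = (\<Sum>z\<in>X. if x = z then iter t z y else 0)"
    by (rule sum.cong) auto
  then show ?case using 0 finite_states by simp
next
  case (Suc s)
  have "(\<Sum>z\<in>X. iter (Suc s) x z * iter t z y) = (\<Sum>w\<in>X. P x w * (\<Sum>z\<in>X. iter s w z * iter t z y))"
    by (simp add: sum_distrib_left sum_distrib_right mult.assoc) (rule sum.swap)
  also have "\<dots> = iter (Suc s + t) x y"
    using Suc.IH by simp
  finally show ?case by simp
qed

lemma pow_one: "y \<in> X \<Longrightarrow> iter 1 x y = P x y"
  using finite_states by (simp add: if_distrib[of "\<lambda>a. _ * a"] cong: if_cong)

lemma pow_reversible:
  "x \<in> X \<Longrightarrow> y \<in> X \<Longrightarrow> \<pi> x * iter t x y = \<pi> y * iter t y x"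
proof (induction t arbitrary: x y)
  case 0
  then show ?case by simp
next
  case (Suc t)
  have "\<pi> x * iter (Suc t) x y = (\<Sum>z\<in>X. (\<pi> x * P x z) * iter t z y)"
    by (simp add: sum_distrib_left mult.assoc)
  also have "\<dots> = (\<Sum>z\<in>X. P z x * (\<pi> z * iter t z y))"
    by (rule sum.cong) (simp_all add: reversible Suc.prems mult_ac)
  also have "\<dots> = (\<Sum>z\<in>X. \<pi> y * (iter t y z * iter 1 z x))"
  proof (rule sum.cong)
    fix z assume "z \<in> X"
    then have "\<pi> z * iter t z y = \<pi> y * iter t y z"
      by (rule Suc.IH) fact
    then show "P z x * (\<pi> z * iter t z y) = \<pi> y * (iter t y z * iter 1 z x)"
      by (simp only: pow_one[OF Suc.prems(1)] mult_ac)
  qed simp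
  also have "\<dots> = \<pi> y * iter (t + 1) y x"
    using Suc.prems by (subst pow_add) (simp_all add: sum_distrib_left)
  finally show ?case by simp
qed

lemma pow_stationary:
  assumes "y \<in> X"
  shows "(\<Sum>x\<in>X. \<pi> x * iter t x y) = \<pi> y"
proof -
  have "(\<Sum>x\<in>X. \<pi> x * iter t x y) = (\<Sum>x\<in>X. \<pi> y * iter t y x)"
    by (rule sum.cong) (simp_all add: assms pow_reversible)
  then show ?thesis using assms by (simp add: pow_row flip: sum_distrib_left)
qed

text \<open>By reversibility \<open>P\<^sup>2\<^sup>s x x\<close> is \<open>\<pi> x\<close> times the sum of \<open>(P\<^sup>s x y)\<^sup>2 / \<pi> y\<close>, and this sum is at least
  1 because \<open>P\<^sup>s x\<close> and \<open>\<pi>\<close> both have total mass 1.\<close>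

lemma pow_even_return:
  assumes "x \<in> X"
  shows "\<pi> x \<le> iter (s + s) x x"
proof -
  let ?a = "\<lambda>y. iter s x y"
  have "0 \<le> (\<Sum>y\<in>X. (?a y - \<pi> y)\<^sup>2 / \<pi> y)"
    by (intro sum_nonneg divide_nonneg_pos zero_le_power2 pi_pos)
  also have "\<dots> = (\<Sum>y\<in>X. (?a y)\<^sup>2 / \<pi> y - 2 * ?a y + \<pi> y)"
    by (rule sum.cong) (auto simp: field_simps power2_eq_square dest: pi_pos)
  also have "\<dots> = (\<Sum>y\<in>X. (?a y)\<^sup>2 / \<pi> y) - 1"
    using assms by (simp add: sum.distrib sum_subtractf pow_row pi_sum flip: sum_distrib_left)
  finally have "\<pi> x * 1 \<le> \<pi> x * (\<Sum>y\<in>X. (?a y)\<^sup>2 / \<pi> y)"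
    by (intro mult_left_mono less_imp_le[OF pi_pos] assms) simp
  also have "\<dots> = (\<Sum>y\<in>X. ?a y * (\<pi> x * ?a y / \<pi> y))"
    by (simp add: sum_distrib_left power2_eq_square mult_ac)
  also have "\<dots> = (\<Sum>y\<in>X. ?a y * iter s y x)"
    by (rule sum.cong) (use assms pi_pos in \<open>force simp: pow_reversible\<close>)+
  finally show ?thesis
    using assms by (simp add: pow_add)
qed

text \<open>Odd times follow from even ones by one lazy step, at the price of the factor \<open>1/2\<close>.\<close>

lemma pow_return:
  assumes "x \<in> X" and "P x x \<ge> 1/2"
  shows "\<pi> x / 2 \<le> iter t x x"
proof (cases "even t")
  case True
  then obtain s where "t = s + s" by (metis evenE mult_2)
  then show ?thesis using pow_even_return[OF assms(1), of s] pi_pos[OF assms(1)] by simp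
next
  case False
  then obtain s where t: "t = Suc (s + s)" by (metis oddE mult_2 Suc_eq_plus1)
  have "\<pi> x / 2 \<le> iter (s + s) x x * (1/2)"
    using pow_even_return[OF assms(1), of s] by simp
  also have "\<dots> \<le> iter (s + s) x x * P x x"
    by (rule mult_left_mono) (use assms pow_nonneg in auto)
  also have "\<dots> \<le> (\<Sum>z\<in>X. P x z * iter (s + s) z x)"
    by (subst mult.commute, rule member_le_sum)
      (auto intro!: mult_nonneg_nonneg kernel_nonneg pow_nonneg assms finite_states)
  finally show ?thesis by (simp add: t)
qed

text \<open>The mean of \<open>h\<close> under \<open>\<pi>\<close> is invariant, so the expected decrease off \<open>z\<close>, at least
  \<open>1 - \<pi> z\<close>, is compensated by the expected increase at \<open>z\<close>, at most \<open>\<pi> z\<close>.\<close>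

lemma drift_pi_target:
  assumes z: "z \<in> X"
    and drift: "\<And>x. x \<in> X \<Longrightarrow> x \<noteq> z \<Longrightarrow> (\<Sum>y\<in>X. P x y * h y) \<le> h x - 1"
    and target: "(\<Sum>y\<in>X. P z y * h y) \<le> h z + 1"
  shows "\<pi> z \<ge> 1/2"
proof -
  have "(\<Sum>x\<in>X. \<pi> x * (\<Sum>y\<in>X. P x y * h y)) = (\<Sum>x\<in>X. \<Sum>y\<in>X. \<pi> y * P y x * h y)"
    by (auto simp: sum_distrib_left mult.assoc[symmetric] reversible intro!: sum.cong)
  also have "\<dots> = (\<Sum>y\<in>X. \<Sum>x\<in>X. \<pi> y * P y x * h y)" by (rule sum.swap)
  also have "\<dots> = (\<Sum>y\<in>X. \<pi> y * h y * (\<Sum>x\<in>X. P y x))"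
    by (simp add: sum_distrib_left mult_ac)
  also have "\<dots> = (\<Sum>y\<in>X. \<pi> y * h y)" by (simp add: kernel_row)
  finally have eq: "(\<Sum>x\<in>X. \<pi> x * (\<Sum>y\<in>X. P x y * h y)) = (\<Sum>y\<in>X. \<pi> y * h y)" .
  have "(\<Sum>x\<in>X. \<pi> x * (\<Sum>y\<in>X. P x y * h y))
      \<le> (\<Sum>x\<in>X. \<pi> x * (h x - 1 + (if x = z then 2 else 0)))"
    by (intro sum_mono mult_left_mono) (use drift target pi_pos in \<open>force intro: less_imp_le\<close>)+
  also have "\<dots> = (\<Sum>x\<in>X. \<pi> x * h x - \<pi> x + (if x = z then 2 * \<pi> x else 0))"
    by (rule sum.cong) (auto simp: algebra_simps)
  also have "\<dots> = (\<Sum>x\<in>X. \<pi> x * h x) - 1 + 2 * \<pi> z"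
    using z by (simp add: sum.distrib sum_subtractf pi_sum finite_states)
  finally show ?thesis using eq by linarith
qed

text \<open>The drift bounds the mean hitting time of \<open>z\<close> by \<open>h x\<close>, and the chain is at \<open>z\<close> with
  probability at least \<open>q\<close> at any time after the hit.  The linear form of the bound makes the
  one-step induction close without a stopping time.\<close>

lemma drift_hits_target:
  assumes z: "z \<in> X" and q: "\<And>t. q \<le> iter t z z" "0 \<le> q"
    and h: "\<And>x. x \<in> X \<Longrightarrow> 0 \<le> h x"
    and drift: "\<And>x. x \<in> X \<Longrightarrow> x \<noteq> z \<Longrightarrow> (\<Sum>y\<in>X. P x y * h y) \<le> h x - 1"
    and t: "t \<le> t0" "0 < t0" and x: "x \<in> X"
  shows "q * ((real t - h x) / real t0) \<le> iter t x z"
  using t x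
proof (induction t arbitrary: x)
  case 0
  have "0 \<le> h x" by (rule h) fact
  then have "q * ((real 0 - h x) / real t0) \<le> 0"
    using q(2) by (intro mult_nonneg_nonpos) (auto simp: divide_le_0_iff)
  moreover have "0 \<le> iter 0 x z" by simp
  ultimately show ?case by linarith
next
  case (Suc t)
  show ?case
  proof (cases "x = z")
    case True
    have "q * ((real (Suc t) - h x) / real t0) \<le> q * 1"
      using Suc.prems h[of x] q(2) by (intro mult_left_mono) (auto simp: divide_le_eq)
    then show ?thesis using q(1)[of "Suc t"] True by simp
  next
    case False
    let ?k = "q / real t0"
    have k: "0 \<le> ?k" using q by simp
    have "q * ((real (Suc t) - h x) / real t0) = ?k * (real t - (h x - 1))" by simp
    also have "\<dots> \<le> ?k * (real t - (\<Sum>y\<in>X. P x y * h y))"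
      using drift[OF Suc.prems(3) False] by (intro mult_left_mono k) simp
    also have "\<dots> = ?k * (real t * (\<Sum>y\<in>X. P x y) - (\<Sum>y\<in>X. P x y * h y))"
      by (simp add: kernel_row Suc.prems)
    also have "\<dots> = (\<Sum>y\<in>X. P x y * (q * ((real t - h y) / real t0)))"
      by (simp add: sum_distrib_left sum_subtractf[symmetric] diff_divide_distrib algebra_simps)
    also have "\<dots> \<le> (\<Sum>y\<in>X. P x y * iter t y z)"
      using Suc by (intro sum_mono mult_left_mono kernel_nonneg) auto
    finally show ?thesis by simp
  qed
qed

text \<open>A signed measure of total mass 0 is annihilated by the common part \<open>\<delta>\<close> of all rows, so only
  the remaining mass \<open>1 - \<delta>\<close> of each row acts on it.\<close>

lemma doeblin_contraction:
  assumes z: "z \<in> X" and \<delta>: "\<And>x. x \<in> X \<Longrightarrow> \<delta> \<le> iter s x z"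
    and \<mu>: "(\<Sum>x\<in>X. \<mu> x) = 0"
  shows "(\<Sum>y\<in>X. \<bar>\<Sum>x\<in>X. \<mu> x * iter s x y\<bar>) \<le> (1 - \<delta>) * (\<Sum>x\<in>X. \<bar>\<mu> x\<bar>)"
proof -
  let ?R = "\<lambda>x y. iter s x y - (if y = z then \<delta> else 0)"
  have R: "0 \<le> ?R x y" if "x \<in> X" "y \<in> X" for x y
    using that \<delta> pow_nonneg by auto
  have "(\<Sum>x\<in>X. \<mu> x * iter s x y) = (\<Sum>x\<in>X. \<mu> x * ?R x y)" for y
  proof -
    have "(\<Sum>x\<in>X. \<mu> x * ?R x y) = (\<Sum>x\<in>X. \<mu> x * iter s x y) - (\<Sum>x\<in>X. \<mu> x) * (if y = z then \<delta> else 0)"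
      by (simp only: right_diff_distrib sum_subtractf sum_distrib_right)
    then show ?thesis using \<mu> by simp
  qed
  then have "(\<Sum>y\<in>X. \<bar>\<Sum>x\<in>X. \<mu> x * iter s x y\<bar>) = (\<Sum>y\<in>X. \<bar>\<Sum>x\<in>X. \<mu> x * ?R x y\<bar>)"
    by (simp only:)
  also have "\<dots> \<le> (\<Sum>y\<in>X. \<Sum>x\<in>X. \<bar>\<mu> x\<bar> * ?R x y)"
    using R by (intro sum_mono order_trans[OF sum_abs]) (simp only: abs_mult abs_of_nonneg order_refl)
  also have "\<dots> = (\<Sum>x\<in>X. \<bar>\<mu> x\<bar> * (\<Sum>y\<in>X. ?R x y))"
    by (subst sum.swap) (simp add: sum_distrib_left)
  also have "\<dots> = (\<Sum>x\<in>X. \<bar>\<mu> x\<bar> * (1 - \<delta>))"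
    using z by (intro sum.cong) (simp_all add: sum_subtractf pow_row finite_states)
  finally show ?thesis by (simp only: sum_distrib_left mult.commute[of "1 - \<delta>"])
qed

lemma tv_geometric:
  assumes z: "z \<in> X" and \<delta>: "\<And>x. x \<in> X \<Longrightarrow> \<delta> \<le> iter s x z" "\<delta> \<le> 1" and x: "x \<in> X"
  shows "tv_dist X (iter (r + k * s) x) \<pi> \<le> (1 - \<delta>) ^ k"
proof (induction k)
  case 0
  have "(\<Sum>y\<in>X. \<bar>iter r x y - \<pi> y\<bar>) \<le> (\<Sum>y\<in>X. iter r x y + \<pi> y)"
    using pow_nonneg[OF x] pi_pos by (intro sum_mono) (smt (verit) less_imp_le)
  also have "\<dots> = 2" using x by (simp add: sum.distrib pow_row pi_sum)
  finally show ?case by (simp add: tv_dist_def)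
next
  case (Suc k)
  let ?t = "r + k * s"
  let ?\<mu> = "\<lambda>y. iter ?t x y - \<pi> y"
  have eq: "(\<Sum>w\<in>X. ?\<mu> w * iter s w y) = iter (r + Suc k * s) x y - \<pi> y" if "y \<in> X" for y
  proof -
    have "r + Suc k * s = ?t + s" by simp
    then show ?thesis
      using that x by (simp only: pow_add left_diff_distrib sum_subtractf pow_stationary)
  qed
  have "(\<Sum>y\<in>X. \<bar>iter (r + Suc k * s) x y - \<pi> y\<bar>) = (\<Sum>y\<in>X. \<bar>\<Sum>w\<in>X. ?\<mu> w * iter s w y\<bar>)"
    using eq by simp
  also have "\<dots> \<le> (1 - \<delta>) * (\<Sum>y\<in>X. \<bar>?\<mu> y\<bar>)"
    using x by (intro doeblin_contraction[OF z \<delta>(1)]) (auto simp: sum_subtractf pow_row pi_sum)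
  finally have "tv_dist X (iter (r + Suc k * s) x) \<pi> \<le> (1 - \<delta>) * tv_dist X (iter ?t x) \<pi>"
    by (simp add: tv_dist_def)
  also have "\<dots> \<le> (1 - \<delta>) * (1 - \<delta>) ^ k"
    using Suc \<delta>(2) by (intro mult_left_mono) auto
  finally show ?case by simp
qed

text \<open>The time \<open>t0\<close> is chosen so that the chain has hit \<open>z\<close> with probability at least \<open>1/2\<close>.  With
  return probabilities at least \<open>1/4\<close> the minorization constant is \<open>1/8\<close>.  The hypothesis on \<open>t\<close>
  is stated so that it holds for \<open>t = \<lfloor>8 ln (6/\<epsilon>) t0\<rfloor>\<close>: the slack between \<open>6/\<epsilon>\<close> and \<open>1/\<epsilon>\<close> pays for
  the incomplete last block of length \<open>t0\<close>.\<close>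

theorem drift_tv_bound:
  assumes z: "z \<in> X" "P z z \<ge> 1/2"
    and h: "\<And>x. x \<in> X \<Longrightarrow> 0 \<le> h x" "\<And>x. x \<in> X \<Longrightarrow> 2 * h x \<le> real t0" and t0: "0 < t0"
    and drift: "\<And>x. x \<in> X \<Longrightarrow> x \<noteq> z \<Longrightarrow> (\<Sum>y\<in>X. P x y * h y) \<le> h x - 1"
    and target: "(\<Sum>y\<in>X. P z y * h y) \<le> h z + 1"
    and \<epsilon>: "0 < \<epsilon>" "\<epsilon> < 1" and x: "x \<in> X" and t: "8 * ln (6 / \<epsilon>) * real t0 \<le> real t + 1"
  shows "tv_dist X (iter t x) \<pi> \<le> \<epsilon>"
proof -
  have \<pi>z: "\<pi> z \<ge> 1/2" by (rule drift_pi_target[OF z(1) drift target])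
  have q: "1/4 \<le> iter s z z" for s
    using pow_return[OF z, of s] \<pi>z by simp
  have hit: "1/8 \<le> iter t0 y z" if y: "y \<in> X" for y
  proof -
    have "1/2 \<le> (real t0 - h y) / real t0"
      using h(2)[OF y] t0 by (simp add: le_divide_eq)
    then have "1/8 \<le> 1/4 * ((real t0 - h y) / real t0)" by linarith
    also have "\<dots> \<le> iter t0 y z"
      using q by (intro drift_hits_target[OF z(1) _ _ h(1) drift order_refl t0 y]) auto
    finally show ?thesis .
  qed
  \<comment> \<open>\<open>k\<close> full blocks of length \<open>t0\<close>; the rest of the time cannot increase the distance.\<close>
  define k where "k = t div t0"
  have t_eq: "t = t mod t0 + k * t0" by (simp add: k_def)
  have "tv_dist X (iter t x) \<pi> \<le> (1 - 1/8) ^ k"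
    by (subst t_eq, rule tv_geometric[OF z(1) hit _ x]) auto
  also have "(1 - 1/8 :: real) ^ k = exp (real k * ln (7/8))"
    by (simp add: exp_of_nat_mult)
  also have "\<dots> \<le> exp (ln \<epsilon>)"
  proof -
    have "t mod t0 < t0" using t0 by simp
    then have "real t + 1 \<le> real t0 * (real k + 1)"
      using t_eq by (metis Suc_leI add.commute add_Suc_right k_def mult.commute mult_Suc_right
          nat_add_left_cancel_le of_nat_1 of_nat_add of_nat_le_iff of_nat_mult plus_1_eq_Suc t_eq)
    with t have "real t0 * (8 * ln (6 / \<epsilon>)) \<le> real t0 * (real k + 1)" by (simp add: mult.commute)
    then have k: "8 * ln (6 / \<epsilon>) \<le> real k + 1" using t0 by simp
    have "ln (6 / \<epsilon>) = ln 6 - ln \<epsilon>" using \<epsilon> by (simp add: ln_div)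
    moreover have "1 \<le> ln (6 :: real)"
      using exp_le by (subst ln_ge_iff) auto
    ultimately have "- ln \<epsilon> \<le> real k * (1/8)" using k by linarith
    also have "\<dots> \<le> real k * (- ln (7/8))"
      using ln_le_minus_one[of "7/8 :: real"] by (intro mult_left_mono) auto
    finally show ?thesis by simp
  qed
  finally show ?thesis using \<epsilon> by simp
qed

end

section \<open>Lazy Metropolis--Hastings kernels\<close>

lemma mh_kernel_off_diagonal:
  assumes "x \<noteq> y" "0 \<le> S x y" "0 \<le> S y x" "0 < \<pi> x" "0 < \<pi> y"
  shows "mh_kernel X S \<pi> x y = min (S x y) (\<pi> y / \<pi> x * S y x)"
proof (cases "S x y = 0")
  case True
  then show ?thesis using assms by (simp add: mh_kernel_def)
next
  case False
  then have "S x y > 0" using assms by simp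
  then have "S x y * accept_prob S \<pi> x y = min (S x y * 1) (S x y * (\<pi> y * S y x / (\<pi> x * S x y)))"
    by (simp add: accept_prob_def min_mult_distrib_left)
  then show ?thesis using assms \<open>S x y > 0\<close> by (simp add: mh_kernel_def)
qed

lemma lazy_mh_reversible_chain:
  assumes fin: "finite X"
    and S: "\<And>x y. x \<in> X \<Longrightarrow> y \<in> X \<Longrightarrow> 0 \<le> S x y" "\<And>x. x \<in> X \<Longrightarrow> (\<Sum>y\<in>X. S x y) \<le> 1"
    and \<pi>: "\<And>x. x \<in> X \<Longrightarrow> 0 < \<pi> x" "(\<Sum>x\<in>X. \<pi> x) = 1"
  shows "reversible_chain X (lazy_kernel (mh_kernel X S \<pi>)) \<pi>"
    and "x \<in> X \<Longrightarrow> lazy_kernel (mh_kernel X S \<pi>) x x \<ge> 1/2"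
    and "x \<in> X \<Longrightarrow> (\<Sum>y\<in>X. lazy_kernel (mh_kernel X S \<pi>) x y * h y) =
      h x + (\<Sum>y\<in>X - {x}. mh_kernel X S \<pi> x y * (h y - h x)) / 2"
proof -
  let ?M = "mh_kernel X S \<pi>"
  have acc: "0 \<le> accept_prob S \<pi> x y" "accept_prob S \<pi> x y \<le> 1" if "x \<in> X" "y \<in> X" for x y
    using that S(1)[of x y] S(1)[of y x] \<pi>(1)[of x] \<pi>(1)[of y] by (auto simp: accept_prob_def)
  have diag: "?M x x = 1 - (\<Sum>y\<in>X - {x}. ?M x y)" for x
  proof -
    have "(\<Sum>y\<in>X - {x}. ?M x y) = (\<Sum>z\<in>X - {x}. S x z * accept_prob S \<pi> x z)"
      by (rule sum.cong) (auto simp: mh_kernel_def)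
    then show ?thesis by (simp add: mh_kernel_def)
  qed
  have off: "0 \<le> ?M x y" "?M x y \<le> S x y" if "x \<in> X" "y \<in> X" "x \<noteq> y" for x y
    using that acc[of x y] S(1)[of x y]
    by (auto simp: mh_kernel_def intro!: mult_nonneg_nonneg mult_left_le)
  have diag_nonneg: "0 \<le> ?M x x" if x: "x \<in> X" for x
  proof -
    have "(\<Sum>y\<in>X - {x}. ?M x y) \<le> (\<Sum>y\<in>X - {x}. S x y)"
      using off(2)[OF x] by (intro sum_mono) auto
    also have "\<dots> \<le> (\<Sum>y\<in>X. S x y)"
      using S x by (intro sum_mono2 fin) auto
    also have "\<dots> \<le> 1" using S(2)[OF x] .
    finally show ?thesis by (simp add: diag)
  qed
  have nonneg: "0 \<le> ?M x y" if "x \<in> X" "y \<in> X" for x y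
    using that off(1) diag_nonneg by (cases "x = y") auto
  have row: "(\<Sum>y\<in>X. ?M x y) = 1" if "x \<in> X" for x
    using that fin by (simp add: sum.remove[of X x] diag)
  have rev: "\<pi> x * ?M x y = \<pi> y * ?M y x" if "x \<in> X" "y \<in> X" for x y
  proof (cases "x = y")
    case False
    have "\<pi> x * ?M x y = min (\<pi> x * S x y) (\<pi> y * S y x)"
      using that False S \<pi>(1)[of x] \<pi>(1)[of y]
      by (simp add: mh_kernel_off_diagonal min_mult_distrib_left)
    moreover have "\<pi> y * ?M y x = min (\<pi> y * S y x) (\<pi> x * S x y)"
      using that False S \<pi>(1)[of x] \<pi>(1)[of y]
      by (simp add: mh_kernel_off_diagonal min_mult_distrib_left)
    ultimately show ?thesis by (simp add: min.commute)
  qed simp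
  have lrow: "(\<Sum>y\<in>X. lazy_kernel ?M x y * h y) = (\<Sum>y\<in>X. ?M x y * h y) / 2 + h x / 2"
    if "x \<in> X" for x and h :: "'a \<Rightarrow> real"
  proof -
    have "(\<Sum>y\<in>X. lazy_kernel ?M x y * h y) =
        (\<Sum>y\<in>X. ?M x y * h y / 2 + (if x = y then h y / 2 else 0))"
      by (rule sum.cong) (auto simp: lazy_kernel_def field_simps)
    then show ?thesis using that fin by (simp add: sum.distrib sum_divide_distrib)
  qed
  show "reversible_chain X (lazy_kernel ?M) \<pi>"
  proof
    show "(\<Sum>y\<in>X. lazy_kernel ?M x y) = 1" if "x \<in> X" for x
      using lrow[OF that, of "\<lambda>_. 1"] row[OF that] by simp
    show "\<pi> x * lazy_kernel ?M x y = \<pi> y * lazy_kernel ?M y x" if "x \<in> X" "y \<in> X" for x y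
      using rev[OF that] by (auto simp: lazy_kernel_def field_simps)
  qed (use fin \<pi> nonneg in \<open>auto simp: lazy_kernel_def\<close>)
  show "lazy_kernel ?M x x \<ge> 1/2" if "x \<in> X"
    using diag_nonneg[OF that] by (simp add: lazy_kernel_def)
  show "(\<Sum>y\<in>X. lazy_kernel ?M x y * h y) = h x + (\<Sum>y\<in>X - {x}. ?M x y * (h y - h x)) / 2"
    if "x \<in> X"
  proof -
    have "(\<Sum>y\<in>X. ?M x y * h y) = ?M x x * h x + (\<Sum>y\<in>X - {x}. ?M x y * h y)"
      using that fin by (simp add: sum.remove)
    also have "\<dots> = h x + (\<Sum>y\<in>X - {x}. ?M x y * (h y - h x))"
      by (simp add: diag algebra_simps sum_subtractf sum_distrib_left)
    finally show ?thesis using lrow[OF that] by (simp add: field_simps)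
  qed
qed

text \<open>The infimum of a nonempty set of times is attained, and that of the empty set is \<open>\<infinity>\<close>.  The
  right-hand side involves only countably many conditions on the kernel, which is also what makes
  the mixing event measurable.\<close>

lemma mixing_time_le_iff:
  assumes "finite X" "X \<noteq> {}"
  shows "ereal_of_enat (mixing_time X P \<pi> \<epsilon>) \<le> ereal b \<longleftrightarrow>
    (\<forall>x\<in>X. \<exists>t. real t \<le> b \<and> (\<forall>t'\<ge>t. tv_dist X (kernel_pow X P t' x) \<pi> \<le> \<epsilon>))"
proof -
  have inf: "ereal_of_enat (INF t\<in>A. enat t) \<le> ereal b \<longleftrightarrow> (\<exists>t\<in>A. real t \<le> b)" for A :: "nat set"
  proof (cases "A = {}")
    case True
    then show ?thesis by (simp add: top_enat_def)
  next
    case False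
    define a where "a = (LEAST t. t \<in> A)"
    have a: "a \<in> A" "\<And>t. t \<in> A \<Longrightarrow> a \<le> t"
      using False by (auto simp: a_def intro: LeastI Least_le)
    have "(INF t\<in>A. enat t) = enat a"
      by (rule antisym) (auto intro!: INF_lower INF_greatest a)
    then show ?thesis using a by (auto intro: order_trans[rotated] simp: order_trans[of "real a"])
  qed
  let ?f = "\<lambda>x. INF t\<in>{t. \<forall>t'\<ge>t. tv_dist X (kernel_pow X P t' x) \<pi> \<le> \<epsilon>}. enat t"
  have "ereal_of_enat (Max (?f ` X)) = Max (ereal_of_enat ` ?f ` X)"
    using assms by (intro mono_Max_commute) (auto simp: mono_def)
  then have "ereal_of_enat (mixing_time X P \<pi> \<epsilon>) \<le> ereal b \<longleftrightarrow> (\<forall>x\<in>X. ereal_of_enat (?f x) \<le> ereal b)"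
    using assms by (simp add: mixing_time_def)
  then show ?thesis unfolding inf by (simp add: Bex_def conj_commute)
qed

section \<open>Ancestors and trees\<close>

lemma children_nonneg: "0 \<le> fst u \<Longrightarrow> v \<in> children u \<longleftrightarrow> fst v = fst u + 1 \<and> snd v div 2 = snd u"
  by (cases u; cases v) auto

text \<open>Dropping the last binary digit of the position is the step to the parent, so the ancestors of
  a node are its binary prefixes.  The restriction to levels \<open>\<ge> 0\<close> excludes the root, whose only
  child is \<open>(0, 0)\<close>, and the nodes of level below \<open>-1\<close> that do not belong to any tree.\<close>

lemma anc_iff:
  assumes "0 \<le> fst u"
  shows "(u, v) \<in> anc \<longleftrightarrow> fst u \<le> fst v \<and> snd u = snd v div 2 ^ nat (fst v - fst u)"
proof
  assume "(u, v) \<in> anc"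
  then have "(u, v) \<in> {(u, v). v \<in> children u}\<^sup>*" by (simp add: anc_def)
  then show "fst u \<le> fst v \<and> snd u = snd v div 2 ^ nat (fst v - fst u)"
  proof (induction rule: rtrancl_induct)
    case base
    then show ?case by simp
  next
    case (step v w)
    then have w: "fst w = fst v + 1" "snd w div 2 = snd v"
      using assms children_nonneg[of v w] by auto
    have "nat (fst w - fst u) = Suc (nat (fst v - fst u))"
      using step.IH w by auto
    then have "snd w div 2 ^ nat (fst w - fst u) = (snd w div 2) div 2 ^ nat (fst v - fst u)"
      by (simp add: div_mult2_eq)
    then show ?case using step.IH w by simp
  qed
next
  assume "fst u \<le> fst v \<and> snd u = snd v div 2 ^ nat (fst v - fst u)"
  then show "(u, v) \<in> anc"
  proof (induction "nat (fst v - fst u)" arbitrary: v)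
    case 0
    then have "u = v" by (cases u; cases v) auto
    then show ?case by (simp add: anc_def)
  next
    case (Suc d)
    let ?p = "(fst v - 1, snd v div 2)"
    have d: "d = nat (fst ?p - fst u)" "fst u \<le> fst ?p" using Suc by auto
    have "snd u = snd ?p div 2 ^ d"
      using Suc.prems Suc.hyps(2) by (metis div_mult2_eq power_Suc snd_conv)
    then have "(u, ?p) \<in> anc" using Suc.hyps(1)[of ?p] d by simp
    moreover have "v \<in> children ?p"
      using d assms children_nonneg[of ?p v] by auto
    ultimately show ?case
      unfolding anc_def by (auto intro: rtrancl_into_rtrancl)
  qed
qed

lemma anc_refl: "(v, v) \<in> anc"
  by (simp add: anc_def)

lemma anc_trans: "(u, v) \<in> anc \<Longrightarrow> (v, w) \<in> anc \<Longrightarrow> (u, w) \<in> anc"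
  unfolding anc_def by (rule rtrancl_trans)

lemma anc_antisym: "0 \<le> fst u \<Longrightarrow> (u, v) \<in> anc \<Longrightarrow> (v, u) \<in> anc \<Longrightarrow> u = v"
  by (cases u; cases v) (auto simp: anc_iff)

lemma anc_linear:
  assumes "0 \<le> fst u" "0 \<le> fst v" "(u, w) \<in> anc" "(v, w) \<in> anc" "fst u \<le> fst v"
  shows "(u, v) \<in> anc"
proof -
  have "nat (fst w - fst u) = nat (fst w - fst v) + nat (fst v - fst u)"
    using assms by (auto simp: anc_iff)
  then have "snd w div 2 ^ nat (fst w - fst u) = snd w div 2 ^ nat (fst w - fst v) div 2 ^ nat (fst v - fst u)"
    by (simp add: power_add div_mult2_eq)
  then show ?thesis using assms by (auto simp: anc_iff)
qed

text \<open>The root is left out: it belongs to every tree and has no twig through it.\<close>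

definition ancestors :: "node \<Rightarrow> node set" where
  "ancestors v = {w. 0 \<le> fst w \<and> (w, v) \<in> anc}"

lemma nodes_iff: "v \<in> nodes L \<longleftrightarrow> v = (-1, 0) \<or> 0 \<le> fst v \<and> fst v < int L \<and> snd v < 2 ^ nat (fst v)"
  by (cases v) (auto simp: nodes_def)

lemma nodes_eq: "nodes L = insert (-1, 0) (\<Union>l<L. (\<lambda>k. (int l, k)) ` {..<2 ^ l})"
proof (intro set_eqI iffI)
  fix v assume "v \<in> nodes L"
  then show "v \<in> insert (-1, 0) (\<Union>l<L. (\<lambda>k. (int l, k)) ` {..<2 ^ l})"
    by (cases v; cases "v = (-1, 0)") (auto simp: nodes_iff intro!: bexI[of _ "nat (fst v)"])
qed (auto simp: nodes_iff)

lemma finite_nodes: "finite (nodes L)"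
  by (auto simp: nodes_eq)

lemma card_nodes: "card (nodes L) = 2 ^ L"
proof -
  have "card (\<Union>l<L. (\<lambda>k. (int l, k)) ` {..<2 ^ l :: nat}) = (\<Sum>l<L. 2 ^ l)"
    by (subst card_UN_disjoint) (auto simp: card_image inj_on_def)
  also have "Suc \<dots> = 2 ^ L"
    by (induction L) auto
  finally show ?thesis
    by (subst nodes_eq, subst card_insert_disjoint) auto
qed

lemma finite_trees: "finite (trees L)"
  by (rule finite_subset[of _ "Pow (nodes L)"]) (auto simp: trees_def finite_nodes)

lemma root_in_tree: "T \<in> trees L \<Longrightarrow> (-1, 0) \<in> T"
  by (simp add: trees_def)

lemma tree_subset_nodes: "T \<in> trees L \<Longrightarrow> T \<subseteq> nodes L"
  by (simp add: trees_def)

lemma finite_tree: "T \<in> trees L \<Longrightarrow> finite T"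
  using finite_subset[OF tree_subset_nodes finite_nodes] .

lemma tree_parent: "T \<in> trees L \<Longrightarrow> v \<in> T \<Longrightarrow> 1 \<le> fst v \<Longrightarrow> (fst v - 1, snd v div 2) \<in> T"
  by (cases v) (auto simp: trees_def)

lemma ancestors_parent:
  assumes "1 \<le> fst v"
  shows "ancestors v = insert v (ancestors (fst v - 1, snd v div 2))"
proof -
  let ?p = "(fst v - 1, snd v div 2)"
  have pv: "(?p, v) \<in> anc" using assms by (simp add: anc_iff)
  have "u \<in> ancestors ?p" if "u \<in> ancestors v" "u \<noteq> v" for u
  proof -
    have "fst u < fst v"
      using that by (cases u; cases v) (force simp: ancestors_def anc_iff)
    then show ?thesis
      using that assms anc_linear[of u ?p v] pv by (auto simp: ancestors_def)
  qed
  then show ?thesis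
    using assms pv anc_trans[OF _ pv] by (auto simp: ancestors_def anc_refl)
qed

lemma ancestors_zero: "fst v = 0 \<Longrightarrow> ancestors v = {v}"
  by (cases v) (auto simp: ancestors_def anc_iff)

lemma ancestors_root: "ancestors (-1, 0) = {}"
  by (auto simp: ancestors_def anc_iff)

lemma tree_closed:
  assumes T: "T \<in> trees L" and "v \<in> T"
  shows "ancestors v \<subseteq> T"
  using \<open>v \<in> T\<close>
proof (induction "nat (fst v)" arbitrary: v)
  case 0
  have "v \<in> nodes L" using 0 tree_subset_nodes[OF T] by auto
  then have "v = (-1, 0) \<or> fst v = 0" using 0 by (auto simp: nodes_iff)
  then show ?case
    using 0(2) ancestors_zero[of v] ancestors_root by (elim disjE) simp_all
next
  case (Suc d)
  then have v: "1 \<le> fst v" by simp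
  show ?case
    using Suc.hyps(1)[of "(fst v - 1, snd v div 2)"] Suc.hyps(2) Suc.prems tree_parent[OF T Suc.prems v] v
    by (subst ancestors_parent) auto
qed

lemma trees_iff:
  "T \<in> trees L \<longleftrightarrow> T \<subseteq> nodes L \<and> (-1, 0) \<in> T \<and> (\<forall>v\<in>T. ancestors v \<subseteq> T)"
proof
  assume "T \<in> trees L"
  then show "T \<subseteq> nodes L \<and> (-1, 0) \<in> T \<and> (\<forall>v\<in>T. ancestors v \<subseteq> T)"
    using tree_closed tree_subset_nodes root_in_tree by blast
next
  assume *: "T \<subseteq> nodes L \<and> (-1, 0) \<in> T \<and> (\<forall>v\<in>T. ancestors v \<subseteq> T)"
  then have "(fst v - 1, snd v div 2) \<in> T" if "v \<in> T" "1 \<le> fst v" for v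
  proof -
    have "(fst v - 1, snd v div 2) \<in> ancestors v"
      using that by (simp add: ancestors_def anc_iff)
    then show ?thesis using * that by blast
  qed
  then show "T \<in> trees L" using * by (force simp: trees_def)
qed

lemma ancestors_subset_nodes:
  assumes "v \<in> nodes L"
  shows "ancestors v \<subseteq> nodes L"
proof -
  have "nodes L \<in> trees L"
    by (auto simp: trees_def nodes_def nat_diff_distrib power_diff
        div_less_iff_less_mult simp flip: power_Suc2)
  then show ?thesis using tree_closed assms by blast
qed

lemma ancestors_trans: "u \<in> ancestors v \<Longrightarrow> ancestors u \<subseteq> ancestors v"
  by (auto simp: ancestors_def intro: anc_trans)

lemma tree_add_ancestors:
  assumes "T \<in> trees L" "v \<in> nodes L"
  shows "T \<union> ancestors v \<in> trees L"
proof -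
  have "ancestors w \<subseteq> T \<union> ancestors v" if "w \<in> T \<union> ancestors v" for w
    using that ancestors_trans[of w v] tree_closed[OF assms(1), of w] by blast
  then show ?thesis
    using assms ancestors_subset_nodes[of v L] by (simp add: trees_iff)
qed

lemma card_ancestors:
  assumes "v \<in> nodes L"
  shows "card (ancestors v) \<le> L"
proof -
  have "inj_on fst (ancestors v)"
    by (auto simp: inj_on_def ancestors_def anc_iff)
  then have "card (ancestors v) = card (fst ` ancestors v)" by (simp add: card_image)
  also have "\<dots> \<le> card {0..<int L}"
    using ancestors_subset_nodes[OF assms] by (intro card_mono) (auto simp: nodes_iff ancestors_def)
  finally show ?thesis by simp
qed

lemma finite_ancestors: "v \<in> nodes L \<Longrightarrow> finite (ancestors v)"
  using finite_subset[OF ancestors_subset_nodes finite_nodes] .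

lemma tree_remove_leaf:
  assumes T: "T \<in> trees L" and v: "v \<in> T" "0 \<le> fst v"
    and leaf: "\<And>w. w \<in> T \<Longrightarrow> (v, w) \<in> anc \<Longrightarrow> w = v"
  shows "T - {v} \<in> trees L"
  using T v leaf by (auto simp: trees_iff ancestors_def)

lemma ext_node_iff:
  assumes T: "T \<in> trees L"
  shows "u \<in> ext_nodes T \<longleftrightarrow> u \<notin> T \<and> (u = (0, 0) \<or> 1 \<le> fst u \<and> (fst u - 1, snd u div 2) \<in> T)"
proof -
  have "(\<exists>v\<in>T. u \<in> children v) \<longleftrightarrow> u = (0, 0) \<or> 1 \<le> fst u \<and> (fst u - 1, snd u div 2) \<in> T" (is "?l \<longleftrightarrow> ?r")
  proof
    assume ?l
    then obtain v where v: "v \<in> T" "u \<in> children v" by auto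
    then have "v \<in> nodes L" using tree_subset_nodes[OF T] by auto
    then show ?r
    proof (cases "v = (-1, 0)")
      case False
      then have "0 \<le> fst v" using \<open>v \<in> nodes L\<close> by (auto simp: nodes_iff)
      then show ?thesis using v children_nonneg[of v u] by auto
    qed (use v in auto)
  next
    assume ?r
    then show ?l
    proof
      assume "u = (0, 0)"
      then show ?l using root_in_tree[OF T] by force
    next
      assume u: "1 \<le> fst u \<and> (fst u - 1, snd u div 2) \<in> T"
      then have "u \<in> children (fst u - 1, snd u div 2)"
        using children_nonneg[of "(fst u - 1, snd u div 2)" u] by auto
      then show ?l using u by blast
    qed
  qed
  then show ?thesis by (auto simp: ext_nodes_def)
qed

text \<open>The root has one child and each other node has two, all distinct, so the \<open>card T\<close> nodes have
  \<open>2 card T - 1\<close> children; \<open>card T - 1\<close> of them are the internal nodes other than the root.\<close>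

lemma card_ext_nodes:
  assumes T: "T \<in> trees L"
  shows "card (ext_nodes T) = card T"
proof -
  let ?r = "(-1, 0) :: node"
  have fin: "finite T" "finite (children v)" for v
    using finite_tree[OF T] by (auto, cases v) auto
  have ch: "children v = {(fst v + 1, 2 * snd v), (fst v + 1, 2 * snd v + 1)}" if "v \<in> T - {?r}" for v
    using that tree_subset_nodes[OF T] by (cases v) (force simp: nodes_iff)
  have "(\<Union>v\<in>T. children v) = (\<Union>v\<in>insert ?r (T - {?r}). children v)"
    using root_in_tree[OF T] by (simp only: insert_Diff)
  also have "\<dots> = insert (0, 0) (\<Union>v\<in>T - {?r}. children v)"
    by (simp only: UN_insert children.simps if_True refl insert_is_Un[symmetric])
  finally have U: "(\<Union>v\<in>T. children v) = insert (0, 0) (\<Union>v\<in>T - {?r}. children v)" .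
  have level: "1 \<le> fst u" if u: "u \<in> (\<Union>v\<in>T - {?r}. children v)" for u
  proof -
    obtain v where v: "v \<in> T - {?r}" "u \<in> children v" using u by (rule UN_E)
    then have "0 \<le> fst v" using tree_subset_nodes[OF T] by (auto simp: nodes_iff simp del: children.simps)
    then show ?thesis using v children_nonneg[of v u] by simp
  qed
  have "card (\<Union>v\<in>T - {?r}. children v) = (\<Sum>v\<in>T - {?r}. card (children v))"
  proof (rule card_UN_disjoint)
    show "\<forall>i\<in>T - {?r}. \<forall>j\<in>T - {?r}. i \<noteq> j \<longrightarrow> children i \<inter> children j = {}"
    proof (intro ballI impI)
      fix i j assume "i \<in> T - {?r}" "j \<in> T - {?r}" "i \<noteq> j"
      then show "children i \<inter> children j = {}"
        unfolding ch[OF \<open>i \<in> T - {?r}\<close>] ch[OF \<open>j \<in> T - {?r}\<close>]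
        by (cases i; cases j) (simp, presburger)
    qed
  qed (use fin in auto)
  also have "\<dots> = (\<Sum>v\<in>T - {?r}. 2)"
    by (intro sum.cong) (auto simp: ch simp del: children.simps)
  also have "\<dots> = 2 * (card T - 1)"
    using root_in_tree[OF T] by (simp add: card_Diff_singleton)
  finally have "card (\<Union>v\<in>T - {?r}. children v) = 2 * (card T - 1)" .
  moreover have "(0, 0) \<notin> (\<Union>v\<in>T - {?r}. children v)"
    using level[of "(0, 0)"] by auto
  ultimately have cU: "card (\<Union>v\<in>T. children v) = 2 * (card T - 1) + 1"
    using fin by (simp add: U)
  have "ext_nodes T = (\<Union>v\<in>T. children v) - (T - {?r})"
    using level[of ?r] unfolding ext_nodes_def U by (auto simp del: children.simps)
  moreover have "T - {?r} \<subseteq> (\<Union>v\<in>T. children v)"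
  proof
    fix u assume u: "u \<in> T - {?r}"
    then have un: "0 \<le> fst u" "snd u < 2 ^ nat (fst u)" using tree_subset_nodes[OF T] by (auto simp: nodes_iff)
    show "u \<in> (\<Union>v\<in>T. children v)"
    proof (cases "fst u = 0")
      case True
      then have "u = (0, 0)" using un by (cases u) auto
      then show ?thesis unfolding U by (simp only: insertI1)
    next
      case False
      then have p: "(fst u - 1, snd u div 2) \<in> T" using tree_parent[OF T] u un by auto
      have "u \<in> children (fst u - 1, snd u div 2)"
        using children_nonneg[of "(fst u - 1, snd u div 2)" u] un False by auto
      then show ?thesis using p by blast
    qed
  qed
  ultimately have "card (ext_nodes T) = 2 * (card T - 1) + 1 - (card T - 1)"
    using fin root_in_tree[OF T] by (simp add: card_Diff_subset cU card_Diff_singleton)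
  moreover have "card T \<ge> 1"
    using fin(1) root_in_tree[OF T] by (metis One_nat_def Suc_leI card_gt_0_iff empty_iff)
  ultimately show ?thesis by simp
qed

section \<open>Signals, junk and the potential of a tree\<close>

definition target_tree :: "node set \<Rightarrow> tree" where
  "target_tree B = insert (-1, 0) (\<Union>b\<in>B. ancestors b)"

text \<open>Usefulness is relative to the signals present in \<open>T\<close>: an ancestor of a signal that \<open>T\<close>
  has not reached yet is junk.\<close>

definition junk :: "node set \<Rightarrow> tree \<Rightarrow> node set" where
  "junk B T = {w \<in> T. 0 \<le> fst w \<and> (\<forall>b\<in>B \<inter> T. w \<notin> ancestors b)}"

text \<open>A move that gains a signal may add up to \<open>L\<close> junk nodes; the weight \<open>L + 1\<close> of a missing
  signal makes up for them.  The factor 16 turns a good move of probability \<open>1/8\<close> into an expected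
  decrease of 2, of which the bad moves use up at most 1.\<close>

definition potential :: "nat \<Rightarrow> node set \<Rightarrow> tree \<Rightarrow> real" where
  "potential L B T = 16 * (real (L + 1) * real (card (B - T)) + real (card (junk B T)))"

lemma target_tree:
  assumes B: "B \<subseteq> nodes L"
  shows "target_tree B \<in> trees L"
proof -
  have "target_tree B \<subseteq> nodes L"
    using ancestors_subset_nodes B by (auto simp: target_tree_def nodes_iff[of "(-1, 0)"])
  moreover have "ancestors v \<subseteq> target_tree B" if v: "v \<in> target_tree B" for v
  proof (cases "v = (-1, 0)")
    case False
    then obtain b where "b \<in> B" "v \<in> ancestors b" using v unfolding target_tree_def by blast
    then show ?thesis using ancestors_trans[of v b] unfolding target_tree_def by blast
  qed (simp add: ancestors_root)
  ultimately show ?thesis by (auto simp: trees_iff target_tree_def)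
qed

lemma target_tree_unique:
  assumes B: "B \<subseteq> nodes L" and T: "T \<in> trees L" "B \<subseteq> T" "junk B T = {}"
  shows "T = target_tree B"
proof
  show "target_tree B \<subseteq> T"
    using T(2) tree_closed[OF T(1)] root_in_tree[OF T(1)] unfolding target_tree_def by blast
  show "T \<subseteq> target_tree B"
  proof
    fix v assume v: "v \<in> T"
    then have "v = (-1, 0) \<or> 0 \<le> fst v"
      using tree_subset_nodes[OF T(1)] nodes_iff by blast
    moreover have "\<exists>b\<in>B. v \<in> ancestors b" if "0 \<le> fst v"
      using that T(3) v unfolding junk_def by blast
    ultimately show "v \<in> target_tree B" unfolding target_tree_def by blast
  qed
qed

lemma ex_min_level:
  assumes "finite (A :: node set)" "A \<noteq> {}"
  obtains v where "v \<in> A" "\<And>w. w \<in> A \<Longrightarrow> fst v \<le> fst w"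
proof -
  have "Min (fst ` A) \<in> fst ` A" using assms by (intro Min_in) auto
  then obtain v where "v \<in> A" "fst v = Min (fst ` A)" by (metis imageE)
  then show ?thesis using that assms(1) by simp
qed

lemma finite_junk: "T \<in> trees L \<Longrightarrow> finite (junk B T)"
  using finite_tree[of T L] by (auto simp: junk_def)

text \<open>A junk node of maximal level: nodes of \<open>T\<close> below a junk node are junk as well.\<close>

lemma junk_leaf:
  assumes T: "T \<in> trees L" and "junk B T \<noteq> {}"
  obtains v where "v \<in> T" "v \<notin> B" "0 \<le> fst v" "\<And>w. w \<in> T \<Longrightarrow> (v, w) \<in> anc \<Longrightarrow> w = v"
proof -
  have "Max (fst ` junk B T) \<in> fst ` junk B T"
    using assms finite_junk[OF T, of B] by (intro Max_in) auto
  then obtain v where "v \<in> junk B T" "fst v = Max (fst ` junk B T)" by (metis imageE)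
  then have v: "v \<in> junk B T" "\<And>w. w \<in> junk B T \<Longrightarrow> fst w \<le> fst v"
    using finite_junk[OF T, of B] by auto
  have "v \<notin> B" using v(1) anc_refl[of v] unfolding junk_def ancestors_def by blast
  moreover have "w = v" if "w \<in> T" "(v, w) \<in> anc" for w
  proof -
    have v0: "0 \<le> fst v" using v(1) by (auto simp: junk_def)
    then have le: "fst v \<le> fst w" using that by (simp add: anc_iff)
    have "w \<in> junk B T"
      using v(1) that v0 le by (auto simp: junk_def ancestors_def intro: anc_trans)
    then have "fst w = fst v" using v(2)[of w] le by linarith
    then show ?thesis using that v0 by (cases v; cases w) (auto simp: anc_iff)
  qed
  ultimately show ?thesis using that[of v] v(1) unfolding junk_def by blast
qed

text \<open>The properties of the neighborhoods on which the drift rests.  The last two say that there is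
  always a good move: a missing signal can be gained, and junk can be pruned.\<close>

locale tree_moves =
  fixes L :: nat and Ng Np :: "tree \<Rightarrow> tree set" and B :: "node set"
  assumes signal_nodes: "B \<subseteq> nodes L"
    and grow_tree: "\<And>T T'. T \<in> trees L \<Longrightarrow> T' \<in> Ng T \<Longrightarrow> T' \<in> trees L"
    and grow_strict: "\<And>T T'. T \<in> trees L \<Longrightarrow> T' \<in> Ng T \<Longrightarrow> T \<subset> T'"
    and grow_size: "\<And>T T'. T \<in> trees L \<Longrightarrow> T' \<in> Ng T \<Longrightarrow> card (T' - T) \<le> L"
    and prune_tree: "\<And>T T'. T \<in> trees L \<Longrightarrow> T' \<in> Np T \<Longrightarrow> T' \<in> trees L"
    and prune_iff_grow: "\<And>T T'. T \<in> trees L \<Longrightarrow> T' \<in> trees L \<Longrightarrow> T' \<in> Np T \<longleftrightarrow> T \<in> Ng T'"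
    and card_grow: "\<And>T. T \<in> trees L \<Longrightarrow> card (Ng T) \<le> 2 ^ L"
    and card_prune: "\<And>T. T \<in> trees L \<Longrightarrow> card (Np T) \<le> 2 ^ L"
    and grow_signal: "\<And>T. T \<in> trees L \<Longrightarrow> \<not> B \<subseteq> T \<Longrightarrow> \<exists>T'\<in>Ng T. (T' - T) \<inter> B \<noteq> {}"
    and prune_junk: "\<And>T. T \<in> trees L \<Longrightarrow> junk B T \<noteq> {} \<Longrightarrow> \<exists>T'\<in>Np T. (T - T') \<inter> B = {}"
begin

lemma finite_signals: "finite B"
  using finite_subset[OF signal_nodes finite_nodes] .

lemma finite_grow: "T \<in> trees L \<Longrightarrow> finite (Ng T)"
  using grow_tree by (intro finite_subset[OF _ finite_trees[of L]]) auto

lemma finite_prune: "T \<in> trees L \<Longrightarrow> finite (Np T)"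
  using prune_tree by (intro finite_subset[OF _ finite_trees[of L]]) auto

lemma prune_strict: "T \<in> trees L \<Longrightarrow> T' \<in> Np T \<Longrightarrow> T' \<subset> T"
  using grow_strict prune_iff_grow prune_tree by blast

lemma prune_size: "T \<in> trees L \<Longrightarrow> T' \<in> Np T \<Longrightarrow> card (T - T') \<le> L"
  using grow_size prune_iff_grow prune_tree by blast

lemma potential_nonneg: "0 \<le> potential L B T"
  by (simp add: potential_def)

lemma potential_le:
  assumes T: "T \<in> trees L"
  shows "potential L B T \<le> 16 * (real (L + 2) * 2 ^ L)"
proof -
  have "card (B - T) \<le> card (nodes L)"
    using signal_nodes by (intro card_mono finite_nodes) auto
  then have B: "real (card (B - T)) \<le> 2 ^ L"
    by (metis card_nodes of_nat_le_iff of_nat_numeral of_nat_power)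
  have "card (junk B T) \<le> card (nodes L)"
    using tree_subset_nodes[OF T] by (intro card_mono finite_nodes) (auto simp: junk_def)
  then have J: "real (card (junk B T)) \<le> 2 ^ L"
    by (metis card_nodes of_nat_le_iff of_nat_numeral of_nat_power)
  have "real (L + 1) * real (card (B - T)) + real (card (junk B T)) \<le> real (L + 1) * 2 ^ L + 2 ^ L"
    by (intro add_mono mult_left_mono B J) simp
  also have "\<dots> = real (L + 2) * 2 ^ L" by (simp add: algebra_simps)
  finally show ?thesis unfolding potential_def by (intro mult_left_mono) auto
qed

lemma grow_junk:
  assumes T: "T \<in> trees L" "T' \<in> Ng T"
  shows "card (junk B T') \<le> card (junk B T) + L"
proof -
  have "junk B T' \<subseteq> junk B T \<union> (T' - T)"
    using grow_strict[OF T] by (auto simp: junk_def)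
  then have "card (junk B T') \<le> card (junk B T \<union> (T' - T))"
    using finite_junk[OF T(1)] finite_tree[OF grow_tree[OF T]] by (intro card_mono) auto
  also have "\<dots> \<le> card (junk B T) + card (T' - T)" by (rule card_Un_le)
  finally show ?thesis using grow_size[OF T] by simp
qed

lemma potential_grow_signal:
  assumes T: "T \<in> trees L" "T' \<in> Ng T" and hit: "(T' - T) \<inter> B \<noteq> {}"
  shows "potential L B T' \<le> potential L B T - 16"
proof -
  have "B - T' \<subset> B - T" using hit grow_strict[OF T] by auto
  then have "card (B - T') < card (B - T)"
    using finite_signals by (intro psubset_card_mono) auto
  then have "real (L + 1) * (real (card (B - T')) + 1) \<le> real (L + 1) * real (card (B - T))"
    by (intro mult_left_mono) auto
  moreover have "real (card (junk B T')) \<le> real (card (junk B T)) + real L"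
    using grow_junk[OF T] by (simp flip: of_nat_add)
  ultimately show ?thesis by (simp add: potential_def algebra_simps)
qed

lemma potential_grow:
  assumes T: "T \<in> trees L" "T' \<in> Ng T"
  shows "potential L B T' \<le> potential L B T + 16 * real L"
proof -
  have "card (B - T') \<le> card (B - T)"
    using finite_signals grow_strict[OF T] by (intro card_mono) auto
  then have "real (L + 1) * real (card (B - T')) \<le> real (L + 1) * real (card (B - T))"
    by (intro mult_left_mono) auto
  moreover have "real (card (junk B T')) \<le> real (card (junk B T)) + real L"
    using grow_junk[OF T] by (simp flip: of_nat_add)
  ultimately show ?thesis by (simp add: potential_def algebra_simps)
qed

text \<open>A pruned set is closed under descendants in \<open>T\<close>; if it contains no signal, all of it is junk,
  and no other node becomes junk.\<close>

lemma potential_prune_junk: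
  assumes T: "T \<in> trees L" "T' \<in> Np T" and miss: "(T - T') \<inter> B = {}"
  shows "potential L B T' \<le> potential L B T - 16"
proof -
  note T' = prune_tree[OF T] and sub = prune_strict[OF T]
  have "junk B T' \<subseteq> junk B T - (T - T')"
    using sub miss by (auto simp: junk_def)
  moreover have removed: "T - T' \<subseteq> junk B T"
  proof
    fix w assume w: "w \<in> T - T'"
    then have "w \<in> nodes L" "w \<noteq> (-1, 0)"
      using tree_subset_nodes[OF T(1)] root_in_tree[OF T'] by auto
    moreover have "w \<notin> ancestors b" if "b \<in> B \<inter> T" for b
      using tree_closed[OF T', of b] that miss w by auto
    ultimately show "w \<in> junk B T" using w by (auto simp: junk_def nodes_iff)
  qed
  ultimately have "junk B T' \<subset> junk B T" using sub by blast
  then have "card (junk B T') < card (junk B T)"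
    using finite_junk[OF T(1)] by (intro psubset_card_mono) auto
  moreover have "B - T' = B - T" using sub miss by auto
  ultimately show ?thesis by (simp add: potential_def)
qed

end

section \<open>CART moves and twiggy moves\<close>

text \<open>The single node that CART adds is a missing signal of minimal level.  Its ancestors lie in
  \<open>B\<close> because \<open>B\<close> is a tree, hence in \<open>T\<close> by minimality.\<close>

lemma cart_moves:
  assumes B: "B \<in> trees L" and "0 < L"
  shows "tree_moves L (cart_grow L) (cart_prune L) B"
proof
  show "B \<subseteq> nodes L" by (rule tree_subset_nodes[OF B])
  fix T T' assume T: "T \<in> trees L"
  show "T' \<in> trees L" if "T' \<in> cart_grow L T" using that by (simp add: cart_grow_def)
  show "T \<subset> T'" if "T' \<in> cart_grow L T" using that by (auto simp: cart_grow_def)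
  show "card (T' - T) \<le> L" if "T' \<in> cart_grow L T" using that \<open>0 < L\<close> by (auto simp: cart_grow_def)
  show "T' \<in> trees L" if "T' \<in> cart_prune L T" using that by (simp add: cart_prune_def)
  show "T' \<in> cart_prune L T \<longleftrightarrow> T \<in> cart_grow L T'" if "T' \<in> trees L"
    using that T by (auto simp: cart_prune_def cart_grow_def)
next
  fix T assume T: "T \<in> trees L"
  have "cart_grow L T \<subseteq> (\<lambda>v. insert v T) ` nodes L"
  proof
    fix T' assume "T' \<in> cart_grow L T"
    then have "T' \<in> trees L" "T \<subseteq> T'" "card (T' - T) = 1" by (auto simp: cart_grow_def)
    then obtain v where v: "T' - T = {v}" by (auto simp: card_1_singleton_iff)
    then have "v \<in> nodes L" "T' = insert v T"
      using \<open>T \<subseteq> T'\<close> tree_subset_nodes[OF \<open>T' \<in> trees L\<close>] by auto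
    then show "T' \<in> (\<lambda>v. insert v T) ` nodes L" by auto
  qed
  then show "card (cart_grow L T) \<le> 2 ^ L"
    using surj_card_le[OF finite_nodes, of "cart_grow L T"] by (simp add: card_nodes)
  have "cart_prune L T \<subseteq> (\<lambda>v. T - {v}) ` nodes L"
  proof
    fix T' assume "T' \<in> cart_prune L T"
    then have "T' \<subseteq> T" "card (T - T') = 1" by (auto simp: cart_prune_def)
    then obtain v where v: "T - T' = {v}" by (auto simp: card_1_singleton_iff)
    then have "v \<in> nodes L" "T' = T - {v}"
      using \<open>T' \<subseteq> T\<close> tree_subset_nodes[OF T] by auto
    then show "T' \<in> (\<lambda>v. T - {v}) ` nodes L" by auto
  qed
  then show "card (cart_prune L T) \<le> 2 ^ L"
    using surj_card_le[OF finite_nodes, of "cart_prune L T"] by (simp add: card_nodes)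
  show "\<exists>T'\<in>cart_grow L T. (T' - T) \<inter> B \<noteq> {}" if new: "\<not> B \<subseteq> T"
  proof -
    have "finite (B - T)" using finite_tree[OF B] by simp
    then obtain v where v: "v \<in> B - T" "\<And>w. w \<in> B - T \<Longrightarrow> fst v \<le> fst w"
      using new ex_min_level[of "B - T"] by (metis Diff_eq_empty_iff)
    have "ancestors v \<subseteq> insert v T"
    proof
      fix w assume w: "w \<in> ancestors v"
      then have "w \<in> B" using tree_closed[OF B, of v] v(1) by auto
      moreover have "fst w < fst v \<or> w = v"
        using w by (cases v; cases w) (auto simp: ancestors_def anc_iff)
      ultimately show "w \<in> insert v T" using v(2)[of w] by force
    qed
    then have "insert v T \<in> trees L"
      using T v(1) tree_subset_nodes[OF B] by (auto simp: trees_iff)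
    moreover have "insert v T - T = {v}" using v by auto
    ultimately show ?thesis
      using v(1) by (intro bexI[of _ "insert v T"]) (auto simp: cart_grow_def)
  qed
  show "\<exists>T'\<in>cart_prune L T. (T - T') \<inter> B = {}" if stray: "junk B T \<noteq> {}"
  proof -
    obtain v where v: "v \<in> T" "v \<notin> B" "0 \<le> fst v" "\<And>w. w \<in> T \<Longrightarrow> (v, w) \<in> anc \<Longrightarrow> w = v"
      using junk_leaf[OF T stray] by blast
    have "T - {v} \<in> trees L" by (rule tree_remove_leaf[OF T v(1,3,4)])
    moreover have "T - (T - {v}) = {v}" using v by auto
    ultimately show ?thesis
      using v by (intro bexI[of _ "T - {v}"]) (auto simp: cart_prune_def)
  qed
qed

lemma ext_node_level: "T \<in> trees L \<Longrightarrow> u \<in> ext_nodes T \<Longrightarrow> 0 \<le> fst u"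
  by (auto simp: ext_node_iff)

text \<open>The part of the path to \<open>v\<close> above the external node \<open>u\<close> lies in \<open>T\<close>, and nothing below \<open>u\<close>
  does.  So the grown tree is determined by \<open>v\<close> alone, which bounds the number of grow moves by the
  number of nodes instead of the number of pairs of nodes.\<close>

lemma graft_eq:
  assumes T: "T \<in> trees L" and u: "u \<in> ext_nodes T" "(u, v) \<in> anc"
  shows "T \<union> path_between u v = T \<union> ancestors v" "T \<inter> path_between u v = {}"
proof -
  note u0 = ext_node_level[OF T u(1)]
  have "w \<in> T" if w: "w \<in> ancestors v" "w \<notin> path_between u v" for w
  proof -
    have w0: "0 \<le> fst w" "(w, v) \<in> anc" using w by (auto simp: ancestors_def)
    then have "(u, w) \<notin> anc" using w(2) by (auto simp: path_between_def)
    then have lt: "fst w < fst u" and wu: "(w, u) \<in> anc"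
      using anc_linear[OF u0 w0(1) u(2) w0(2)] anc_linear[OF w0(1) u0 w0(2) u(2)] by linarith+
    let ?p = "(fst u - 1, snd u div 2)"
    have u1: "1 \<le> fst u" using lt w0 by linarith
    then have "?p \<in> T" using u(1) by (auto simp: ext_node_iff[OF T])
    moreover have "w \<in> ancestors ?p"
      using wu w0 lt ancestors_parent[OF u1] by (auto simp: ancestors_def)
    ultimately show ?thesis using tree_closed[OF T] by auto
  qed
  moreover have "path_between u v \<subseteq> ancestors v"
    using u0 by (auto simp: path_between_def ancestors_def anc_iff[of u])
  ultimately show "T \<union> path_between u v = T \<union> ancestors v" by auto
  have "u \<notin> T" using u(1) by (simp add: ext_node_iff[OF T])
  then show "T \<inter> path_between u v = {}"
    using tree_closed[OF T] u0 by (auto simp: path_between_def ancestors_def)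
qed

text \<open>The first node outside \<open>T\<close> on the way down to \<open>v\<close>.\<close>

lemma entry_node:
  assumes T: "T \<in> trees L" and v: "v \<in> nodes L" "v \<notin> T"
  obtains u where "u \<in> ext_nodes T" "(u, v) \<in> anc" "twig_ends L u v"
proof -
  have v0: "0 \<le> fst v" "fst v < int L" using v root_in_tree[OF T] by (auto simp: nodes_iff)
  have "finite (ancestors v - T)" "v \<in> ancestors v - T"
    using v v0 finite_ancestors by (auto simp: ancestors_def anc_refl)
  then obtain u where u: "u \<in> ancestors v - T" "\<And>w. w \<in> ancestors v - T \<Longrightarrow> fst u \<le> fst w"
    using ex_min_level[of "ancestors v - T"] by (metis empty_iff)
  have u0: "0 \<le> fst u" "(u, v) \<in> anc" using u(1) by (auto simp: ancestors_def)
  have "u \<in> nodes L" using u(1) ancestors_subset_nodes[OF v(1)] by auto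
  have "u \<in> ext_nodes T"
  proof (cases "fst u = 0")
    case True
    then have "u = (0, 0)" using \<open>u \<in> nodes L\<close> by (cases u) (auto simp: nodes_iff)
    then show ?thesis using u(1) by (simp add: ext_node_iff[OF T])
  next
    case False
    then have u1: "1 \<le> fst u" using u0 by simp
    then have "(fst u - 1, snd u div 2) \<in> ancestors u"
      by (simp add: ancestors_def anc_iff)
    then have "(fst u - 1, snd u div 2) \<in> ancestors v"
      using ancestors_trans[of u v] u(1) by auto
    then have "(fst u - 1, snd u div 2) \<in> T" using u(2) by force
    then show ?thesis using u(1) u1 by (simp add: ext_node_iff[OF T])
  qed
  moreover have "twig_ends L u v"
    using u0 v0 by (auto simp: twig_ends_def anc_iff)
  ultimately show ?thesis using that u0 by blast
qed

lemma twiggy_growI: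
  "T \<union> path_between u v \<in> trees L \<Longrightarrow> u \<in> ext_nodes T \<Longrightarrow> twig_ends L u v \<Longrightarrow>
    T \<union> path_between u v \<in> twiggy_grow L T"
  unfolding twiggy_grow_def by blast

lemma twiggy_pruneI:
  "u \<in> T \<Longrightarrow> 0 \<le> fst u \<Longrightarrow> {w \<in> T. (u, w) \<in> anc} = path_between u v \<Longrightarrow> twig_ends L u v \<Longrightarrow>
    T - path_between u v \<in> trees L \<Longrightarrow> T - path_between u v \<in> twiggy_prune L T"
  unfolding twiggy_prune_def Let_def by (intro CollectI conjI bexI[of _ u] exI[of _ u] exI[of _ v]) simp_all

lemma twiggy_grow_obtain:
  assumes T: "T \<in> trees L" and "T' \<in> twiggy_grow L T"
  obtains u v where "T' \<in> trees L" "u \<in> ext_nodes T" "twig_ends L u v" "v \<in> nodes L" "v \<notin> T"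
    "T' = T \<union> path_between u v" "T' = T \<union> ancestors v"
proof -
  obtain u v where uv: "T' \<in> trees L" "u \<in> ext_nodes T" "twig_ends L u v" "T' = T \<union> path_between u v"
    using assms(2) by (auto simp: twiggy_grow_def)
  have a: "(u, v) \<in> anc" using uv by (simp add: twig_ends_def)
  have "v \<in> path_between u v" using a by (simp add: path_between_def anc_refl)
  then have "v \<in> nodes L" "v \<notin> T"
    using uv graft_eq(2)[OF T uv(2) a] tree_subset_nodes[OF uv(1)] by auto
  then show ?thesis using that uv graft_eq(1)[OF T uv(2) a] by blast
qed

text \<open>The twig that is pruned below \<open>u\<close> must start at \<open>u\<close>, because its upper end and \<open>u\<close> are
  ancestors of each other.\<close>

lemma twiggy_prune_iff_grow:
  assumes T: "T \<in> trees L" and T': "T' \<in> trees L"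
  shows "T' \<in> twiggy_prune L T \<longleftrightarrow> T \<in> twiggy_grow L T'"
proof
  assume "T' \<in> twiggy_prune L T"
  then obtain u a b where u: "u \<in> T" "0 \<le> fst u" and ab: "twig_ends L a b"
    and D: "{v \<in> T. (u, v) \<in> anc} = path_between a b" and eq: "T' = T - path_between a b"
    by (auto simp: twiggy_prune_def Let_def)
  have "u \<in> path_between a b" using D u(1) anc_refl by blast
  moreover have "a \<in> path_between a b" using ab by (simp add: twig_ends_def path_between_def anc_refl)
  then have "a \<in> T" "(u, a) \<in> anc" using D by auto
  ultimately have "a = u" using anc_antisym[OF u(2), of a] by (simp add: path_between_def)
  have "u \<notin> T'" using \<open>u \<in> path_between a b\<close> eq by auto
  have "u \<in> ext_nodes T'"
  proof (cases "fst u = 0")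
    case True
    have "u \<in> nodes L" using u tree_subset_nodes[OF T] by auto
    then have "u = (0, 0)" using True by (cases u) (auto simp: nodes_iff)
    then show ?thesis using \<open>u \<notin> T'\<close> by (simp add: ext_node_iff[OF T'])
  next
    case False
    then have u1: "1 \<le> fst u" using u by simp
    have "(fst u - 1, snd u div 2) \<notin> path_between a b"
      using \<open>a = u\<close> u by (auto simp: path_between_def anc_iff[OF u(2)])
    then have "(fst u - 1, snd u div 2) \<in> T'" using tree_parent[OF T u(1) u1] eq by auto
    then show ?thesis using \<open>u \<notin> T'\<close> u1 by (simp add: ext_node_iff[OF T'])
  qed
  moreover have "T = T' \<union> path_between u b"
    using eq D \<open>a = u\<close> by auto
  ultimately show "T \<in> twiggy_grow L T'"
    using T ab \<open>a = u\<close> twiggy_growI[of T' u b L] by simp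
next
  assume "T \<in> twiggy_grow L T'"
  then obtain u v where uv: "u \<in> ext_nodes T'" "twig_ends L u v" "T = T' \<union> path_between u v"
    by (auto simp: twiggy_grow_def)
  have a: "(u, v) \<in> anc" using uv by (simp add: twig_ends_def)
  note u0 = ext_node_level[OF T' uv(1)]
  have "u \<notin> T'" using uv(1) by (simp add: ext_node_iff[OF T'])
  then have "w \<notin> T'" if "(u, w) \<in> anc" for w
    using tree_closed[OF T', of w] that u0 by (auto simp: ancestors_def)
  then have "{w \<in> T. (u, w) \<in> anc} = path_between u v"
    using uv(3) by (auto simp: path_between_def)
  moreover have "T' = T - path_between u v"
    using graft_eq(2)[OF T' uv(1) a] uv(3) by auto
  moreover have "u \<in> T" using uv(3) a by (auto simp: path_between_def anc_refl)
  ultimately show "T' \<in> twiggy_prune L T"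
    using T' u0 uv(2) twiggy_pruneI[of u T v L] by simp
qed

lemma twiggy_moves:
  assumes B: "B \<subseteq> nodes L"
  shows "tree_moves L (twiggy_grow L) (twiggy_prune L) B"
proof
  show "B \<subseteq> nodes L" by (rule B)
  fix T T' assume T: "T \<in> trees L"
  show "T' \<in> trees L" if "T' \<in> twiggy_grow L T" using that by (auto simp: twiggy_grow_def)
  show "T \<subset> T'" if "T' \<in> twiggy_grow L T"
    using twiggy_grow_obtain[OF T that] root_in_tree[OF T]
    by (metis (no_types, lifting) Un_upper1 ancestors_def anc_refl in_mono mem_Collect_eq nodes_iff psubsetI sup_ge2)
  show "card (T' - T) \<le> L" if T': "T' \<in> twiggy_grow L T"
  proof -
    obtain v where v: "v \<in> nodes L" "T' = T \<union> ancestors v" using twiggy_grow_obtain[OF T T'] by metis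
    then have "card (T' - T) \<le> card (ancestors v)"
      using finite_ancestors by (intro card_mono) auto
    then show ?thesis using card_ancestors[OF v(1)] by simp
  qed
  show "T' \<in> trees L" if "T' \<in> twiggy_prune L T" using that by (auto simp: twiggy_prune_def)
  show "T' \<in> twiggy_prune L T \<longleftrightarrow> T \<in> twiggy_grow L T'" if "T' \<in> trees L"
    using twiggy_prune_iff_grow[OF T that] .
next
  fix T assume T: "T \<in> trees L"
  have "twiggy_grow L T \<subseteq> (\<lambda>v. T \<union> ancestors v) ` nodes L"
    using twiggy_grow_obtain[OF T] by (metis (no_types, lifting) image_eqI subsetI)
  then show "card (twiggy_grow L T) \<le> 2 ^ L"
    using surj_card_le[OF finite_nodes, of "twiggy_grow L T"] by (simp add: card_nodes)
  have "twiggy_prune L T \<subseteq> (\<lambda>u. T - {v \<in> T. (u, v) \<in> anc}) ` nodes L"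
    using tree_subset_nodes[OF T] by (auto simp: twiggy_prune_def Let_def)
  then show "card (twiggy_prune L T) \<le> 2 ^ L"
    using surj_card_le[OF finite_nodes, of "twiggy_prune L T"] by (simp add: card_nodes)
  show "\<exists>T'\<in>twiggy_grow L T. (T' - T) \<inter> B \<noteq> {}" if new: "\<not> B \<subseteq> T"
  proof -
    obtain v where v: "v \<in> B" "v \<notin> T" using new by blast
    then have vn: "v \<in> nodes L" using B by auto
    obtain u where u: "u \<in> ext_nodes T" "(u, v) \<in> anc" "twig_ends L u v"
      using entry_node[OF T vn v(2)] .
    let ?T' = "T \<union> path_between u v"
    have "?T' \<in> trees L"
      using tree_add_ancestors[OF T vn] graft_eq(1)[OF T u(1,2)] by simp
    moreover have "v \<in> ?T'" using u(2) by (simp add: path_between_def anc_refl)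
    ultimately show ?thesis
      using u v twiggy_growI[of T u v L] by (intro bexI[of _ ?T']) auto
  qed
  show "\<exists>T'\<in>twiggy_prune L T. (T - T') \<inter> B = {}" if stray: "junk B T \<noteq> {}"
  proof -
    obtain v where v: "v \<in> T" "v \<notin> B" "0 \<le> fst v" "\<And>w. w \<in> T \<Longrightarrow> (v, w) \<in> anc \<Longrightarrow> w = v"
      using junk_leaf[OF T stray] by blast
    have "T - {v} \<in> trees L" by (rule tree_remove_leaf[OF T v(1,3,4)])
    moreover have "{w \<in> T. (v, w) \<in> anc} = {v}" using v anc_refl by auto
    moreover have "path_between v v = {v}"
      using anc_antisym[OF v(3)] by (auto simp: path_between_def anc_refl)
    moreover have "v \<in> nodes L" using v(1) tree_subset_nodes[OF T] by blast
    then have "twig_ends L v v"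
      using v(3) by (auto simp: twig_ends_def anc_refl nodes_iff)
    ultimately have "T - {v} \<in> twiggy_prune L T"
      using v twiggy_pruneI[of v T v L] by simp
    then show ?thesis using v by (intro bexI[of _ "T - {v}"]) auto
  qed
qed

section \<open>Drift of the informed chains\<close>

lemma weighted_proposal_nonneg:
  assumes "\<And>U. U \<in> N T \<Longrightarrow> 0 \<le> w T U"
  shows "0 \<le> weighted_proposal N w T T'"
  using assms by (auto simp: weighted_proposal_def intro!: divide_nonneg_nonneg sum_nonneg)

lemma weighted_proposal_sum:
  assumes "finite X" "N T \<subseteq> X" and "\<And>U. U \<in> N T \<Longrightarrow> 0 \<le> w T U"
  shows "(\<Sum>T'\<in>X. weighted_proposal N w T T') \<le> 1"
proof -
  have "(\<Sum>T'\<in>X. weighted_proposal N w T T') = (\<Sum>T'\<in>N T. w T T' / (\<Sum>U\<in>N T. w T U))"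
    using assms by (intro sum.mono_neutral_cong_right) (auto simp: weighted_proposal_def)
  also have "\<dots> \<le> 1"
    by (simp flip: sum_divide_distrib add: divide_self_if)
  finally show ?thesis .
qed

text \<open>One member of \<open>G\<close> outweighs everything outside \<open>G\<close>.\<close>

lemma weighted_proposal_concentrates:
  assumes fin: "finite (N T)" and w: "\<And>U. U \<in> N T \<Longrightarrow> 0 \<le> w T U"
    and G: "G \<subseteq> N T" "V \<in> G" "0 < w T V" "(\<Sum>U\<in>N T - G. w T U) \<le> w T V"
  shows "1/2 \<le> (\<Sum>T'\<in>G. weighted_proposal N w T T')"
proof -
  let ?g = "\<Sum>U\<in>G. w T U" and ?b = "\<Sum>U\<in>N T - G. w T U"
  have "w T V \<le> ?g"
    using G w finite_subset[OF G(1) fin] by (intro member_le_sum) auto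
  then have b: "?b \<le> ?g" and g: "0 < ?g" using G by auto
  have Z: "(\<Sum>U\<in>N T. w T U) = ?b + ?g"
    using G(1) fin by (rule sum.subset_diff)
  have "0 \<le> ?b" using w by (intro sum_nonneg) auto
  then have "1/2 \<le> ?g / (?b + ?g)" using b g by (simp add: field_simps)
  also have "\<dots> = (\<Sum>T'\<in>G. weighted_proposal N w T T')"
    using G(1) by (auto simp: weighted_proposal_def Z sum_divide_distrib intro!: sum.cong)
  finally show ?thesis .
qed

text \<open>What the data have to provide.  The number \<open>\<Gamma>\<close> bounds from below the posterior gain of any set
  of at most \<open>L\<close> nodes that contains a signal, whatever noise nodes it contains besides.\<close>

locale informed_moves = tree_moves L Ng Np B
  for L :: nat and Ng Np B +
  fixes n :: nat and A c :: real and \<pi> :: "tree \<Rightarrow> real" and g :: "node \<Rightarrow> real" and \<Gamma> :: real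
  assumes n_pos: "0 < n"
    and post_pos: "\<And>T. T \<in> trees L \<Longrightarrow> 0 < \<pi> T"
    and post_sum: "(\<Sum>T\<in>trees L. \<pi> T) = 1"
    and post_ratio: "\<And>T T'. T \<in> trees L \<Longrightarrow> T' \<in> trees L \<Longrightarrow> T \<subseteq> T' \<Longrightarrow> \<pi> T' = \<pi> T * prod g (T' - T)"
    and factor_pos: "\<And>v. 0 < g v"
    and noise: "\<And>v. v \<in> nodes L - B \<Longrightarrow> g v \<le> 1 / real n powr (c - 3/2)"
    and signal: "\<And>D. D \<subseteq> nodes L \<Longrightarrow> D \<inter> B \<noteq> {} \<Longrightarrow> card D \<le> L \<Longrightarrow> \<Gamma> \<le> prod g D"
    and cap_le: "real n powr (A\<^sup>2 * ln (real n) / 8) \<le> \<Gamma>"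
    and signal_beats_prune: "2 * 2 ^ L * real n powr (c - 3/2) \<le> \<Gamma>"
    and many_nodes: "2 * 2 ^ L \<le> real n powr (c - 3/2)"
    and stray_small: "2 ^ L / real n powr (c - 3/2) * (16 * real L) + 2 ^ L / \<Gamma> * (16 * (real (L + 2) * 2 ^ L)) \<le> 1"
begin

abbreviation "\<kappa> \<equiv> real n powr (c - 3/2)"
abbreviation "cap \<equiv> real n powr (A\<^sup>2 * ln (real n) / 8)"
abbreviation "wg \<equiv> grow_weight n A \<pi>"
abbreviation "wp \<equiv> prune_weight n c \<pi>"
abbreviation "Sg \<equiv> weighted_proposal Ng wg"
abbreviation "Sp \<equiv> weighted_proposal Np wp"
abbreviation "S \<equiv> tree_proposal L Sg Sp"
abbreviation "M \<equiv> mh_kernel (trees L) S \<pi>"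
abbreviation "h \<equiv> potential L B"

lemma kappa_pos: "0 < \<kappa>" and kappa_ge_2: "2 \<le> \<kappa>"
proof -
  have "(1::real) \<le> 2 ^ L" by simp
  then show "2 \<le> \<kappa>" using many_nodes by linarith
  then show "0 < \<kappa>" by linarith
qed

lemma inverse_kappa_le_1: "1 / \<kappa> \<le> 1"
  using kappa_ge_2 kappa_pos by (subst divide_le_eq_1_pos) linarith+

lemma cap_ge_1: "1 \<le> cap"
  using n_pos by (intro ge_one_powr_ge_zero) auto

lemma Gamma_pos: "0 < \<Gamma>" using cap_ge_1 cap_le by linarith

lemma ratio_pos: "0 < prod g D" by (intro prod_pos) (use factor_pos in auto)

lemma noise_ratio:
  assumes D: "D \<subseteq> nodes L" "D \<noteq> {}" "D \<inter> B = {}"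
  shows "prod g D \<le> 1 / \<kappa>"
proof -
  obtain v where v: "v \<in> D" using D(2) by blast
  have fin: "finite D" using D(1) finite_nodes finite_subset by blast
  have le: "g w \<le> 1 / \<kappa>" if "w \<in> D" for w using noise[of w] that D by blast
  have "prod g D = g v * prod g (D - {v})" using fin v by (rule prod.remove)
  also have "\<dots> \<le> g v * 1"
  proof (intro mult_left_mono prod_le_1 conjI)
    show "g w \<le> 1" if "w \<in> D - {v}" for w using le[of w] inverse_kappa_le_1 that by auto
  qed (use less_imp_le[OF factor_pos] in blast)+
  finally show ?thesis using le[OF v] by simp
qed

lemma grow_ratio: "T \<in> trees L \<Longrightarrow> T' \<in> Ng T \<Longrightarrow> \<pi> T' / \<pi> T = prod g (T' - T)"
  using post_ratio[of T T'] post_pos[of T] grow_tree[of T T'] grow_strict[of T T'] by auto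

lemma prune_ratio: "T \<in> trees L \<Longrightarrow> T' \<in> Np T \<Longrightarrow> \<pi> T' / \<pi> T = 1 / prod g (T - T')"
  using post_ratio[of T' T] post_pos[of T'] prune_tree[of T T'] prune_strict[of T T']
  by (auto simp: field_simps)

lemma grow_diff: "T \<in> trees L \<Longrightarrow> T' \<in> Ng T \<Longrightarrow> T' - T \<subseteq> nodes L \<and> T' - T \<noteq> {}"
  using grow_tree[of T T'] grow_strict[of T T'] tree_subset_nodes[of T' L] by blast

lemma prune_diff: "T \<in> trees L \<Longrightarrow> T' \<in> Np T \<Longrightarrow> T - T' \<subseteq> nodes L \<and> T - T' \<noteq> {}"
  using prune_tree[of T T'] prune_strict[of T T'] tree_subset_nodes[of T L] by blast

lemma grow_signal_ratio: "T \<in> trees L \<Longrightarrow> T' \<in> Ng T \<Longrightarrow> (T' - T) \<inter> B \<noteq> {} \<Longrightarrow> \<Gamma> \<le> prod g (T' - T)"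
  using grow_diff[of T T'] grow_size[of T T'] by (intro signal) auto

lemma prune_signal_ratio: "T \<in> trees L \<Longrightarrow> T' \<in> Np T \<Longrightarrow> (T - T') \<inter> B \<noteq> {} \<Longrightarrow> \<Gamma> \<le> prod g (T - T')"
  using prune_diff[of T T'] prune_size[of T T'] by (intro signal) auto

lemma grow_noise_ratio: "T \<in> trees L \<Longrightarrow> T' \<in> Ng T \<Longrightarrow> (T' - T) \<inter> B = {} \<Longrightarrow> prod g (T' - T) \<le> 1 / \<kappa>"
  using grow_diff[of T T'] by (intro noise_ratio) auto

lemma prune_noise_ratio: "T \<in> trees L \<Longrightarrow> T' \<in> Np T \<Longrightarrow> (T - T') \<inter> B = {} \<Longrightarrow> prod g (T - T') \<le> 1 / \<kappa>"
  using prune_diff[of T T'] by (intro noise_ratio) auto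

lemma wg_pos: "T \<in> trees L \<Longrightarrow> T' \<in> Ng T \<Longrightarrow> 0 < wg T T'"
  using n_pos ratio_pos by (simp add: grow_weight_def grow_ratio)

lemma wp_bounds: "1 \<le> wp T T'" "wp T T' \<le> \<kappa>"
  using kappa_ge_2 by (auto simp: prune_weight_def)

lemma Sg_nonneg: "T \<in> trees L \<Longrightarrow> 0 \<le> Sg T T'"
  by (intro weighted_proposal_nonneg less_imp_le[OF wg_pos])

lemma Sp_nonneg: "0 \<le> Sp T T'"
  by (intro weighted_proposal_nonneg) (use wp_bounds(1) in \<open>force intro: order_trans[of 0 1]\<close>)

lemma real_card_grow: "T \<in> trees L \<Longrightarrow> N \<subseteq> Ng T \<Longrightarrow> real (card N) \<le> 2 ^ L"
  using card_mono[OF finite_grow, of T N] card_grow[of T]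
  by (metis of_nat_le_iff of_nat_numeral of_nat_power order_trans)

lemma real_card_prune: "T \<in> trees L \<Longrightarrow> N \<subseteq> Np T \<Longrightarrow> real (card N) \<le> 2 ^ L"
  using card_mono[OF finite_prune, of T N] card_prune[of T]
  by (metis of_nat_le_iff of_nat_numeral of_nat_power order_trans)

lemma nodes_per_kappa: "2 ^ L * (1 / \<kappa>) \<le> 1 / 2"
  using many_nodes kappa_pos by (simp add: field_simps)

lemma S_lower:
  assumes T: "T \<in> trees L"
  shows "Sg T T' / 2 \<le> S T T'" "Sp T T' / 2 \<le> S T T'"
proof -
  have "Np null_tree = {}"
  proof -
    have "null_tree \<in> trees L" by (auto simp: trees_def null_tree_def nodes_def)
    then show ?thesis
      using prune_strict[of null_tree] prune_tree[of null_tree] root_in_tree by (fastforce simp: null_tree_def)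
  qed
  then have null: "Sp null_tree T' = 0" by (simp add: weighted_proposal_def)
  have "Ng (full_tree L) = {}" if "full_tree L \<in> trees L"
    using grow_strict[OF that] grow_tree[OF that] tree_subset_nodes by (fastforce simp: full_tree_def)
  then have full: "Sg T T' = 0" if "T = full_tree L"
    using that T by (simp add: weighted_proposal_def)
  show "Sg T T' / 2 \<le> S T T'" "Sp T T' / 2 \<le> S T T'"
    using null full Sg_nonneg[OF T, of T'] Sp_nonneg[of T T'] by (auto simp: tree_proposal_def)
qed

lemma S_nonneg: "T \<in> trees L \<Longrightarrow> 0 \<le> S T T'"
  using Sg_nonneg Sp_nonneg by (auto simp: tree_proposal_def)

lemma S_sum:
  assumes T: "T \<in> trees L"
  shows "(\<Sum>T'\<in>trees L. S T T') \<le> 1"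
proof -
  have g: "(\<Sum>T'\<in>trees L. Sg T T') \<le> 1"
    using grow_tree[OF T] by (intro weighted_proposal_sum finite_trees less_imp_le[OF wg_pos] T) auto
  have p: "(\<Sum>T'\<in>trees L. Sp T T') \<le> 1"
    using prune_tree[OF T] order_trans[OF _ wp_bounds(1)]
    by (intro weighted_proposal_sum finite_trees) auto
  consider "T = null_tree" | "T \<noteq> null_tree" "T = full_tree L" | "T \<noteq> null_tree" "T \<noteq> full_tree L" by blast
  then show ?thesis
  proof cases
    case 3
    then have "(\<Sum>T'\<in>trees L. S T T') = (\<Sum>T'\<in>trees L. Sg T T') / 2 + (\<Sum>T'\<in>trees L. Sp T T') / 2"
      by (simp add: tree_proposal_def sum.distrib sum_divide_distrib)
    then show ?thesis using g p by simp
  qed (use g p in \<open>simp_all add: tree_proposal_def\<close>)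
qed

lemma S_le_1: "T \<in> trees L \<Longrightarrow> T' \<in> trees L \<Longrightarrow> S T T' \<le> 1"
  using member_le_sum[of T' "trees L" "S T"] S_nonneg[of T] S_sum[of T] finite_trees by force

lemma S_zero: "T' \<notin> Ng T \<Longrightarrow> T' \<notin> Np T \<Longrightarrow> S T T' = 0"
  unfolding tree_proposal_def weighted_proposal_def by (cases "T = null_tree"; cases "T = full_tree L") auto

lemma M_eq:
  "T \<in> trees L \<Longrightarrow> T' \<in> trees L \<Longrightarrow> T \<noteq> T' \<Longrightarrow> M T T' = min (S T T') (\<pi> T' / \<pi> T * S T' T)"
  by (intro mh_kernel_off_diagonal S_nonneg post_pos)

lemma M_nonneg: "T \<in> trees L \<Longrightarrow> T' \<in> trees L \<Longrightarrow> T \<noteq> T' \<Longrightarrow> 0 \<le> M T T'"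
  using S_nonneg post_pos by (simp add: M_eq less_imp_le)

text \<open>Whatever the proposal, a downhill move is made at most with the probability given by the
  posterior ratio.\<close>

lemma M_le_ratio:
  assumes "T \<in> trees L" "T' \<in> trees L" "T \<noteq> T'"
  shows "M T T' \<le> \<pi> T' / \<pi> T"
proof -
  have "\<pi> T' / \<pi> T * S T' T \<le> \<pi> T' / \<pi> T * 1"
    using assms post_pos S_le_1 by (intro mult_left_mono) (auto intro: less_imp_le)
  then show ?thesis using assms by (simp add: M_eq min_le_iff_disj)
qed

text \<open>All prune weights lie between \<open>1\<close> and \<open>\<kappa>\<close>, so the reverse move is proposed with probability at
  least \<open>1 / (2 * 2\<^sup>L \<kappa>)\<close>; the posterior gain \<open>\<Gamma>\<close> outweighs this.\<close>

lemma grow_signal_accepted: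
  assumes T: "T \<in> trees L" "T' \<in> Ng T" and hit: "(T' - T) \<inter> B \<noteq> {}"
  shows "M T T' = S T T'"
proof -
  have T': "T' \<in> trees L" "T \<noteq> T'" using grow_tree[OF T] grow_strict[OF T] by auto
  have reverse_move: "T \<in> Np T'" using prune_iff_grow T T' by blast
  have "(\<Sum>U\<in>Np T'. wp T' U) \<le> real (card (Np T')) * \<kappa>"
    using wp_bounds(2) by (intro sum_bounded_above) auto
  also have "\<dots> \<le> 2 ^ L * \<kappa>"
    using kappa_pos by (intro mult_right_mono real_card_prune[OF T'(1)]) auto
  finally have Z: "(\<Sum>U\<in>Np T'. wp T' U) \<le> 2 ^ L * \<kappa>" .
  moreover have "wp T' T \<le> (\<Sum>U\<in>Np T'. wp T' U)"
    using reverse_move finite_prune[OF T'(1)] order_trans[OF _ wp_bounds(1)] by (intro member_le_sum) auto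
  then have Z0: "0 < (\<Sum>U\<in>Np T'. wp T' U)" using wp_bounds(1)[of T' T] by linarith
  ultimately have "1 / (2 ^ L * \<kappa>) \<le> wp T' T / (\<Sum>U\<in>Np T'. wp T' U)"
    using wp_bounds(1)[of T' T] by (intro frac_le) auto
  then have "1 / (2 ^ L * \<kappa>) / 2 \<le> S T' T"
    using S_lower(2)[OF T'(1), of T] reverse_move by (simp add: weighted_proposal_def)
  then have "\<Gamma> * (1 / (2 ^ L * \<kappa>) / 2) \<le> prod g (T' - T) * S T' T"
    using grow_signal_ratio[OF T hit] kappa_pos by (intro mult_mono less_imp_le[OF ratio_pos]) auto
  moreover have "1 \<le> \<Gamma> * (1 / (2 ^ L * \<kappa>) / 2)"
    using signal_beats_prune kappa_pos by (simp add: field_simps)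
  ultimately have "S T T' \<le> \<pi> T' / \<pi> T * S T' T"
    using S_le_1[OF T(1) T'(1)] unfolding grow_ratio[OF T] by linarith
  then show ?thesis using T T' by (simp add: M_eq)
qed

text \<open>The posterior gain \<open>1/r\<close> cancels against the grow weight \<open>r\<close> of the reverse move.  What
  remains is its normalization: no signal is missing, so the \<open>2\<^sup>L\<close> grow weights are at most \<open>1/\<kappa>\<close>
  each and add up to at most \<open>1/2\<close>.\<close>

lemma prune_junk_accepted:
  assumes T: "T \<in> trees L" "T' \<in> Np T" and miss: "(T - T') \<inter> B = {}" and "B \<subseteq> T"
  shows "M T T' = S T T'"
proof -
  have T': "T' \<in> trees L" "T \<noteq> T'" using prune_tree[OF T] prune_strict[OF T] by auto
  have reverse_move: "T \<in> Ng T'" using prune_iff_grow T T' by blast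
  have "B \<subseteq> T'" using miss \<open>B \<subseteq> T\<close> by blast
  let ?r = "prod g (T - T')" and ?Z = "\<Sum>U\<in>Ng T'. wg T' U"
  have wg_le: "wg T' U \<le> 1 / \<kappa>" if U: "U \<in> Ng T'" for U
  proof -
    have "(U - T') \<inter> B = {}" using \<open>B \<subseteq> T'\<close> by blast
    then show ?thesis
      using grow_noise_ratio[OF T'(1) U] grow_ratio[OF T'(1) U]
      by (simp add: grow_weight_def min_le_iff_disj)
  qed
  have "?Z \<le> real (card (Ng T')) * (1 / \<kappa>)"
    using wg_le by (intro sum_bounded_above) auto
  also have "\<dots> \<le> 2 ^ L * (1 / \<kappa>)"
    using kappa_pos by (intro mult_right_mono real_card_grow[OF T'(1)]) auto
  also have "\<dots> \<le> 1 / 2" by (rule nodes_per_kappa)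
  finally have Z: "?Z \<le> 1 / 2" .
  have wgT: "wg T' T = ?r"
  proof -
    have "?r \<le> cap" using prune_noise_ratio[OF T miss] cap_ge_1 inverse_kappa_le_1 by linarith
    then show ?thesis unfolding grow_weight_def grow_ratio[OF T'(1) reverse_move] by (rule min_absorb1)
  qed
  have "wg T' T \<le> ?Z"
    using reverse_move finite_grow[OF T'(1)] less_imp_le[OF wg_pos[OF T'(1)]] by (intro member_le_sum) auto
  then have Z0: "0 < ?Z" using wgT ratio_pos[of "T - T'"] by linarith
  have "?r / ?Z / 2 \<le> S T' T"
    using S_lower(1)[OF T'(1), of T] reverse_move wgT by (simp add: weighted_proposal_def)
  then have "1 / ?r * (?r / ?Z / 2) \<le> 1 / ?r * S T' T"
    using ratio_pos[of "T - T'"] by (intro mult_left_mono) auto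
  moreover have "1 \<le> 1 / ?r * (?r / ?Z / 2)"
    using Z Z0 ratio_pos[of "T - T'"] by (simp add: field_simps)
  ultimately have "S T T' \<le> \<pi> T' / \<pi> T * S T' T"
    using S_le_1[OF T(1) T'(1)] unfolding prune_ratio[OF T] by linarith
  then show ?thesis using T T' by (simp add: M_eq)
qed

definition "grow_hits T = {T' \<in> Ng T. (T' - T) \<inter> B \<noteq> {}}"
definition "prune_misses T = {T' \<in> Np T. (T - T') \<inter> B = {}}"

text \<open>If a signal is missing, a grow move that gains one has at least the capped weight, against a total weight of at
  most \<open>2\<^sup>L / \<kappa>\<close> for all grow moves without signals.  If none is missing, a prune move without
  signals has the capped weight \<open>\<kappa>\<close>, and the others have weight at most \<open>1\<close>.\<close>

lemma progress:
  assumes T: "T \<in> trees L" "T \<noteq> target_tree B"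
  shows "1/4 \<le> (\<Sum>T'\<in>grow_hits T. M T T') + (\<Sum>T'\<in>prune_misses T. M T T')"
proof -
  have sub: "grow_hits T \<subseteq> Ng T" "prune_misses T \<subseteq> Np T"
    by (auto simp: grow_hits_def prune_misses_def)
  have nn: "0 \<le> (\<Sum>T'\<in>grow_hits T. M T T')" "0 \<le> (\<Sum>T'\<in>prune_misses T. M T T')"
  proof -
    show "0 \<le> (\<Sum>T'\<in>grow_hits T. M T T')"
      using T(1) grow_tree[OF T(1)] grow_strict[OF T(1)] sub by (intro sum_nonneg M_nonneg) blast+
    show "0 \<le> (\<Sum>T'\<in>prune_misses T. M T T')"
      using T(1) prune_tree[OF T(1)] prune_strict[OF T(1)] sub by (intro sum_nonneg M_nonneg) blast+
  qed
  show ?thesis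
  proof (cases "B \<subseteq> T")
    case False
    then obtain V where V: "V \<in> grow_hits T"
      using grow_signal[OF T(1)] by (auto simp: grow_hits_def)
    have "cap \<le> wg T V"
      using V grow_signal_ratio[OF T(1), of V] cap_le grow_ratio[OF T(1), of V]
      by (auto simp: grow_hits_def grow_weight_def)
    have "(\<Sum>U\<in>Ng T - grow_hits T. wg T U) \<le> real (card (Ng T - grow_hits T)) * (1 / \<kappa>)"
      using grow_noise_ratio[OF T(1)] grow_ratio[OF T(1)]
      by (intro sum_bounded_above) (auto simp: grow_hits_def grow_weight_def min_le_iff_disj)
    also have "\<dots> \<le> 2 ^ L * (1 / \<kappa>)"
      using kappa_pos by (intro mult_right_mono real_card_grow[OF T(1)]) auto
    also have "\<dots> \<le> 1" using nodes_per_kappa by linarith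
    also have "\<dots> \<le> wg T V" using \<open>cap \<le> wg T V\<close> cap_ge_1 by linarith
    finally have "1/2 \<le> (\<Sum>T'\<in>grow_hits T. Sg T T')"
      using V sub wg_pos[OF T(1)]
      by (intro weighted_proposal_concentrates[where N = Ng, OF finite_grow[OF T(1)]]) (auto intro: less_imp_le)
    also have "\<dots> \<le> (\<Sum>T'\<in>grow_hits T. 2 * M T T')"
    proof (intro sum_mono)
      fix T' assume "T' \<in> grow_hits T"
      then have "M T T' = S T T'" by (intro grow_signal_accepted T) (auto simp: grow_hits_def)
      then show "Sg T T' \<le> 2 * M T T'" using S_lower(1)[OF T(1), of T'] by linarith
    qed
    finally show ?thesis using nn by (simp flip: sum_distrib_left)
  next
    case True
    then have "junk B T \<noteq> {}" using target_tree_unique[OF signal_nodes T(1)] T(2) by blast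
    then obtain V where V: "V \<in> prune_misses T"
      using prune_junk[OF T(1)] by (auto simp: prune_misses_def)
    have "\<kappa> \<le> 1 / prod g (T - V)"
      using V prune_noise_ratio[OF T(1), of V] ratio_pos[of "T - V"] kappa_pos
      by (auto simp: prune_misses_def field_simps)
    then have wV: "wp T V = \<kappa>"
      using V prune_ratio[OF T(1), of V] by (auto simp: prune_misses_def prune_weight_def)
    have w1: "wp T U \<le> 1" if U: "U \<in> Np T - prune_misses T" for U
    proof -
      have "\<Gamma> \<le> prod g (T - U)"
        using U by (intro prune_signal_ratio[OF T(1)]) (auto simp: prune_misses_def)
      then have "1 / prod g (T - U) \<le> 1"
        using cap_ge_1 cap_le by (simp add: divide_le_eq_1)
      then show ?thesis using U prune_ratio[OF T(1), of U] by (auto simp: prune_weight_def)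
    qed
    have "(\<Sum>U\<in>Np T - prune_misses T. wp T U) \<le> real (card (Np T - prune_misses T)) * 1"
      using w1 by (intro sum_bounded_above) auto
    also have "\<dots> \<le> 2 ^ L"
      using real_card_prune[OF T(1), of "Np T - prune_misses T"] by simp
    also have "\<dots> \<le> wp T V"
    proof -
      have "(0::real) < 2 ^ L" by simp
      then show ?thesis using many_nodes wV by linarith
    qed
    finally have "1/2 \<le> (\<Sum>T'\<in>prune_misses T. Sp T T')"
      using V sub wV kappa_pos order_trans[OF _ wp_bounds(1)]
      by (intro weighted_proposal_concentrates[where N = Np, OF finite_prune[OF T(1)]]) auto
    also have "\<dots> \<le> (\<Sum>T'\<in>prune_misses T. 2 * M T T')"
    proof (intro sum_mono)
      fix T' assume "T' \<in> prune_misses T"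
      then have "M T T' = S T T'" by (intro prune_junk_accepted T True) (auto simp: prune_misses_def)
      then show "Sp T T' \<le> 2 * M T T'" using S_lower(2)[OF T(1), of T'] by linarith
    qed
    finally show ?thesis using nn by (simp flip: sum_distrib_left)
  qed
qed

text \<open>The two kinds of bad moves contribute at most 1 together: growing noise happens with
  probability at most \<open>1/\<kappa>\<close> and adds at most \<open>L\<close> junk nodes; pruning a signal may cost the whole
  range of the potential, but happens with probability at most \<open>1/\<Gamma>\<close>.\<close>

lemma potential_change:
  assumes T: "T \<in> trees L"
  shows "(\<Sum>T'\<in>trees L - {T}. M T T' * (h T' - h T)) \<le>
    1 - 16 * ((\<Sum>T'\<in>grow_hits T. M T T') + (\<Sum>T'\<in>prune_misses T. M T T'))"
proof -
  let ?f = "\<lambda>T'. M T T' * (h T' - h T)"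
  let ?H = "16 * (real (L + 2) * 2 ^ L)"
  have g: "T' \<in> trees L" "T \<noteq> T'" if "T' \<in> Ng T" for T'
    using grow_tree[OF T that] grow_strict[OF T that] by auto
  have p: "T' \<in> trees L" "T \<noteq> T'" if "T' \<in> Np T" for T'
    using prune_tree[OF T that] prune_strict[OF T that] by auto
  have gM: "0 \<le> M T T'" if "T' \<in> Ng T" for T' using M_nonneg[OF T g[OF that]] .
  have pM: "0 \<le> M T T'" if "T' \<in> Np T" for T' using M_nonneg[OF T p[OF that]] .
  have "(\<Sum>T'\<in>trees L - {T}. ?f T') = (\<Sum>T'\<in>Ng T \<union> Np T. ?f T')"
  proof (rule sum.mono_neutral_right)
    show "\<forall>T'\<in>trees L - {T} - (Ng T \<union> Np T). ?f T' = 0"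
    proof
      fix T' assume T': "T' \<in> trees L - {T} - (Ng T \<union> Np T)"
      then have "S T T' = 0" by (intro S_zero) auto
      moreover have "S T' T \<ge> 0" using T' S_nonneg by auto
      ultimately have "M T T' = 0" using T' T post_pos by (subst M_eq) (auto simp: less_imp_le)
      then show "?f T' = 0" by simp
    qed
  qed (use g p finite_trees in auto)
  also have "\<dots> = (\<Sum>T'\<in>Ng T. ?f T') + (\<Sum>T'\<in>Np T. ?f T')"
    using grow_strict[OF T] prune_strict[OF T] finite_grow[OF T] finite_prune[OF T]
    by (intro sum.union_disjoint) blast+
  also have "(\<Sum>T'\<in>Ng T. ?f T') = (\<Sum>T'\<in>Ng T - grow_hits T. ?f T') + (\<Sum>T'\<in>grow_hits T. ?f T')"
    by (intro sum.subset_diff finite_grow T) (auto simp: grow_hits_def)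
  also have "(\<Sum>T'\<in>Np T. ?f T') = (\<Sum>T'\<in>Np T - prune_misses T. ?f T') + (\<Sum>T'\<in>prune_misses T. ?f T')"
    by (intro sum.subset_diff finite_prune T) (auto simp: prune_misses_def)
  finally have split: "(\<Sum>T'\<in>trees L - {T}. ?f T') =
    (\<Sum>T'\<in>Ng T - grow_hits T. ?f T') + (\<Sum>T'\<in>grow_hits T. ?f T') +
    ((\<Sum>T'\<in>Np T - prune_misses T. ?f T') + (\<Sum>T'\<in>prune_misses T. ?f T'))" .
  have "(\<Sum>T'\<in>grow_hits T. ?f T') \<le> (\<Sum>T'\<in>grow_hits T. M T T' * (-16))"
  proof (intro sum_mono mult_left_mono)
    fix T' assume "T' \<in> grow_hits T"
    then show "h T' - h T \<le> -16" "0 \<le> M T T'"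
      using potential_grow_signal[OF T, of T'] gM[of T'] by (auto simp: grow_hits_def)
  qed
  then have 1: "(\<Sum>T'\<in>grow_hits T. ?f T') \<le> - 16 * (\<Sum>T'\<in>grow_hits T. M T T')"
    by (simp add: sum_distrib_left mult.commute)
  have "(\<Sum>T'\<in>prune_misses T. ?f T') \<le> (\<Sum>T'\<in>prune_misses T. M T T' * (-16))"
  proof (intro sum_mono mult_left_mono)
    fix T' assume "T' \<in> prune_misses T"
    then show "h T' - h T \<le> -16" "0 \<le> M T T'"
      using potential_prune_junk[OF T, of T'] pM[of T'] by (auto simp: prune_misses_def)
  qed
  then have 2: "(\<Sum>T'\<in>prune_misses T. ?f T') \<le> - 16 * (\<Sum>T'\<in>prune_misses T. M T T')"
    by (simp add: sum_distrib_left mult.commute)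
  have "(\<Sum>T'\<in>Ng T - grow_hits T. ?f T') \<le> real (card (Ng T - grow_hits T)) * (1 / \<kappa> * (16 * real L))"
  proof (intro sum_bounded_above)
    fix T' assume T': "T' \<in> Ng T - grow_hits T"
    then have "M T T' \<le> 1 / \<kappa>"
      using M_le_ratio[OF T g] grow_ratio[OF T, of T'] grow_noise_ratio[OF T, of T']
      by (force simp: grow_hits_def)
    then show "?f T' \<le> 1 / \<kappa> * (16 * real L)"
      using T' potential_grow[OF T, of T'] gM[of T']
      by (intro order_trans[OF mult_left_mono[of _ "16 * real L"] mult_right_mono]) auto
  qed
  also have "\<dots> \<le> 2 ^ L * (1 / \<kappa> * (16 * real L))"
    using kappa_pos by (intro mult_right_mono real_card_grow[OF T]) auto
  finally have 3: "(\<Sum>T'\<in>Ng T - grow_hits T. ?f T') \<le> 2 ^ L / \<kappa> * (16 * real L)" by simp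
  have "(\<Sum>T'\<in>Np T - prune_misses T. ?f T') \<le> real (card (Np T - prune_misses T)) * (1 / \<Gamma> * ?H)"
  proof (intro sum_bounded_above)
    fix T' assume T': "T' \<in> Np T - prune_misses T"
    then have "\<Gamma> \<le> prod g (T - T')"
      by (intro prune_signal_ratio[OF T]) (auto simp: prune_misses_def)
    then have "1 / prod g (T - T') \<le> 1 / \<Gamma>" using Gamma_pos by (intro frac_le) auto
    then have "M T T' \<le> 1 / \<Gamma>"
      using M_le_ratio[OF T p] prune_ratio[OF T, of T'] T' by force
    moreover have "h T' - h T \<le> ?H"
      using potential_le[of T'] potential_nonneg[of T] p(1)[of T'] T' by auto
    ultimately show "?f T' \<le> 1 / \<Gamma> * ?H"
      using T' pM[of T']
      by (intro order_trans[OF mult_left_mono[of _ ?H] mult_right_mono]) auto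
  qed
  also have "\<dots> \<le> 2 ^ L * (1 / \<Gamma> * ?H)"
    using Gamma_pos by (intro mult_right_mono real_card_prune[OF T]) auto
  finally have 4: "(\<Sum>T'\<in>Np T - prune_misses T. ?f T') \<le> 2 ^ L / \<Gamma> * ?H" by simp
  \<comment> \<open>The two contributions of bad moves are kept opaque to make the final step linear.\<close>
  define e1 where "e1 = 2 ^ L / \<kappa> * (16 * real L)"
  define e2 where "e2 = 2 ^ L / \<Gamma> * ?H"
  have "e1 + e2 \<le> 1" unfolding e1_def e2_def by (rule stray_small)
  moreover note 1 2 3[folded e1_def] 4[folded e2_def]
  ultimately show ?thesis unfolding split distrib_left by linarith
qed

theorem informed_tv_bound:
  assumes \<epsilon>: "0 < \<epsilon>" "\<epsilon> < 1" and t0: "0 < t0" "32 * (real (L + 2) * 2 ^ L) \<le> real t0"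
    and T: "T \<in> trees L" and t: "8 * ln (6 / \<epsilon>) * real t0 \<le> real t + 1"
  shows "tv_dist (trees L) (kernel_pow (trees L) (lazy_kernel M) t T) \<pi> \<le> \<epsilon>"
proof -
  interpret C: reversible_chain "trees L" "lazy_kernel M" \<pi>
    by (intro lazy_mh_reversible_chain(1) finite_trees S_nonneg S_sum post_pos post_sum)
  have lazy: "lazy_kernel M x x \<ge> 1/2" if "x \<in> trees L" for x
    using that by (intro lazy_mh_reversible_chain(2) finite_trees S_nonneg S_sum post_pos post_sum)
  have change: "(\<Sum>y\<in>trees L. lazy_kernel M x y * h y) =
      h x + (\<Sum>y\<in>trees L - {x}. M x y * (h y - h x)) / 2" if "x \<in> trees L" for x
    using that by (intro lazy_mh_reversible_chain(3) finite_trees S_nonneg S_sum post_pos post_sum)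
  note z = target_tree[OF signal_nodes]
  have drift: "(\<Sum>y\<in>trees L. lazy_kernel M x y * h y) \<le> h x - 1"
    if "x \<in> trees L" "x \<noteq> target_tree B" for x
  proof -
    have "E \<le> H - 1" if "E = H + D / 2" "D \<le> 1 - 16 * p" "1/4 \<le> p" for E H D p :: real
      using that by linarith
    from this[OF change[OF that(1)] potential_change[OF that(1)] progress[OF that]]
    show ?thesis .
  qed
  have stay: "0 \<le> (\<Sum>T'\<in>grow_hits (target_tree B). M (target_tree B) T')"
    using grow_tree[OF z] grow_strict[OF z]
    by (intro sum_nonneg M_nonneg z) (auto simp: grow_hits_def)
  have stay': "0 \<le> (\<Sum>T'\<in>prune_misses (target_tree B). M (target_tree B) T')"
    using prune_tree[OF z] prune_strict[OF z]
    by (intro sum_nonneg M_nonneg z) (auto simp: prune_misses_def)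
  \<comment> \<open>At the target the good moves can only help, so the bad ones alone bound the increase.\<close>
  have target: "(\<Sum>y\<in>trees L. lazy_kernel M (target_tree B) y * h y) \<le> h (target_tree B) + 1"
  proof -
    have "E \<le> H + 1" if "0 \<le> p" "E = H + D / 2" "D \<le> 1 - 16 * p" for E H D p :: real
      using that by linarith
    from this[OF add_nonneg_nonneg[OF stay stay'] change[OF z] potential_change[OF z]]
    show ?thesis .
  qed
  have h_le: "2 * h x \<le> real t0" if "x \<in> trees L" for x
    using potential_le[OF that] t0(2) by linarith
  show ?thesis
    by (rule C.drift_tv_bound[OF z lazy[OF z] potential_nonneg h_le t0(1) drift target \<epsilon> T t])
qed

end

section \<open>Orthogonality of the Haar design\<close>

text \<open>The Haar function of level \<open>j\<close> and position \<open>k\<close>, up to scaling, on the cells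
  \<open>(s / 2\<^sup>j\<^sup>+\<^sup>1, (s + 1) / 2\<^sup>j\<^sup>+\<^sup>1]\<close>, on each of which it is constant.\<close>

definition haar_cell :: "nat \<Rightarrow> nat \<Rightarrow> real" where
  "haar_cell k s = (if s = 2 * k then 1 else if s = 2 * k + 1 then -1 else 0)"

lemma sum_haar_cell:
  assumes "k < 2 ^ j"
  shows "(\<Sum>s<2 ^ Suc j. F s * haar_cell k s) = F (2 * k) - F (2 * k + 1)"
proof -
  have "(\<Sum>s<2 ^ Suc j. F s * haar_cell k s) = (\<Sum>s\<in>{2 * k, 2 * k + 1}. F s * haar_cell k s)"
    using assms by (intro sum.mono_neutral_right) (auto simp: haar_cell_def)
  then show ?thesis by (simp add: haar_cell_def)
qed

lemma sum_blocks:
  fixes F :: "nat \<Rightarrow> real"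
  assumes "0 < m"
  shows "(\<Sum>i=1..q * m. F ((i - 1) div m)) = real m * (\<Sum>s<q. F s)"
proof -
  have "(\<Sum>i=1..q * m. F ((i - 1) div m)) = (\<Sum>i<q * m. F (i div m))"
    by (rule sum.reindex_bij_witness[of _ Suc "\<lambda>i. i - 1"]) auto
  also have "\<dots> = (\<Sum>s<q. \<Sum>i\<in>{s * m..<s * m + m}. F (i div m))"
    by (rule sum.nat_group[symmetric])
  also have "\<dots> = (\<Sum>s<q. \<Sum>i\<in>{s * m..<s * m + m}. F s)"
  proof (intro sum.cong refl)
    fix s i assume "i \<in> {s * m..<s * m + m}"
    then have "i div m = s" by (intro div_nat_eqI) (auto simp: mult.commute)
    then show "F (i div m) = F s" by simp
  qed
  also have "\<dots> = real m * (\<Sum>s<q. F s)" by (simp add: sum_distrib_left)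
  finally show ?thesis .
qed

lemma design_root:
  assumes "i \<in> {1..n}"
  shows "design n i (-1, 0) = 1"
  using assms by (auto simp: design_def indicator_def divide_le_eq)

lemma nat_div_eq_iff: "0 < m \<Longrightarrow> x div m = q \<longleftrightarrow> q * m \<le> x \<and> x < (q + 1) * m" for x m q :: nat
  using less_eq_div_iff_mult_less_eq[of m q x] div_less_iff_less_mult[of m x "q + 1"] by auto

text \<open>The cells are half-open on the left, so the design points \<open>i / n\<close> of one cell form a block
  of \<open>m\<close> consecutive values of \<open>i - 1\<close>.\<close>

lemma design_level:
  assumes n: "n = 2 ^ Suc j * m" and m: "0 < m" and i: "1 \<le> i"
  shows "design n i (int j, k) = 2 powr (real j / 2) * haar_cell k ((i - 1) div m)"
proof -
  let ?y = "2 ^ j * (real i / real n) - real k"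
  have y: "?y = (real i - 2 * real k * real m) / (2 * real m)"
    using m by (simp add: n field_simps)
  have "(0 < ?y \<and> ?y \<le> 1/2) \<longleftrightarrow> 2 * real k * real m < real i \<and> real i \<le> (2 * real k + 1) * real m"
    unfolding y using m by (auto simp: field_simps)
  also have "\<dots> \<longleftrightarrow> real (2 * k * m) < real i \<and> real i \<le> real ((2 * k + 1) * m)"
    by (simp add: algebra_simps)
  also have "\<dots> \<longleftrightarrow> 2 * k * m < i \<and> i \<le> (2 * k + 1) * m"
    by (simp only: of_nat_less_iff of_nat_le_iff)
  also have "\<dots> \<longleftrightarrow> (i - 1) div m = 2 * k"
    using i by (subst nat_div_eq_iff[OF m]) (auto simp: algebra_simps)
  finally have 1: "(0 < ?y \<and> ?y \<le> 1/2) \<longleftrightarrow> (i - 1) div m = 2 * k" .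
  have "(1/2 < ?y \<and> ?y \<le> 1) \<longleftrightarrow> (2 * real k + 1) * real m < real i \<and> real i \<le> (2 * real k + 2) * real m"
    unfolding y using m by (auto simp: field_simps)
  also have "\<dots> \<longleftrightarrow> real ((2 * k + 1) * m) < real i \<and> real i \<le> real ((2 * k + 2) * m)"
    by (simp add: algebra_simps)
  also have "\<dots> \<longleftrightarrow> (2 * k + 1) * m < i \<and> i \<le> (2 * k + 2) * m"
    by (simp only: of_nat_less_iff of_nat_le_iff)
  also have "\<dots> \<longleftrightarrow> (i - 1) div m = 2 * k + 1"
    using i by (subst nat_div_eq_iff[OF m]) (auto simp: algebra_simps)
  finally have 2: "(1/2 < ?y \<and> ?y \<le> 1) \<longleftrightarrow> (i - 1) div m = 2 * k + 1" .
  have "haar_mother ?y = haar_cell k ((i - 1) div m)"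
    using 1 2 by (auto simp: haar_mother_def haar_cell_def indicator_def)
  then show ?thesis by (simp add: design_def)
qed

text \<open>A Haar function of coarser or equal level takes the same value on both halves of the support of
  another one, where the latter takes opposite values.\<close>

lemma design_orthogonal:
  assumes n: "n = 2 ^ (Lmax + 1)" and L: "L \<le> Lmax" and v: "v \<in> nodes L" and w: "w \<in> nodes L"
  shows "(\<Sum>i=1..n. design n i v * design n i w) = (if v = w then real n else 0)"
proof -
  define m where "m j = (2::nat) ^ (Lmax - j)" for j
  have n_m: "n = 2 ^ Suc j * m j" if "j < L" for j
    using that L by (simp add: n m_def flip: power_add)
  have m0: "0 < m j" for j by (simp add: m_def)
  have level: "\<exists>j k. v = (int j, k) \<and> j < L \<and> k < 2 ^ j" if "v \<in> nodes L" "v \<noteq> (-1, 0)" for v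
    using that by (cases v) (auto simp: nodes_iff intro!: exI[of _ "nat (fst v)"])
  have d: "design n i (int j, k) = 2 powr (real j / 2) * haar_cell k ((i - 1) div m j)"
    if "j < L" "i \<in> {1..n}" for i j k
    using that by (intro design_level n_m m0) auto
  have reduce: "(\<Sum>i=1..n. F ((i - 1) div m j) * design n i (int j, k)) =
      2 powr (real j / 2) * real (m j) * (F (2 * k) - F (2 * k + 1))"
    if "j < L" "k < 2 ^ j" for F j k
  proof -
    have "(\<Sum>i=1..n. F ((i - 1) div m j) * design n i (int j, k)) =
        2 powr (real j / 2) * (\<Sum>i=1..n. F ((i - 1) div m j) * haar_cell k ((i - 1) div m j))"
      using that by (simp add: d sum_distrib_left mult_ac)
    also have "(\<Sum>i=1..n. F ((i - 1) div m j) * haar_cell k ((i - 1) div m j)) =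
        real (m j) * (\<Sum>s<2 ^ Suc j. F s * haar_cell k s)"
      unfolding n_m[OF that(1)] by (rule sum_blocks[OF m0])
    finally show ?thesis using that by (simp only: sum_haar_cell mult.assoc)
  qed
  have orth: "(\<Sum>i=1..n. design n i v * design n i (int j, k)) = 0"
    if v: "v \<in> nodes L" "v \<noteq> (int j, k)" "fst v \<le> int j" and jk: "j < L" "k < 2 ^ j" for v j k
  proof (cases "v = (-1, 0)")
    case True
    then have "(\<Sum>i=1..n. design n i v * design n i (int j, k)) =
        (\<Sum>i=1..n. (\<lambda>_. 1) ((i - 1) div m j) * design n i (int j, k))"
      by (intro sum.cong) (simp_all add: design_root)
    also have "\<dots> = 0" by (subst reduce[OF jk]) simp
    finally show ?thesis .
  next
    case False
    then obtain j' k' where v': "v = (int j', k')" "j' < L" "k' < 2 ^ j'"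
      using level[OF v(1)] by auto
    then have "j' \<le> j" using v by simp
    define e where "e = j - j'"
    have "m j' = m j * 2 ^ e"
      using \<open>j' \<le> j\<close> jk L by (simp add: m_def e_def flip: power_add)
    then have dv: "(i - 1) div m j' = (i - 1) div m j div 2 ^ e" for i
      by (simp add: div_mult2_eq)
    have "(\<Sum>i=1..n. design n i v * design n i (int j, k)) =
        (\<Sum>i=1..n. (\<lambda>s. 2 powr (real j' / 2) * haar_cell k' (s div 2 ^ e)) ((i - 1) div m j) * design n i (int j, k))"
      by (intro sum.cong refl) (simp only: v'(1) d[OF v'(2)] dv)
    also have "\<dots> = 0"
    proof (cases e)
      case 0
      then have "k' \<noteq> k" using v v' \<open>j' \<le> j\<close> by (auto simp: e_def)
      then have "2 * k \<noteq> 2 * k'" "2 * k \<noteq> 2 * k' + 1" "2 * k + 1 \<noteq> 2 * k'" by presburger+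
      then have "haar_cell k' (2 * k) = 0" "haar_cell k' (2 * k + 1) = 0"
        unfolding haar_cell_def by simp_all
      then show ?thesis using 0 by (subst reduce[OF jk]) simp
    next
      case (Suc e')
      have "2 * k div 2 ^ e = (2 * k + 1) div 2 ^ e"
        by (simp add: Suc div_mult2_eq)
      then show ?thesis by (subst reduce[OF jk]) simp
    qed
    finally show ?thesis .
  qed
  show ?thesis
  proof (cases "v = w")
    case True
    show ?thesis
    proof (cases "v = (-1, 0)")
      case True
      then show ?thesis using \<open>v = w\<close> by (simp add: design_root)
    next
      case False
      then obtain j k where v': "v = (int j, k)" "j < L" "k < 2 ^ j" using level[OF v] by auto
      have "(\<Sum>i=1..n. design n i v * design n i w) =
          (\<Sum>i=1..n. (\<lambda>s. 2 powr (real j / 2) * haar_cell k s) ((i - 1) div m j) * design n i (int j, k))"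
        using d[OF v'(2)] v' \<open>v = w\<close> by (intro sum.cong) simp_all
      also have "\<dots> = (2 powr (real j / 2) * 2 powr (real j / 2)) * (2 * real (m j))"
        by (subst reduce[OF v'(2,3)]) (simp add: haar_cell_def)
      also have "2 powr (real j / 2) * 2 powr (real j / 2) = (2 ^ j :: real)"
        by (simp add: powr_realpow flip: powr_add)
      also have "2 ^ j * (2 * real (m j)) = real n"
        by (subst n_m[OF v'(2)]) simp
      finally show ?thesis using \<open>v = w\<close> by simp
    qed
  next
    case False
    consider "fst v \<le> fst w" | "fst w \<le> fst v" by linarith
    then show ?thesis
    proof cases
      case 1
      have "w \<noteq> (-1, 0)" using 1 False v by (auto simp: nodes_iff)
      then obtain j k where "w = (int j, k)" "j < L" "k < 2 ^ j" using level[OF w] by auto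
      then show ?thesis using orth[OF v, of j k] 1 False by auto
    next
      case 2
      have "v \<noteq> (-1, 0)" using 2 False w by (auto simp: nodes_iff)
      then obtain j k where "v = (int j, k)" "j < L" "k < 2 ^ j" using level[OF v] by auto
      then show ?thesis using orth[OF w, of j k] 2 False by (auto simp: mult.commute)
    qed
  qed
qed

section \<open>The posterior as a product over nodes\<close>

text \<open>Completing the square.\<close>

lemma gaussian_tilt:
  assumes r: "0 \<le> r"
  shows "normal_density 0 1 b * exp (a * b - r * b\<^sup>2 / 2) =
    exp (a\<^sup>2 / (2 * (1 + r))) / sqrt (1 + r) * normal_density (a / (1 + r)) (1 / sqrt (1 + r)) b"
proof -
  define s where "s = 1 + r"
  have s: "0 < s" "r = s - 1" using r by (auto simp: s_def)
  have "(b - a / s)\<^sup>2 / (2 * (1 / sqrt s)\<^sup>2) = s * b\<^sup>2 / 2 - a * b + a\<^sup>2 / (2 * s)"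
    using s(1) by (simp add: power2_diff power_divide field_simps power2_eq_square)
  then have e: "- b\<^sup>2 / 2 + (a * b - r * b\<^sup>2 / 2) =
      a\<^sup>2 / (2 * s) + - ((b - a / s)\<^sup>2 / (2 * (1 / sqrt s)\<^sup>2))"
    unfolding s(2) by (simp add: algebra_simps add_divide_distrib diff_divide_distrib)
  have "normal_density 0 1 b * exp (a * b - r * b\<^sup>2 / 2) =
      1 / sqrt (2 * pi) * exp (- b\<^sup>2 / 2 + (a * b - r * b\<^sup>2 / 2))"
    unfolding exp_add by (simp add: normal_density_def)
  also have "\<dots> = 1 / sqrt (2 * pi) * (exp (a\<^sup>2 / (2 * s)) *
      exp (- ((b - a / s)\<^sup>2 / (2 * (1 / sqrt s)\<^sup>2))))"
    unfolding e exp_add ..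
  also have "1 / sqrt (2 * pi) = 1 / sqrt s * (1 / sqrt (2 * pi * (1 / sqrt s)\<^sup>2))"
    using s by (simp add: power_divide real_sqrt_divide)
  finally show ?thesis unfolding s_def[symmetric] by (simp add: normal_density_def)
qed

lemma gaussian_tilt_integral:
  assumes r: "0 \<le> r"
  shows "integrable (density lborel (\<lambda>b. ennreal (normal_density 0 1 b))) (\<lambda>b. exp (a * b - r * b\<^sup>2 / 2))" (is ?i)
    and "(\<integral>b. exp (a * b - r * b\<^sup>2 / 2) \<partial>density lborel (\<lambda>b. ennreal (normal_density 0 1 b))) =
      exp (a\<^sup>2 / (2 * (1 + r))) / sqrt (1 + r)" (is ?e)
proof -
  have \<sigma>: "0 < 1 / sqrt (1 + r)" using r by simp
  have "integrable lborel (\<lambda>b. normal_density 0 1 b *\<^sub>R exp (a * b - r * b\<^sup>2 / 2))"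
    unfolding real_scaleR_def gaussian_tilt[OF r]
    by (intro integrable_mult_right integrable_normal_density \<sigma>)
  then show ?i by (subst integrable_density) simp_all
  have "(\<integral>b. normal_density 0 1 b *\<^sub>R exp (a * b - r * b\<^sup>2 / 2) \<partial>lborel) =
      exp (a\<^sup>2 / (2 * (1 + r))) / sqrt (1 + r)"
    unfolding real_scaleR_def gaussian_tilt[OF r] integral_mult_right_zero
    by (subst integral_normal_density[OF \<sigma>]) simp
  then show ?e by (subst integral_density) simp_all
qed

lemma gaussian_mgf:
  shows "integrable (density lborel (\<lambda>y. ennreal (normal_density \<mu> 1 y))) (\<lambda>y. exp (a * (y - \<mu>)))" (is ?i)
    and "(\<integral>y. exp (a * (y - \<mu>)) \<partial>density lborel (\<lambda>y. ennreal (normal_density \<mu> 1 y))) = exp (a\<^sup>2 / 2)" (is ?e)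
proof -
  have tilt: "normal_density \<mu> 1 y * exp (a * (y - \<mu>)) = exp (a\<^sup>2 / 2) * normal_density (\<mu> + a) 1 y" for y
  proof -
    have "- (y - \<mu>)\<^sup>2 / 2 + a * (y - \<mu>) = a\<^sup>2 / 2 + - (y - (\<mu> + a))\<^sup>2 / 2"
      by (simp add: field_simps power2_eq_square)
    then show ?thesis by (simp add: normal_density_def flip: exp_add)
  qed
  show ?i by (subst integrable_density) (simp_all add: tilt)
  show ?e by (subst integral_density) (simp_all add: tilt)
qed

definition score :: "nat \<Rightarrow> (nat \<Rightarrow> real) \<Rightarrow> node \<Rightarrow> real" where
  "score n Y v = (\<Sum>i=1..n. design n i v * Y i)"

lemma likelihood_eq:
  assumes n: "n = 2 ^ (Lmax + 1)" and L: "L \<le> Lmax" and T: "T \<subseteq> nodes L"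
  shows "likelihood n T Y \<beta> = (\<Prod>i=1..n. normal_density 0 1 (Y i)) *
    (\<Prod>v\<in>T. exp (score n Y v * \<beta> v - real n * (\<beta> v)\<^sup>2 / 2))"
proof -
  have finT: "finite T" using T finite_nodes finite_subset by blast
  let ?f = "\<lambda>i. \<Sum>v\<in>T. design n i v * \<beta> v"
  have "(\<Sum>i=1..n. (?f i)\<^sup>2) = (\<Sum>i=1..n. \<Sum>v\<in>T. \<Sum>w\<in>T. \<beta> v * \<beta> w * (design n i v * design n i w))"
    by (simp add: power2_eq_square sum_product mult_ac)
  also have "\<dots> = (\<Sum>v\<in>T. \<Sum>w\<in>T. \<Sum>i=1..n. \<beta> v * \<beta> w * (design n i v * design n i w))"
    by (subst sum.swap, rule sum.cong[OF refl], rule sum.swap)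
  also have "\<dots> = (\<Sum>v\<in>T. \<Sum>w\<in>T. \<beta> v * \<beta> w * (if v = w then real n else 0))"
    using T by (intro sum.cong refl, subst sum_distrib_left[symmetric], subst design_orthogonal[OF n L]) auto
  also have "\<dots> = (\<Sum>v\<in>T. \<Sum>w\<in>T. if v = w then real n * (\<beta> v)\<^sup>2 else 0)"
    by (intro sum.cong refl) (auto simp: power2_eq_square)
  also have "\<dots> = (\<Sum>v\<in>T. real n * (\<beta> v)\<^sup>2)" using finT by simp
  finally have sq: "(\<Sum>i=1..n. (?f i)\<^sup>2) = (\<Sum>v\<in>T. real n * (\<beta> v)\<^sup>2)" .
  have cross: "(\<Sum>i=1..n. ?f i * Y i) = (\<Sum>v\<in>T. score n Y v * \<beta> v)"
    unfolding score_def sum_distrib_right by (subst sum.swap) (simp add: mult_ac)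
  have "normal_density (?f i) 1 (Y i) = normal_density 0 1 (Y i) * exp (?f i * Y i - (?f i)\<^sup>2 / 2)" for i
  proof -
    have "- (Y i - ?f i)\<^sup>2 / 2 = - (Y i)\<^sup>2 / 2 + (?f i * Y i - (?f i)\<^sup>2 / 2)"
      by (simp add: field_simps power2_eq_square)
    then have "exp (- (Y i - ?f i)\<^sup>2 / 2) = exp (- (Y i)\<^sup>2 / 2) * exp (?f i * Y i - (?f i)\<^sup>2 / 2)"
      by (simp only: exp_add)
    then show ?thesis by (simp add: normal_density_def)
  qed
  then have "likelihood n T Y \<beta> =
      (\<Prod>i=1..n. normal_density 0 1 (Y i)) * exp (\<Sum>i=1..n. ?f i * Y i - (?f i)\<^sup>2 / 2)"
    by (simp add: likelihood_def prod.distrib exp_sum)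
  also have "(\<Sum>i=1..n. ?f i * Y i - (?f i)\<^sup>2 / 2) = (\<Sum>i=1..n. ?f i * Y i) - (\<Sum>i=1..n. (?f i)\<^sup>2) / 2"
    by (simp only: sum_subtractf sum_divide_distrib)
  also have "\<dots> = (\<Sum>v\<in>T. score n Y v * \<beta> v - real n * (\<beta> v)\<^sup>2 / 2)"
    unfolding sq cross by (simp add: sum_subtractf sum_divide_distrib)
  finally show ?thesis using finT by (simp add: exp_sum)
qed

lemma marginal_likelihood_eq:
  assumes n: "n = 2 ^ (Lmax + 1)" and L: "L \<le> Lmax" and T: "T \<subseteq> nodes L"
  shows "marginal_likelihood n Y T = (\<Prod>i=1..n. normal_density 0 1 (Y i)) *
    (\<Prod>v\<in>T. exp ((score n Y v)\<^sup>2 / (2 * (1 + real n))) / sqrt (1 + real n))"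
proof -
  have finT: "finite T" using T finite_nodes finite_subset by blast
  interpret prob_space "density lborel (\<lambda>x. ennreal (normal_density 0 1 x))"
    by (intro prob_space_normal_density) simp
  interpret product_sigma_finite "\<lambda>_ :: node. density lborel (\<lambda>x. ennreal (normal_density 0 1 x))" ..
  show ?thesis
    unfolding marginal_likelihood_def coeff_prior_def likelihood_eq[OF n L T] integral_mult_right_zero
    by (subst product_integral_prod[OF finT])
      (simp_all only: gaussian_tilt_integral of_nat_0_le_iff)
qed

text \<open>The contribution of one internal node to the posterior weight: its own prior
  probability, that of one of the equally many external nodes, and the Gaussian integral over its
  coefficient.\<close>

definition node_factor :: "nat \<Rightarrow> real \<Rightarrow> (nat \<Rightarrow> real) \<Rightarrow> node \<Rightarrow> real" where
  "node_factor n c Y v = real n powr (- c) * (1 - real n powr (- c)) *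
     (exp ((score n Y v)\<^sup>2 / (2 * (1 + real n))) / sqrt (1 + real n))"

lemma posterior_eq:
  assumes n: "n = 2 ^ (Lmax + 1)" and L: "L \<le> Lmax" and c: "0 < c" and T: "T \<in> trees L"
  shows "posterior (\<lambda>_. real n powr (- c)) n L Y T =
    prod (node_factor n c Y) T / (\<Sum>T'\<in>trees L. prod (node_factor n c Y) T')"
proof -
  let ?p = "real n powr (- c)"
  let ?K = "(\<Prod>i=1..n. normal_density 0 1 (Y i)) / (\<Sum>T'\<in>trees L. tree_weight (\<lambda>_. ?p) T')"
  have "1 \<le> (2::real) ^ Lmax" by simp
  then have "1 < real n" by (simp add: n del: one_le_power)
  then have p: "0 < ?p" "?p < 1" using c by (auto intro: powr_less_one)
  have w: "0 < tree_weight (\<lambda>_. ?p) T'" for T'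
    using p by (auto simp: tree_weight_def intro!: mult_pos_pos prod_pos)
  have "0 < (\<Sum>T'\<in>trees L. tree_weight (\<lambda>_. ?p) T')"
    using w T finite_trees by (intro sum_pos) auto
  moreover have "0 < (\<Prod>i=1..n. normal_density 0 1 (Y i))"
    by (intro prod_pos) (simp add: normal_density_pos)
  ultimately have K: "?K \<noteq> 0" by (metis divide_eq_0_iff less_irrefl)
  have eq: "tree_prior (\<lambda>_. ?p) L T' * marginal_likelihood n Y T' = ?K * prod (node_factor n c Y) T'"
    if T': "T' \<in> trees L" for T'
  proof -
    have "tree_weight (\<lambda>_. ?p) T' = (\<Prod>v\<in>T'. ?p * (1 - ?p))"
      by (simp add: tree_weight_def card_ext_nodes[OF T'] power_mult_distrib)
    then show ?thesis
      unfolding tree_prior_def marginal_likelihood_eq[OF n L tree_subset_nodes[OF T']] node_factor_def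
        prod.distrib by simp
  qed
  have "posterior (\<lambda>_. ?p) n L Y T =
      ?K * prod (node_factor n c Y) T / (\<Sum>T'\<in>trees L. ?K * prod (node_factor n c Y) T')"
    using T by (simp add: posterior_def eq)
  also have "\<dots> = prod (node_factor n c Y) T / (\<Sum>T'\<in>trees L. prod (node_factor n c Y) T')"
  proof -
    have "K * a / (\<Sum>T'\<in>trees L. K * b T') = a / (\<Sum>T'\<in>trees L. b T')"
      if "K \<noteq> 0" for K a and b :: "tree \<Rightarrow> real"
      using that by (simp flip: sum_distrib_left)
    from this[OF K] show ?thesis .
  qed
  finally show ?thesis .
qed

section \<open>Gaussian noise in the scores\<close>

lemma prob_space_data_law: "prob_space (data_law n f0)"
  unfolding data_law_def by (intro prob_space_PiM prob_space_normal_density) simp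

text \<open>The exponential moment at \<open>t / s\<close>, the minimizer of the exponent \<open>a\<^sup>2 s / 2 - a t\<close>.\<close>

lemma chernoff_linear:
  assumes x: "(\<Sum>i=1..n. (x i)\<^sup>2) = s" and s: "0 < s" and t: "0 < t"
  shows "measure (data_law n f0) {Y \<in> space (data_law n f0). t \<le> (\<Sum>i=1..n. x i * (Y i - f0 (real i / real n)))}
    \<le> exp (- t\<^sup>2 / (2 * s))"
proof -
  let ?N = "\<lambda>i. density lborel (\<lambda>y. ennreal (normal_density (f0 (real i / real n)) 1 y))"
  let ?S = "\<lambda>Y. \<Sum>i=1..n. x i * (Y i - f0 (real i / real n))"
  let ?a = "t / s"
  interpret prob_space "data_law n f0" by (rule prob_space_data_law)
  interpret N: prob_space "?N i" for i by (intro prob_space_normal_density) simp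
  interpret product_sigma_finite ?N ..
  have split: "exp (?a * ?S Y) = (\<Prod>i=1..n. exp (?a * x i * (Y i - f0 (real i / real n))))" for Y
    by (simp add: sum_distrib_left exp_sum mult_ac)
  have int: "integrable (data_law n f0) (\<lambda>Y. exp (?a * ?S Y))"
    unfolding split data_law_def
    by (rule product_integrable_prod[OF _ gaussian_mgf(1)]) simp
  have "(\<integral>Y. exp (?a * ?S Y) \<partial>data_law n f0) = (\<Prod>i=1..n. exp ((?a * x i)\<^sup>2 / 2))"
    unfolding split data_law_def
    by (subst product_integral_prod[OF _ gaussian_mgf(1)]) (simp_all only: gaussian_mgf(2) finite_atLeastAtMost)
  also have "\<dots> = exp (?a\<^sup>2 * s / 2)"
  proof -
    have "(?a * x i)\<^sup>2 / 2 = ?a\<^sup>2 / 2 * (x i)\<^sup>2" for i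
      by (simp add: power_mult_distrib power_divide)
    then have "(\<Sum>i=1..n. (?a * x i)\<^sup>2 / 2) = ?a\<^sup>2 / 2 * s"
      by (simp only: x flip: sum_distrib_left)
    then show ?thesis by (simp add: exp_sum[symmetric])
  qed
  finally have mgf: "(\<integral>Y. exp (?a * ?S Y) \<partial>data_law n f0) = exp (?a\<^sup>2 * s / 2)" .
  have "measure (data_law n f0) {Y \<in> space (data_law n f0). t \<le> ?S Y}
      \<le> exp (- ?a * t) * (\<integral>Y. exp (?a * ?S Y) \<partial>data_law n f0)"
  proof -
    have "set_integrable (data_law n f0) (space (data_law n f0)) (\<lambda>Y. exp (?a * ?S Y))"
      unfolding set_integrable_def using int by (rule Bochner_Integration.integrable_cong[OF refl, THEN iffD2, rotated]) simp
    from Chernoff_ineq_ge[OF _ this sets.top, of t] show ?thesis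
      using s t unfolding set_integral_space[OF int] by simp
  qed
  also have "\<dots> = exp (- ?a * t + ?a\<^sup>2 * s / 2)" by (simp only: mgf exp_add)
  also have "- ?a * t + ?a\<^sup>2 * s / 2 = - t\<^sup>2 / (2 * s)"
    using s by (simp add: field_simps power2_eq_square)
  finally show ?thesis .
qed

section \<open>Measurability of the mixing event\<close>

lemma informed_kernel_measurable:
  fixes \<pi> :: "'a \<Rightarrow> tree \<Rightarrow> real"
  assumes \<pi>[measurable]: "\<And>T. T \<in> trees L \<Longrightarrow> (\<lambda>\<omega>. \<pi> \<omega> T) \<in> borel_measurable M"
    and N: "\<And>T. T \<in> trees L \<Longrightarrow> Ng L T \<subseteq> trees L" "\<And>T. T \<in> trees L \<Longrightarrow> Np L T \<subseteq> trees L"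
    and T: "T \<in> trees L" "T' \<in> trees L"
  shows "(\<lambda>\<omega>. informed_kernel Ng Np n L A c (\<pi> \<omega>) T T') \<in> borel_measurable M"
proof -
  let ?S = "\<lambda>\<omega>. tree_proposal L (weighted_proposal (Ng L) (grow_weight n A (\<pi> \<omega>)))
    (weighted_proposal (Np L) (prune_weight n c (\<pi> \<omega>)))"
  have g: "(\<lambda>\<omega>. grow_weight n A (\<pi> \<omega>) U V) \<in> borel_measurable M" if "U \<in> trees L" "V \<in> trees L" for U V
    unfolding grow_weight_def using \<pi>[OF that(1)] \<pi>[OF that(2)] by measurable
  have p: "(\<lambda>\<omega>. prune_weight n c (\<pi> \<omega>) U V) \<in> borel_measurable M" if "U \<in> trees L" "V \<in> trees L" for U V
    unfolding prune_weight_def using \<pi>[OF that(1)] \<pi>[OF that(2)] by measurable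
  have Sg: "(\<lambda>\<omega>. weighted_proposal (Ng L) (grow_weight n A (\<pi> \<omega>)) U V) \<in> borel_measurable M"
    if "U \<in> trees L" for U V
    unfolding weighted_proposal_def using N(1)[OF that] g[OF that]
    by (cases "V \<in> Ng L U") (auto intro!: borel_measurable_divide borel_measurable_sum)
  have Sp: "(\<lambda>\<omega>. weighted_proposal (Np L) (prune_weight n c (\<pi> \<omega>)) U V) \<in> borel_measurable M"
    if "U \<in> trees L" for U V
    unfolding weighted_proposal_def using N(2)[OF that] p[OF that]
    by (cases "V \<in> Np L U") (auto intro!: borel_measurable_divide borel_measurable_sum)
  have S: "(\<lambda>\<omega>. ?S \<omega> U V) \<in> borel_measurable M" if "U \<in> trees L" for U V
    unfolding tree_proposal_def using Sg[OF that, of V] Sp[OF that, of V]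
    by (cases "U = null_tree"; cases "U = full_tree L") auto
  have acc: "(\<lambda>\<omega>. ?S \<omega> U V * accept_prob (?S \<omega>) (\<pi> \<omega>) U V) \<in> borel_measurable M"
    if "U \<in> trees L" "V \<in> trees L" for U V
    unfolding accept_prob_def using S[OF that(1)] S[OF that(2)] \<pi>[OF that(1)] \<pi>[OF that(2)]
    by (intro borel_measurable_times borel_measurable_min borel_measurable_divide borel_measurable_const)
  have "(\<lambda>\<omega>. mh_kernel (trees L) (?S \<omega>) (\<pi> \<omega>) T T') \<in> borel_measurable M"
    unfolding mh_kernel_def using acc T
    by (cases "T' = T") (auto intro!: borel_measurable_diff borel_measurable_sum)
  then show ?thesis
    unfolding informed_kernel_def lazy_kernel_def by simp
qed

lemma kernel_pow_measurable:
  assumes "finite X" and "\<And>x y. x \<in> X \<Longrightarrow> y \<in> X \<Longrightarrow> (\<lambda>\<omega>. P \<omega> x y) \<in> borel_measurable M"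
    and "x \<in> X" "y \<in> X"
  shows "(\<lambda>\<omega>. kernel_pow X (P \<omega>) t x y :: real) \<in> borel_measurable M"
  using assms(3)
proof (induction t arbitrary: x)
  case (Suc t)
  then show ?case
    using assms(2)[OF Suc.prems] by (auto intro!: borel_measurable_sum borel_measurable_times)
qed simp

lemma score_measurable: "(\<lambda>Y. score n Y v) \<in> borel_measurable (data_law n f0)"
  unfolding score_def data_law_def
  by (intro borel_measurable_sum borel_measurable_times borel_measurable_const)
    (auto intro!: measurable_component_singleton[THEN measurable_compose, of _ _ _ "\<lambda>x. x"])

lemma posterior_measurable:
  assumes n: "n = 2 ^ (Lmax + 1)" "L \<le> Lmax" and c: "0 < c" and T: "T \<in> trees L"
  shows "(\<lambda>Y. posterior (\<lambda>_. real n powr (- c)) n L Y T) \<in> borel_measurable (data_law n f0)"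
proof -
  have "(\<lambda>Y. node_factor n c Y v) \<in> borel_measurable (data_law n f0)" for v
    unfolding node_factor_def using score_measurable[of n v f0] by measurable
  then show ?thesis
    unfolding posterior_eq[OF n c T] by (intro borel_measurable_divide borel_measurable_sum borel_measurable_prod)
qed

text \<open>On the trees the posterior is a continuous expression in the scores, and the kernel is built
  from it by finitely many arithmetic operations.\<close>

lemma mixing_event_measurable:
  assumes n: "n = 2 ^ (Lmax + 1)" "L \<le> Lmax" and c: "0 < c"
    and N: "\<And>T. T \<in> trees L \<Longrightarrow> Ng L T \<subseteq> trees L" "\<And>T. T \<in> trees L \<Longrightarrow> Np L T \<subseteq> trees L"
  shows "{Y \<in> space (data_law n f0).
     ereal_of_enat (informed_mixing_time Ng Np n L A c Y \<epsilon>) \<le> ereal b} \<in> sets (data_law n f0)"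
proof -
  let ?\<pi> = "\<lambda>Y. posterior (\<lambda>_. real n powr (- c)) n L Y"
  let ?d = "\<lambda>Y t x. tv_dist (trees L) (kernel_pow (trees L) (informed_kernel Ng Np n L A c (?\<pi> Y)) t x) (?\<pi> Y)"
  have "trees L \<noteq> {}" using target_tree[of "{}" L] by auto
  then have iff: "ereal_of_enat (informed_mixing_time Ng Np n L A c Y \<epsilon>) \<le> ereal b \<longleftrightarrow>
      (\<forall>x\<in>trees L. \<exists>t. real t \<le> b \<and> (\<forall>t'. t' \<ge> t \<longrightarrow> ?d Y t' x \<le> \<epsilon>))" for Y
    unfolding informed_mixing_time_def Let_def by (subst mixing_time_le_iff[OF finite_trees]) auto
  have d: "(\<lambda>Y. ?d Y t x) \<in> borel_measurable (data_law n f0)" if "x \<in> trees L" for t x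
    unfolding tv_dist_def
    by (intro borel_measurable_divide borel_measurable_sum borel_measurable_abs borel_measurable_diff
        borel_measurable_const kernel_pow_measurable[OF finite_trees] informed_kernel_measurable
        posterior_measurable[OF n c] N that)
  have "Measurable.pred (data_law n f0) (\<lambda>Y. \<exists>t. real t \<le> b \<and> (\<forall>t'. t' \<ge> t \<longrightarrow> ?d Y t' x \<le> \<epsilon>))"
    if "x \<in> trees L" for x
    using d[OF that] by measurable
  then have "Measurable.pred (data_law n f0)
      (\<lambda>Y. \<forall>x\<in>trees L. \<exists>t. real t \<le> b \<and> (\<forall>t'. t' \<ge> t \<longrightarrow> ?d Y t' x \<le> \<epsilon>))"
    by (intro pred_intros_finite finite_trees)
  then show ?thesis unfolding iff by (simp add: pred_def)
qed

definition noise_event :: "nat \<Rightarrow> nat \<Rightarrow> (real \<Rightarrow> real) \<Rightarrow> (nat \<Rightarrow> real) set" where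
  "noise_event n L f0 = {Y \<in> space (data_law n f0). \<forall>v\<in>nodes L.
     \<bar>score n Y v - score n (\<lambda>i. f0 (real i / real n)) v\<bar> \<le> 2 * sqrt (real n * ln (real n))}"

text \<open>With the threshold \<open>2 sqrt (n ln n)\<close> each one-sided tail is at most \<open>1 / n\<^sup>2\<close>, and there are
  \<open>2 * 2\<^sup>L \<le> n\<close> of them.\<close>

lemma noise_event_prob:
  assumes n: "n = 2 ^ (Lmax + 1)" and L: "L \<le> Lmax"
  shows "noise_event n L f0 \<in> sets (data_law n f0)"
    and "1 - 1 / real n \<le> measure (data_law n f0) (noise_event n L f0)"
proof -
  let ?M = "data_law n f0" and ?\<mu> = "\<lambda>i. f0 (real i / real n)" and ?t = "2 * sqrt (real n * ln (real n))"
  interpret prob_space ?M by (rule prob_space_data_law)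
  show E: "noise_event n L f0 \<in> sets ?M"
    unfolding noise_event_def
    using score_measurable[of n _ f0] finite_nodes[of L] by measurable
  have n1: "2 \<le> real n"
  proof -
    have "(1::real) \<le> 2 ^ Lmax" by simp
    then show ?thesis by (simp add: n del: one_le_power)
  qed
  then have t: "0 < ?t" by simp
  have diff: "score n Y v - score n ?\<mu> v = (\<Sum>i=1..n. design n i v * (Y i - ?\<mu> i))" for Y v
    by (simp add: score_def right_diff_distrib sum_subtractf)
  let ?A = "\<lambda>\<sigma> v. {Y \<in> space ?M. ?t \<le> (\<Sum>i=1..n. (\<sigma> * design n i v) * (Y i - ?\<mu> i))}"
  have A_sets: "?A \<sigma> v \<in> sets ?M" for \<sigma> v
  proof -
    have "(\<Sum>i=1..n. (\<sigma> * design n i v) * (Y i - ?\<mu> i)) = \<sigma> * (score n Y v - score n ?\<mu> v)" for Y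
      unfolding diff by (simp add: sum_distrib_left mult.assoc)
    then show ?thesis using score_measurable[of n v f0] by simp
  qed
  have A_prob: "measure ?M (?A \<sigma> v) \<le> 1 / (real n)\<^sup>2" if v: "v \<in> nodes L" and \<sigma>: "\<sigma>\<^sup>2 = 1" for \<sigma> v
  proof -
    have "(\<sigma> * design n i v)\<^sup>2 = design n i v * design n i v" for i
      unfolding power_mult_distrib \<sigma> by (simp add: power2_eq_square)
    then have "(\<Sum>i=1..n. (\<sigma> * design n i v)\<^sup>2) = real n"
      using design_orthogonal[OF n L v v] by simp
    then have "measure ?M (?A \<sigma> v) \<le> exp (- ?t\<^sup>2 / (2 * real n))"
      using n1 t by (intro chernoff_linear) auto
    also have "- ?t\<^sup>2 / (2 * real n) = - 2 * ln (real n)"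
      using n1 by (simp add: power_mult_distrib)
    also have "exp (- 2 * ln (real n)) = 1 / (real n)\<^sup>2"
      using n1 by (simp add: exp_minus exp_double field_simps)
    finally show ?thesis .
  qed
  have "space ?M - noise_event n L f0 \<subseteq> (\<Union>v\<in>nodes L. ?A 1 v \<union> ?A (-1) v)"
  proof
    fix Y assume Y: "Y \<in> space ?M - noise_event n L f0"
    then obtain v where v: "v \<in> nodes L" "?t < \<bar>score n Y v - score n ?\<mu> v\<bar>"
      unfolding noise_event_def by (auto simp: not_le)
    then have "?t \<le> score n Y v - score n ?\<mu> v \<or> ?t \<le> - (score n Y v - score n ?\<mu> v)" by linarith
    then have "Y \<in> ?A 1 v \<union> ?A (-1) v"
      using Y unfolding diff by (auto simp: sum_negf)
    then show "Y \<in> (\<Union>v\<in>nodes L. ?A 1 v \<union> ?A (-1) v)" using v by blast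
  qed
  then have "prob (space ?M - noise_event n L f0) \<le> prob (\<Union>v\<in>nodes L. ?A 1 v \<union> ?A (-1) v)"
    by (rule finite_measure_mono) (intro sets.finite_UN sets.Un finite_nodes A_sets)
  also have "\<dots> \<le> (\<Sum>v\<in>nodes L. prob (?A 1 v \<union> ?A (-1) v))"
    by (intro finite_measure_subadditive_finite finite_nodes image_subsetI sets.Un A_sets)
  also have "\<dots> \<le> (\<Sum>v\<in>nodes L. 2 / (real n)\<^sup>2)"
  proof (intro sum_mono)
    fix v assume v: "v \<in> nodes L"
    have "prob (?A 1 v \<union> ?A (-1) v) \<le> prob (?A 1 v) + prob (?A (-1) v)"
      by (intro measure_Un_le A_sets)
    also have "\<dots> \<le> 1 / (real n)\<^sup>2 + 1 / (real n)\<^sup>2"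
      by (intro add_mono A_prob v) auto
    finally show "prob (?A 1 v \<union> ?A (-1) v) \<le> 2 / (real n)\<^sup>2" by simp
  qed
  also have "\<dots> = 2 * 2 ^ L / (real n)\<^sup>2" by (simp add: card_nodes)
  also have "\<dots> \<le> real n / (real n)\<^sup>2"
  proof (intro divide_right_mono)
    have "(2::real) ^ L \<le> 2 ^ Lmax" using L by (intro power_increasing) auto
    then show "2 * 2 ^ L \<le> real n" by (simp add: n)
  qed simp
  also have "\<dots> = 1 / real n" by (simp add: power2_eq_square)
  finally show "1 - 1 / real n \<le> measure ?M (noise_event n L f0)"
    using prob_compl[OF E] by simp
qed

section \<open>The mixing bound\<close>

text \<open>The inequalities in \<open>x = n\<close> that make the sample large enough.  In the order of the conjuncts
  from the third on: the signal dominates the noise in a score, its square keeps half of its leading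
  term \<open>A\<^sup>2 (ln x)\<^sup>2 / 2\<close>, the bad moves are rare, and \<open>8 t\<^sub>0 / 2\<^sup>L\<close> fits under the claimed bound.  The level
  \<open>L\<close> enters through \<open>L \<le> 3/2 ln x\<close>.\<close>

definition large_sample :: "real \<Rightarrow> real \<Rightarrow> real \<Rightarrow> real \<Rightarrow> bool" where
  "large_sample c A Cf x \<longleftrightarrow> 8 \<le> x \<and> c \<le> ln x \<and> 2 * sqrt (ln x) \<le> A * ln x \<and>
     A\<^sup>2 / 4 * (ln x)\<^sup>2 \<le> x / (2 * (1 + x)) * (A * ln x - 2 * sqrt (ln x))\<^sup>2 \<and>
     12 * ln x / sqrt x + 4 * x\<^sup>2 * (3/2 * ln x + 2) / exp ((ln x)\<^sup>2) \<le> 1 \<and>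
     256 * (3/2 * ln x + 2) \<le> 9 * (Cf + 2)\<^sup>2 / A\<^sup>2 * (x / (ln x)\<^sup>2)"

lemma eventually_large_sample:
  assumes A: "0 < A" and Cf: "0 < Cf"
  shows "\<forall>\<^sub>F x in at_top. large_sample c A Cf x"
proof -
  have K: "0 < 9 * (Cf + 2)\<^sup>2 / A\<^sup>2" using assms by simp
  have "\<forall>\<^sub>F x :: real in at_top. 8 \<le> x" by real_asymp
  moreover have "\<forall>\<^sub>F x :: real in at_top. c \<le> ln x" by real_asymp
  moreover have "\<forall>\<^sub>F x :: real in at_top. 2 * sqrt (ln x) \<le> A * ln x" using A by real_asymp
  moreover have "\<forall>\<^sub>F x :: real in at_top.
      A\<^sup>2 / 4 * (ln x)\<^sup>2 \<le> x / (2 * (1 + x)) * (A * ln x - 2 * sqrt (ln x))\<^sup>2"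
    using A by real_asymp
  moreover have "\<forall>\<^sub>F x :: real in at_top.
      12 * ln x / sqrt x + 4 * x\<^sup>2 * (3/2 * ln x + 2) / exp ((ln x)\<^sup>2) \<le> 1" by real_asymp
  moreover have "\<forall>\<^sub>F x :: real in at_top.
      256 * (3/2 * ln x + 2) \<le> 9 * (Cf + 2)\<^sup>2 / A\<^sup>2 * (x / (ln x)\<^sup>2)"
    using K unfolding times_divide_eq_right[symmetric] by real_asymp
  ultimately show ?thesis by eventually_elim (simp only: large_sample_def simp_thms)
qed


lemma level_le_ln:
  assumes n: "n = 2 ^ (Lmax + 1)" and "L \<le> Lmax"
  shows "real L \<le> 3/2 * ln (real n)"
proof -
  have "ln (real n) = real (Lmax + 1) * ln 2"
    unfolding n of_nat_power of_nat_numeral by (rule ln_realpow)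
  moreover have "real (Lmax + 1) * (2/3) \<le> real (Lmax + 1) * ln 2"
    using ln2_ge_two_thirds by (intro mult_left_mono) auto
  ultimately show ?thesis using assms(2) by simp
qed

text \<open>Here \<open>A\<^sup>2/4\<close> in the exponent comes from one signal, and \<open>3/2 (c + 1)\<close> from at most
  \<open>L \<le> 3/2 ln n\<close> nodes that each contribute a factor of at least \<open>n powr (- (c + 1))\<close>.  The lower
  bound on \<open>A\<^sup>2\<close> leaves \<open>A\<^sup>2/8\<close>, the exponent of the cap, and \<open>1\<close> more, which beats all
  powers of \<open>n\<close>.\<close>

lemma informed_moves_on_noise_event:
  fixes \<beta> :: "node \<Rightarrow> real"
  assumes n: "n = 2 ^ (Lmax + 1)" and L: "L \<le> Lmax" and c: "3 < c"
    and A: "0 < A" "12 * (c + 1) + 8 \<le> A\<^sup>2" and large: "large_sample c A Cf (real n)"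
    and moves: "tree_moves L Ng Np B"
    and f0: "\<And>x. x \<in> {0..1} \<Longrightarrow> f0 x = (\<Sum>v\<in>B. \<beta> v * haar v x)"
    and \<beta>: "\<And>v. v \<in> B \<Longrightarrow> A * ln (real n) / sqrt (real n) < \<bar>\<beta> v\<bar>"
    and Y: "Y \<in> noise_event n L f0"
  shows "informed_moves L Ng Np B n A c (posterior (\<lambda>_. real n powr (- c)) n L Y)
    (node_factor n c Y) (exp ((A\<^sup>2 / 4 - 3/2 * (c + 1)) * (ln (real n))\<^sup>2))"
proof -
  interpret tree_moves L Ng Np B by (rule moves)
  let ?x = "real n" and ?l = "ln (real n)"
  let ?\<Gamma> = "exp ((A\<^sup>2 / 4 - 3/2 * (c + 1)) * ?l\<^sup>2)"
  have x: "8 \<le> ?x" and l: "c \<le> ?l" and dom: "2 * sqrt ?l \<le> A * ?l"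
    and quad: "A\<^sup>2 / 4 * ?l\<^sup>2 \<le> ?x / (2 * (1 + ?x)) * (A * ?l - 2 * sqrt ?l)\<^sup>2"
    and small: "12 * ?l / sqrt ?x + 4 * ?x\<^sup>2 * (3/2 * ?l + 2) / exp (?l\<^sup>2) \<le> 1"
    using large unfolding large_sample_def by blast+
  have l3: "3 < ?l" using l c by simp
  have pw: "?x powr a = exp (a * ?l)" for a using x by (simp add: powr_def)
  have NL: "2 * 2 ^ L \<le> ?x"
  proof -
    have "(2::real) ^ L \<le> 2 ^ Lmax" using L by (intro power_increasing) auto
    then show ?thesis by (simp add: n)
  qed
  note Ll = level_le_ln[OF n L]
  define q where "q = ?x powr (- c)"
  have q: "0 < q" "q \<le> 1/2"
  proof -
    show "0 < q" using x by (simp add: q_def)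
    have "q \<le> ?x powr (-1)" unfolding q_def using c x by (intro powr_mono) auto
    also have "\<dots> = 1 / ?x" by (simp add: powr_minus_divide)
    also have "\<dots> \<le> 1 / 8" using x by (intro divide_left_mono) auto
    finally show "q \<le> 1/2" by simp
  qed
  have g_eq: "node_factor n c Y v = q * (1 - q) * (exp ((score n Y v)\<^sup>2 / (2 * (1 + ?x))) / sqrt (1 + ?x))" for v
    by (simp add: node_factor_def q_def)
  have g_pos: "0 < node_factor n c Y v" for v
    using q by (simp add: g_eq)
  have g_lower: "?x powr (- (c + 1)) * exp ((score n Y v)\<^sup>2 / (2 * (1 + ?x))) \<le> node_factor n c Y v" for v
  proof -
    have "sqrt (1 + ?x) \<le> ?x / 2"
      using x by (intro real_le_lsqrt) (auto simp: power2_eq_square field_simps intro: order_trans[OF _ mult_right_mono[OF x]])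
    then have "1 / ?x \<le> (1/2) / sqrt (1 + ?x)"
      using x by (simp add: field_simps)
    also have "\<dots> \<le> (1 - q) / sqrt (1 + ?x)"
      using q x by (intro divide_right_mono) auto
    finally have "q * (1 / ?x) \<le> q * ((1 - q) / sqrt (1 + ?x))"
      using q by (intro mult_left_mono) auto
    moreover have "?x powr (- (c + 1)) = q * (1 / ?x)"
      using x by (simp add: q_def powr_diff powr_minus_divide field_simps powr_add)
    ultimately have "?x powr (- (c + 1)) \<le> q * ((1 - q) / sqrt (1 + ?x))" by simp
    then have "?x powr (- (c + 1)) * exp ((score n Y v)\<^sup>2 / (2 * (1 + ?x)))
        \<le> q * ((1 - q) / sqrt (1 + ?x)) * exp ((score n Y v)\<^sup>2 / (2 * (1 + ?x)))"
      by (intro mult_right_mono) auto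
    then show ?thesis by (simp add: g_eq mult_ac)
  qed
  have g_lower': "?x powr (- (c + 1)) \<le> node_factor n c Y v" for v
    using g_lower[of v] mult_left_mono[of 1 "exp ((score n Y v)\<^sup>2 / (2 * (1 + ?x)))" "?x powr (- (c + 1))"]
    by simp
  have noise_le: "\<bar>score n Y v - score n (\<lambda>i. f0 (real i / ?x)) v\<bar> \<le> 2 * sqrt (?x * ?l)"
    if "v \<in> nodes L" for v
    using Y that unfolding noise_event_def by blast
  have mean: "score n (\<lambda>i. f0 (real i / ?x)) v = (if v \<in> B then ?x * \<beta> v else 0)"
    if v: "v \<in> nodes L" for v
  proof -
    have "score n (\<lambda>i. f0 (real i / ?x)) v = (\<Sum>i=1..n. design n i v * (\<Sum>w\<in>B. \<beta> w * design n i w))"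
      unfolding score_def by (intro sum.cong refl) (subst f0, auto simp: design_def divide_le_eq_1)
    also have "\<dots> = (\<Sum>w\<in>B. \<Sum>i=1..n. \<beta> w * (design n i v * design n i w))"
      by (simp only: sum_distrib_left mult.left_commute) (rule sum.swap)
    also have "\<dots> = (\<Sum>w\<in>B. if v = w then \<beta> w * ?x else 0)"
      using design_orthogonal[OF n L v] signal_nodes
      by (intro sum.cong refl, subst sum_distrib_left[symmetric], subst design_orthogonal[OF n L v]) auto
    also have "\<dots> = (if v \<in> B then ?x * \<beta> v else 0)" using finite_signals by simp
    finally show ?thesis .
  qed
  have g_noise: "node_factor n c Y v \<le> 1 / ?x powr (c - 3/2)" if v: "v \<in> nodes L - B" for v
  proof -
    have "\<bar>score n Y v\<bar> \<le> 2 * sqrt (?x * ?l)" using noise_le[of v] mean[of v] v by simp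
    then have "(score n Y v)\<^sup>2 \<le> (2 * sqrt (?x * ?l))\<^sup>2" by (metis abs_ge_zero power2_abs power_mono)
    also have "\<dots> = 4 * (?x * ?l)" using x l3 by (simp add: power_mult_distrib)
    also have "\<dots> \<le> 2 * ?l * (2 * (1 + ?x))" using l3 by (simp add: algebra_simps)
    finally have "(score n Y v)\<^sup>2 / (2 * (1 + ?x)) \<le> 2 * ?l"
      using x by (simp add: pos_divide_le_eq)
    then have e: "exp ((score n Y v)\<^sup>2 / (2 * (1 + ?x))) \<le> ?x powr 2" by (simp add: pw)
    have "1 / sqrt (1 + ?x) \<le> 1 / sqrt ?x" using x by (intro divide_left_mono) auto
    also have "\<dots> = ?x powr (-1/2)" using x by (simp add: powr_half_sqrt powr_minus_divide)
    finally have "exp ((score n Y v)\<^sup>2 / (2 * (1 + ?x))) * (1 / sqrt (1 + ?x)) \<le> ?x powr 2 * ?x powr (-1/2)"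
      using e x by (intro mult_mono) auto
    then have "q * (1 - q) * (exp ((score n Y v)\<^sup>2 / (2 * (1 + ?x))) * (1 / sqrt (1 + ?x)))
        \<le> q * 1 * (?x powr 2 * ?x powr (-1/2))"
      by (rule mult_mono[rotated]) (use q in simp_all)
    also have "\<dots> = ?x powr (- c + (2 + -1/2))" by (simp only: q_def powr_add mult_1_right)
    also have "\<dots> = 1 / ?x powr (c - 3/2)"
      by (subst powr_minus_divide[symmetric]) (simp add: algebra_simps)
    finally show ?thesis by (simp add: g_eq)
  qed
  have g_signal: "?x powr (- (c + 1)) * exp (A\<^sup>2 / 4 * ?l\<^sup>2) \<le> node_factor n c Y v" if v: "v \<in> B" for v
  proof -
    have vn: "v \<in> nodes L" using v signal_nodes by blast
    have "sqrt ?x * (A * ?l) = (?x / sqrt ?x) * (A * ?l)" using x by (simp only: real_div_sqrt of_nat_0_le_iff)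
    also have "\<dots> = ?x * (A * ?l / sqrt ?x)" by simp
    also have "\<dots> \<le> ?x * \<bar>\<beta> v\<bar>"
      using \<beta>[OF v] by (intro mult_left_mono) auto
    also have "\<dots> = \<bar>?x * \<beta> v\<bar>" by (simp add: abs_mult)
    also have "\<dots> \<le> \<bar>score n Y v\<bar> + 2 * sqrt (?x * ?l)"
      using noise_le[OF vn] mean[OF vn] v by simp
    \<comment> \<open>The mean \<open>n \<beta>\<^sub>v\<close> of the score, of size at least \<open>sqrt n A ln n\<close>, against the noise.\<close>
    finally have "sqrt ?x * (A * ?l - 2 * sqrt ?l) \<le> \<bar>score n Y v\<bar>"
      by (simp add: real_sqrt_mult algebra_simps)
    then have "(sqrt ?x * (A * ?l - 2 * sqrt ?l))\<^sup>2 \<le> \<bar>score n Y v\<bar>\<^sup>2"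
      using dom by (intro power_mono) auto
    then have "?x * (A * ?l - 2 * sqrt ?l)\<^sup>2 \<le> (score n Y v)\<^sup>2"
      by (simp add: power_mult_distrib)
    then have "?x * (A * ?l - 2 * sqrt ?l)\<^sup>2 / (2 * (1 + ?x)) \<le> (score n Y v)\<^sup>2 / (2 * (1 + ?x))"
      by (intro divide_right_mono) auto
    then have "A\<^sup>2 / 4 * ?l\<^sup>2 \<le> (score n Y v)\<^sup>2 / (2 * (1 + ?x))"
      by (intro order_trans[OF quad]) simp
    then have "?x powr (- (c + 1)) * exp (A\<^sup>2 / 4 * ?l\<^sup>2) \<le>
        ?x powr (- (c + 1)) * exp ((score n Y v)\<^sup>2 / (2 * (1 + ?x)))"
      by (intro mult_left_mono) auto
    then show ?thesis using g_lower[of v] by linarith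
  qed
  have signal: "?\<Gamma> \<le> prod (node_factor n c Y) D"
    if D: "D \<subseteq> nodes L" "D \<inter> B \<noteq> {}" "card D \<le> L" for D
  proof -
    obtain v where v: "v \<in> D" "v \<in> B" using D(2) by blast
    have fin: "finite D" using D(1) finite_nodes finite_subset by blast
    let ?m = "?x powr (- (c + 1))"
    have m: "0 < ?m" "?m \<le> 1"
    proof -
      show "0 < ?m" using x by simp
      have "?m \<le> ?x powr 0" using c x by (intro powr_mono) auto
      then show "?m \<le> 1" using x by simp
    qed
    have cardD: "card D = Suc (card (D - {v}))"
      using fin v(1) by (metis card.remove)
    have "(A\<^sup>2 / 4 - 3/2 * (c + 1)) * ?l\<^sup>2 = A\<^sup>2 / 4 * ?l\<^sup>2 - (c + 1) * ?l * (3/2 * ?l)"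
      by (simp add: power2_eq_square algebra_simps)
    also have "\<dots> \<le> A\<^sup>2 / 4 * ?l\<^sup>2 - (c + 1) * ?l * real L"
      using Ll c l3 by (intro diff_left_mono mult_left_mono) auto
    finally have "?\<Gamma> \<le> exp (A\<^sup>2 / 4 * ?l\<^sup>2 - (c + 1) * ?l * real L)" by simp
    also have "\<dots> = ?m ^ L * exp (A\<^sup>2 / 4 * ?l\<^sup>2)"
    proof -
      have "?m ^ L = exp (real L * (- (c + 1) * ?l))" unfolding pw by (rule exp_of_nat_mult[symmetric])
      then have "?m ^ L * exp (A\<^sup>2 / 4 * ?l\<^sup>2) = exp (real L * (- (c + 1) * ?l) + A\<^sup>2 / 4 * ?l\<^sup>2)"
        by (simp only: exp_add)
      then show ?thesis by (simp add: algebra_simps)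
    qed
    also have "\<dots> \<le> ?m ^ card D * exp (A\<^sup>2 / 4 * ?l\<^sup>2)"
      using m D(3) by (intro mult_right_mono power_decreasing) auto
    also have "\<dots> = (?m * exp (A\<^sup>2 / 4 * ?l\<^sup>2)) * ?m ^ card (D - {v})"
      by (simp add: cardD)
    also have "\<dots> \<le> node_factor n c Y v * (\<Prod>w\<in>D - {v}. node_factor n c Y w)"
    proof (intro mult_mono g_signal v(2))
      have "(\<Prod>w\<in>D - {v}. ?m) \<le> (\<Prod>w\<in>D - {v}. node_factor n c Y w)"
        using m g_lower' by (intro prod_mono) auto
      then show "?m ^ card (D - {v}) \<le> (\<Prod>w\<in>D - {v}. node_factor n c Y w)" by simp
    qed (use m less_imp_le[OF g_pos[of v]] in simp_all)
    also have "\<dots> = prod (node_factor n c Y) D"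
      using fin v(1) by (rule prod.remove[symmetric])
    finally show ?thesis .
  qed
  have \<Gamma>: "exp (A\<^sup>2 * ?l\<^sup>2 / 8) \<le> ?\<Gamma>" "exp (?l\<^sup>2) \<le> ?\<Gamma>"
  proof -
    have "A\<^sup>2 / 8 + 1 \<le> A\<^sup>2 / 4 - 3/2 * (c + 1)" using A(2) by (simp add: field_simps)
    then have le: "(A\<^sup>2 / 8 + 1) * ?l\<^sup>2 \<le> (A\<^sup>2 / 4 - 3/2 * (c + 1)) * ?l\<^sup>2"
      by (intro mult_right_mono) auto
    have "A\<^sup>2 * ?l\<^sup>2 / 8 \<le> (A\<^sup>2 / 8 + 1) * ?l\<^sup>2" "?l\<^sup>2 \<le> (A\<^sup>2 / 8 + 1) * ?l\<^sup>2"
      by (simp_all add: algebra_simps)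
    then show "exp (A\<^sup>2 * ?l\<^sup>2 / 8) \<le> ?\<Gamma>" "exp (?l\<^sup>2) \<le> ?\<Gamma>"
      using order_trans[OF _ le] unfolding exp_le_cancel_iff by blast+
  qed
  have \<kappa>: "?x powr (3/2) \<le> ?x powr (c - 3/2)" using c x by (intro powr_mono) auto
  have x32: "?x powr (3/2) = ?x * sqrt ?x"
  proof -
    have "?x powr (3/2) = ?x powr (1 + 1/2)" by simp
    also have "\<dots> = ?x * sqrt ?x" unfolding powr_add using x by (simp add: powr_half_sqrt)
    finally show ?thesis .
  qed
  show ?thesis
  proof (unfold_locales)
    show "0 < n" using x by simp
    have tot: "0 < (\<Sum>T'\<in>trees L. prod (node_factor n c Y) T')"
      using target_tree[OF signal_nodes] finite_trees g_pos by (intro sum_pos prod_pos) auto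
    have c0: "0 < c" using c by simp
    show "0 < posterior (\<lambda>_. ?x powr - c) n L Y T" if "T \<in> trees L" for T
      using tot g_pos by (simp add: posterior_eq[OF n L c0 that] prod_pos)
    have "(\<Sum>T\<in>trees L. posterior (\<lambda>_. ?x powr - c) n L Y T) =
        (\<Sum>T\<in>trees L. prod (node_factor n c Y) T / (\<Sum>T'\<in>trees L. prod (node_factor n c Y) T'))"
      by (intro sum.cong refl posterior_eq[OF n L c0])
    then show "(\<Sum>T\<in>trees L. posterior (\<lambda>_. ?x powr - c) n L Y T) = 1"
      using tot by (simp flip: sum_divide_distrib)
    show "posterior (\<lambda>_. ?x powr - c) n L Y T' =
        posterior (\<lambda>_. ?x powr - c) n L Y T * prod (node_factor n c Y) (T' - T)"
      if "T \<in> trees L" "T' \<in> trees L" "T \<subseteq> T'" for T T'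
      using prod.subset_diff[OF that(3) finite_tree[OF that(2)], of "node_factor n c Y"]
      by (simp add: posterior_eq[OF n L c0 that(1)] posterior_eq[OF n L c0 that(2)])
    show "0 < node_factor n c Y v" for v by (rule g_pos)
    show "node_factor n c Y v \<le> 1 / ?x powr (c - 3/2)" if "v \<in> nodes L - B" for v
      by (rule g_noise[OF that])
    show "?\<Gamma> \<le> prod (node_factor n c Y) D" if "D \<subseteq> nodes L" "D \<inter> B \<noteq> {}" "card D \<le> L" for D
      by (rule signal[OF that])
    show "?x powr (A\<^sup>2 * ?l / 8) \<le> ?\<Gamma>"
      using \<Gamma>(1) by (simp add: pw power2_eq_square)
    have "2 * 2 ^ L * ?x powr (c - 3/2) \<le> ?x * ?x powr (c - 3/2)"
      using NL by (intro mult_right_mono) auto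
    also have "\<dots> = exp ?l * exp ((c - 3/2) * ?l)" using x by (simp add: pw)
    also have "\<dots> = exp ((c - 1/2) * ?l)" by (simp add: algebra_simps flip: exp_add)
    also have "\<dots> \<le> exp (?l * ?l)" using l l3 by (auto intro!: mult_right_mono)
    also have "\<dots> \<le> ?\<Gamma>" using \<Gamma>(2) by (simp add: power2_eq_square)
    finally show "2 * 2 ^ L * ?x powr (c - 3/2) \<le> ?\<Gamma>" .
    have "?x powr 1 \<le> ?x powr (c - 3/2)" using c x by (intro powr_mono) auto
    then show "2 * 2 ^ L \<le> ?x powr (c - 3/2)" using NL x by simp
    have "2 ^ L / ?x powr (c - 3/2) * (16 * real L) \<le> (?x / 2) / ?x powr (3/2) * (16 * (3/2 * ?l))"
      using NL \<kappa> Ll x by (intro mult_mono frac_le) auto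
    also have "\<dots> = 12 * ?l / sqrt ?x" unfolding x32 using x by (simp add: field_simps)
    finally have 1: "2 ^ L / ?x powr (c - 3/2) * (16 * real L) \<le> 12 * ?l / sqrt ?x" .
    have "2 ^ L / ?\<Gamma> * (16 * (real (L + 2) * 2 ^ L)) \<le>
        (?x / 2) / exp (?l\<^sup>2) * (16 * ((3/2 * ?l + 2) * (?x / 2)))"
      using NL \<Gamma>(2) Ll x l3 by (intro mult_mono frac_le) auto
    also have "\<dots> = 4 * ?x\<^sup>2 * (3/2 * ?l + 2) / exp (?l\<^sup>2)"
      by (simp add: field_simps power2_eq_square)
    finally show "2 ^ L / ?x powr (c - 3/2) * (16 * real L) +
        2 ^ L / ?\<Gamma> * (16 * (real (L + 2) * 2 ^ L)) \<le> 1"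
      using 1 small by linarith
  qed
qed

text \<open>The potential is at most \<open>16 (L + 2) 2\<^sup>L\<close>, so \<open>t\<^sub>0 = 32 (L + 2) 2\<^sup>L\<close> is admissible in the
  drift bound.\<close>

lemma informed_mixing_probability:
  assumes n: "n = 2 ^ (Lmax + 1)" and L: "L \<le> Lmax" and c: "3 < c"
    and A: "0 < A" "12 * (c + 1) + 8 \<le> A\<^sup>2" and large: "large_sample c A Cf (real n)"
    and moves: "tree_moves L (Ng L) (Np L) B"
    and signal: "sparse_signal n L A Cf f0 B"
    and \<epsilon>: "0 < \<epsilon>" "\<epsilon> < 1"
  shows "measure (data_law n f0)
          {Y \<in> space (data_law n f0).
             ereal_of_enat (informed_mixing_time Ng Np n L A c Y \<epsilon>) \<le> ereal (1 * mixing_bound n L A Cf \<epsilon>)}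
          \<ge> 1 - 4 / real n - exp (- real n / 8)"
proof -
  let ?E = "{Y \<in> space (data_law n f0).
     ereal_of_enat (informed_mixing_time Ng Np n L A c Y \<epsilon>) \<le> ereal (mixing_bound n L A Cf \<epsilon>)}"
  let ?l = "ln (real n)"
  interpret prob_space "data_law n f0" by (rule prob_space_data_law)
  interpret tree_moves L "Ng L" "Np L" B by (rule moves)
  obtain \<beta> where f0: "\<And>x. x \<in> {0..1} \<Longrightarrow> f0 x = (\<Sum>v\<in>B. \<beta> v * haar v x)"
    and \<beta>: "\<And>v. v \<in> B \<Longrightarrow> A * ?l / sqrt (real n) < \<bar>\<beta> v\<bar>"
    using signal unfolding sparse_signal_def by blast
  have x: "8 \<le> real n" and budget: "256 * (3/2 * ?l + 2) \<le> 9 * (Cf + 2)\<^sup>2 / A\<^sup>2 * (real n / ?l\<^sup>2)"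
    using large unfolding large_sample_def by blast+
  define t0 where "t0 = 32 * (L + 2) * 2 ^ L"
  have t0: "0 < t0" "32 * (real (L + 2) * 2 ^ L) \<le> real t0" by (auto simp: t0_def)
  have ln6: "0 \<le> ln (6 / \<epsilon>)" using \<epsilon> by simp
  have bound: "8 * ln (6 / \<epsilon>) * real t0 \<le> mixing_bound n L A Cf \<epsilon>"
  proof -
    have "8 * real t0 \<le> 256 * (3/2 * ?l + 2) * 2 ^ L"
      using level_le_ln[OF n L] by (simp add: t0_def)
    also have "\<dots> \<le> 9 * (Cf + 2)\<^sup>2 / A\<^sup>2 * (real n / ?l\<^sup>2) * 2 ^ L"
      by (intro mult_right_mono budget) simp
    also have "\<dots> = 9 * (Cf + 2)\<^sup>2 / A\<^sup>2 * (2 ^ L * real n / ?l\<^sup>2)" by simp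
    finally have "ln (6 / \<epsilon>) * (8 * real t0) \<le> mixing_bound n L A Cf \<epsilon>"
      unfolding mixing_bound_def using ln6 by (intro mult_left_mono max.coboundedI1)
    then show ?thesis by (simp add: mult_ac)
  qed
  have "noise_event n L f0 \<subseteq> ?E"
  proof
    fix Y assume Y: "Y \<in> noise_event n L f0"
    let ?\<pi> = "posterior (\<lambda>_. real n powr (- c)) n L Y"
    interpret informed_moves L "Ng L" "Np L" B n A c ?\<pi> "node_factor n c Y"
      "exp ((A\<^sup>2 / 4 - 3/2 * (c + 1)) * (ln (real n))\<^sup>2)"
      by (rule informed_moves_on_noise_event[OF n L c A large moves f0 \<beta> Y])
    have "ereal_of_enat (informed_mixing_time Ng Np n L A c Y \<epsilon>) \<le> ereal (mixing_bound n L A Cf \<epsilon>)"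
      unfolding informed_mixing_time_def Let_def
    proof (subst mixing_time_le_iff[OF finite_trees])
      show "trees L \<noteq> {}" using target_tree[OF signal_nodes] by auto
      show "\<forall>T\<in>trees L. \<exists>t. real t \<le> mixing_bound n L A Cf \<epsilon> \<and> (\<forall>t'\<ge>t.
          tv_dist (trees L) (kernel_pow (trees L) (informed_kernel Ng Np n L A c ?\<pi>) t' T) ?\<pi> \<le> \<epsilon>)"
      proof (intro ballI exI conjI allI impI)
        let ?t = "nat \<lfloor>8 * ln (6 / \<epsilon>) * real t0\<rfloor>"
        have nonneg: "0 \<le> 8 * ln (6 / \<epsilon>) * real t0" using ln6 by simp
        then show "real ?t \<le> mixing_bound n L A Cf \<epsilon>"
          using bound of_nat_floor[OF nonneg] by linarith
        fix T t' assume T: "T \<in> trees L" and "?t \<le> t'"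
        then have "8 * ln (6 / \<epsilon>) * real t0 \<le> real t' + 1" by linarith
        then show "tv_dist (trees L) (kernel_pow (trees L) (informed_kernel Ng Np n L A c ?\<pi>) t' T) ?\<pi> \<le> \<epsilon>"
          unfolding informed_kernel_def by (rule informed_tv_bound[OF \<epsilon> t0 T])
      qed
    qed
    then show "Y \<in> ?E" using Y by (simp add: noise_event_def)
  qed
  moreover have "?E \<in> events"
  proof (rule mixing_event_measurable[OF n L])
    show "0 < c" using c by simp
    show "Ng L T \<subseteq> trees L" "Np L T \<subseteq> trees L" if "T \<in> trees L" for T
      using grow_tree[OF that] prune_tree[OF that] by blast+
  qed
  ultimately have "prob (noise_event n L f0) \<le> prob ?E" by (intro finite_measure_mono)
  moreover have "1 / real n \<le> 4 / real n" by (intro divide_right_mono) auto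
  moreover have "0 < exp (- real n / 8)" by simp
  ultimately have "1 - 4 / real n - exp (- real n / 8) \<le> prob ?E"
    using noise_event_prob(2)[OF n L, of f0] by linarith
  then show ?thesis by simp
qed

lemma eventually_informed_mixing_probability:
  fixes L :: "nat \<Rightarrow> nat"
  assumes c: "3 < c" and A0: "4 * (c + 1) \<le> A" and Cf: "0 < Cf"
    and L: "\<forall>Lmax. L Lmax \<le> Lmax" "filterlim L at_top at_top"
  shows "\<forall>\<^sub>F Lmax in at_top. \<forall>n f0 \<epsilon> B Ng Np. n = 2 ^ (Lmax + 1) \<longrightarrow> 0 < \<epsilon> \<longrightarrow> \<epsilon> < 1 \<longrightarrow>
      sparse_signal n (L Lmax) A Cf f0 B \<longrightarrow>
      (0 < L Lmax \<longrightarrow> tree_moves (L Lmax) (Ng (L Lmax)) (Np (L Lmax)) B) \<longrightarrow>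
      measure (data_law n f0)
        {Y \<in> space (data_law n f0).
           ereal_of_enat (informed_mixing_time Ng Np n (L Lmax) A c Y \<epsilon>)
             \<le> ereal (1 * mixing_bound n (L Lmax) A Cf \<epsilon>)}
        \<ge> 1 - 4 / real n - exp (- real n / 8)"
proof -
  have A: "0 < A" using A0 c by simp
  have A2: "12 * (c + 1) + 8 \<le> A\<^sup>2"
  proof -
    have "12 * (c + 1) + 8 \<le> (4 * (c + 1)) * 4" using c by simp
    also have "\<dots> \<le> A * A" using A0 c by (intro mult_mono) auto
    finally show ?thesis by (simp add: power2_eq_square)
  qed
  have "filterlim (\<lambda>Lmax :: nat. 2 ^ (Lmax + 1) :: real) at_top at_top" by real_asymp
  then have "\<forall>\<^sub>F Lmax in at_top. large_sample c A Cf (2 ^ (Lmax + 1))"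
    using eventually_large_sample[OF A Cf, of c] unfolding filterlim_iff by blast
  moreover have "\<forall>\<^sub>F Lmax in at_top. 0 < L Lmax"
    using L(2)[unfolded filterlim_at_top, rule_format, of 1] by eventually_elim simp
  ultimately show ?thesis
  proof eventually_elim
    case (elim Lmax)
    show ?case
    proof (intro allI impI)
      fix n :: nat and f0 :: "real \<Rightarrow> real" and \<epsilon> :: real and B :: "node set"
        and Ng Np :: "nat \<Rightarrow> tree \<Rightarrow> tree set"
      assume n: "n = 2 ^ (Lmax + 1)" and \<epsilon>: "0 < \<epsilon>" "\<epsilon> < 1"
        and B: "sparse_signal n (L Lmax) A Cf f0 B"
        and moves: "0 < L Lmax \<longrightarrow> tree_moves (L Lmax) (Ng (L Lmax)) (Np (L Lmax)) B"
      have large: "large_sample c A Cf (real n)" using elim(1) by (simp add: n)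
      have LL: "L Lmax \<le> Lmax" using L(1) by blast
      show "measure (data_law n f0)
        {Y \<in> space (data_law n f0).
           ereal_of_enat (informed_mixing_time Ng Np n (L Lmax) A c Y \<epsilon>)
             \<le> ereal (1 * mixing_bound n (L Lmax) A Cf \<epsilon>)}
        \<ge> 1 - 4 / real n - exp (- real n / 8)"
        by (rule informed_mixing_probability[where Ng = Ng and Np = Np and L = "L Lmax",
            OF n LL c A A2 large moves[rule_format, OF elim(2)] B \<epsilon>])
    qed
  qed
qed

theorem theorem5:
  fixes c :: real
  assumes "c > 3"
  shows "\<exists>A0>0. \<exists>C>0. \<forall>A\<ge>A0. \<forall>Cf>0. \<forall>L :: nat \<Rightarrow> nat.
    (\<forall>Lmax. L Lmax \<le> Lmax) \<longrightarrow> filterlim L at_top at_top \<longrightarrow>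
    (\<forall>\<^sub>F Lmax in at_top. \<forall>n f0 \<epsilon>. n = 2 ^ (Lmax + 1) \<longrightarrow> 0 < \<epsilon> \<longrightarrow> \<epsilon> < 1 \<longrightarrow>
      (assumption_Fa n (L Lmax) A Cf f0 \<or> assumption_Fb n (L Lmax) A Cf f0 \<longrightarrow>
        measure (data_law n f0)
          {Y \<in> space (data_law n f0).
             ereal_of_enat (informed_twiggy_mixing_time n (L Lmax) A c Y \<epsilon>)
               \<le> ereal (C * mixing_bound n (L Lmax) A Cf \<epsilon>)}
          \<ge> 1 - 4 / real n - exp (- real n / 8)) \<and>
      (assumption_Fa n (L Lmax) A Cf f0 \<longrightarrow>
        measure (data_law n f0)
          {Y \<in> space (data_law n f0).
             ereal_of_enat (informed_cart_mixing_time n (L Lmax) A c Y \<epsilon>)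
               \<le> ereal (C * mixing_bound n (L Lmax) A Cf \<epsilon>)}
          \<ge> 1 - 4 / real n - exp (- real n / 8)))"
proof (rule exI[of _ "4 * (c + 1)"], intro conjI exI[of _ 1] allI impI)
  show "0 < 4 * (c + 1)" using assms by simp
  show "(0::real) < 1" by simp
  fix A Cf :: real and L :: "nat \<Rightarrow> nat"
  assume "4 * (c + 1) \<le> A" "0 < Cf" "\<forall>Lmax. L Lmax \<le> Lmax" "filterlim L at_top at_top"
  from eventually_informed_mixing_probability[OF assms this]
  show "\<forall>\<^sub>F Lmax in at_top. \<forall>n f0 \<epsilon>. n = 2 ^ (Lmax + 1) \<longrightarrow> 0 < \<epsilon> \<longrightarrow> \<epsilon> < 1 \<longrightarrow>
      (assumption_Fa n (L Lmax) A Cf f0 \<or> assumption_Fb n (L Lmax) A Cf f0 \<longrightarrow>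
        measure (data_law n f0)
          {Y \<in> space (data_law n f0).
             ereal_of_enat (informed_twiggy_mixing_time n (L Lmax) A c Y \<epsilon>)
               \<le> ereal (1 * mixing_bound n (L Lmax) A Cf \<epsilon>)}
          \<ge> 1 - 4 / real n - exp (- real n / 8)) \<and>
      (assumption_Fa n (L Lmax) A Cf f0 \<longrightarrow>
        measure (data_law n f0)
          {Y \<in> space (data_law n f0).
             ereal_of_enat (informed_cart_mixing_time n (L Lmax) A c Y \<epsilon>)
               \<le> ereal (1 * mixing_bound n (L Lmax) A Cf \<epsilon>)}
          \<ge> 1 - 4 / real n - exp (- real n / 8))"
  proof eventually_elim
    case (elim Lmax)
    show ?case
    proof (intro allI impI conjI, goal_cases)
      case (1 n f0 \<epsilon>)
      then obtain B where B: "sparse_signal n (L Lmax) A Cf f0 B"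
        unfolding assumption_Fa_def assumption_Fb_def by blast
      then have "B \<subseteq> nodes (L Lmax)" unfolding sparse_signal_def by blast
      with elim 1(1-3) B twiggy_moves show ?case by blast
    next
      case (2 n f0 \<epsilon>)
      then obtain B where B: "sparse_signal n (L Lmax) A Cf f0 B" "B \<in> trees (L Lmax)"
        unfolding assumption_Fa_def by blast
      with elim 2(1-3) cart_moves show ?case by blast
    qed
  qed
qed

end
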